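(* Let $\mathbb K$ be a field, $R=\mathbb K[x_1,\dots,x_n]$, and let $I\subseteq R$ be the edge ideal of a wheel. Then $I$ admits a minimal pruned resolution.
   Context: The edge ideal of a simple graph on vertices $x_1,\dots,x_n$ is the ideal generated by the monomials $x_ix_j$ with $\{x_i,x_j\}$ an edge. A wheel on $n$ vertices is a cycle on $n-1$ vertices together with one further vertex, of degree $n-1$, adjacent to all vertices of the cycle. $G(I)$ denotes the set of minimal monomial generators of a monomial ideal $I$. Pruned resolutions. For a monomial ideal $I$ with minimal generators in a fixed order $m_1,\dots,m_q$ and $\sigma\subseteq\{1,\dots,q\}$ put $m_\sigma=\mathrm{lcm}(m_i: i\in\sigma)$, $m_\emptyset=1$. The Taylor resolution of $R/I$ is supported on the full simplex $X_{\mathrm{Taylor}}$ on $q$ vertices; the face $\sigma$ has homological degree $|\sigma|$ and multidegree the exponent of $m_\sigma$. Pruning algorithm: for $j=1,\dots,q$ successively (step $j$), for every $\sigma\not\ni j$ with $m_\sigma=m_{\sigma\cup\{j\}}$ and such that neither $\sigma$ nor $\sigma\cup\{j\}$ belongs to a previously selected edge, select (prune) the edge $\{\sigma,\sigma\cup\{j\}\}$. The selected edges form a homogeneous acyclic matching on $X_{\mathrm{Taylor}}$, and discrete Morse theory (Batzies–Welker) yields a $\mathbb Z^n$-graded CW-complex, with cells corresponding to the faces in no selected edge (critical faces), supporting a free resolution of $R/I$: the pruned resolution for the given order. Its module in homological degree $i$ is the direct sum of $R(-\deg m_\sigma)$ over critical $\sigma$ with $|\sigma|=i$; so it is minimal iff,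 for all $i,\alpha$, the number of critical $\sigma$ with $|\sigma|=i$ and multidegree $\alpha$ is $\beta_{i,\alpha}(R/I)$. Betti splitting version. $I=J+K$, with $G(I)$ the disjoint union of $G(J)$ and $G(K)$, is a Betti splitting if $\beta_{i,\alpha}(I)=\beta_{i,\alpha}(J)+\beta_{i,\alpha}(K)+\beta_{i-1,\alpha}(J\cap K)$ for all $i$ and $\alpha\in\mathbb Z^n$. Then one may prune separately the faces with vertices in $G(J)$, the faces with vertices in $G(K)$, and the remaining faces (which account for $J\cap K$), and iterate this using Betti splittings of $J$, $K$, $J\cap K$; this is always a partial pruning of $X_{\mathrm{Taylor}}$, and the numbers of generators (pruned Betti numbers) satisfy $\overline\beta_{i,\alpha}(I)=\overline\beta_{i,\alpha}(J)+\overline\beta_{i,\alpha}(K)+\overline\beta_{i-1,\alpha}(J\cap K)$. $I$ admits a minimal pruned resolution if, for some order of the generators, the cellular resolution given by the pruning algorithm or by its iterated Betti splitting version is minimal. Explicitly (recursively, in finitely many steps): either for some order of $G(I)$ the pruned resolution of $R/I$ is minimal, or there is a Betti splitting $I=J+K$ such that $J$, $K$ and $J\cap K$ all admit minimal pruned resolutions. *)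

theory Defs
  imports
    Complex_Main
    "HOL-Library.Poly_Mapping"
    "HOL-Library.Function_Algebras"
    "HOL-Library.Set_Algebras"
begin

text \<open>The variables are indexed by a finite type \<open>'n\<close>. A monomial is its exponent vector, so that
  divisibility is the pointwise order, and the polynomial ring is the monoid algebra of
  \<open>'n \<Rightarrow> nat\<close> over \<open>'k\<close>.\<close>

type_synonym 'n mono = "'n \<Rightarrow> nat"
type_synonym ('n, 'k) mpoly = "('n \<Rightarrow> nat) \<Rightarrow>\<^sub>0 'k"

definition monom :: "'n mono \<Rightarrow> ('n, 'k::field) mpoly" where
  "monom m = Poly_Mapping.single m 1"

definition var :: "'n \<Rightarrow> ('n, 'k::field) mpoly" where
  "var i = monom (\<lambda>j. if j = i then 1 else 0)"

abbreviation ideal_gen :: "('n, 'k::field) mpoly set \<Rightarrow> ('n, 'k) mpoly set" where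
  "ideal_gen S \<equiv> module.span (*) S"

definition monomial_ideal :: "('n, 'k::field) mpoly set \<Rightarrow> bool" where
  "monomial_ideal I \<longleftrightarrow> (\<exists>M. I = ideal_gen (monom ` M))"

definition min_gens :: "('n, 'k::field) mpoly set \<Rightarrow> 'n mono set" where
  "min_gens I = {m. monom m \<in> I \<and> (\<forall>m'. monom m' \<in> I \<longrightarrow> m' \<le> m \<longrightarrow> m' = m)}"

definition multideg :: "'n mono \<Rightarrow> 'n \<Rightarrow> int" where
  "multideg m = (\<lambda>v. int (m v))"

definition homogeneous :: "('n \<Rightarrow> int) \<Rightarrow> ('n, 'k::field) mpoly \<Rightarrow> bool" where
  "homogeneous \<alpha> p \<longleftrightarrow> (\<forall>m \<in> Poly_Mapping.keys p. multideg m = \<alpha>)"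

text \<open>Vectors of the free module of rank \<open>r\<close> are functions on \<open>nat\<close> that vanish from \<open>r\<close> on.\<close>

definition free_mod :: "nat \<Rightarrow> (nat \<Rightarrow> ('n, 'k::field) mpoly) set" where
  "free_mod r = {v. \<forall>g\<ge>r. v g = 0}"

text \<open>The linear map sending the \<open>g\<close>-th basis vector to \<open>\<Sum>h<s. D g h e\<^sub>h\<close>.\<close>

definition lin_map ::
    "nat \<Rightarrow> nat \<Rightarrow> (nat \<Rightarrow> nat \<Rightarrow> ('n, 'k::field) mpoly) \<Rightarrow> (nat \<Rightarrow> ('n, 'k) mpoly) \<Rightarrow> nat \<Rightarrow> ('n, 'k) mpoly" where
  "lin_map r s D v = (\<lambda>h. if h < s then \<Sum>g<r. v g * D g h else 0)"

text \<open>A minimal \<open>\<int>\<^sup>n\<close>-graded free resolution of the module \<open>A / B\<close>, for homogeneous ideals \<open>B \<subseteq> A\<close>: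
  \<open>\<dots> \<rightarrow> F\<^sub>1 \<rightarrow> F\<^sub>0 \<rightarrow> A / B \<rightarrow> 0\<close> where \<open>F\<^sub>i\<close> is the direct sum of the \<open>R(- dg i g)\<close> for \<open>g < r i\<close>.
  The matrix of \<open>F\<^sub>i\<^sub>+\<^sub>1 \<rightarrow> F\<^sub>i\<close> is \<open>D i\<close>, and \<open>e g \<in> A\<close> represents the image of the \<open>g\<close>-th
  generator of \<open>F\<^sub>0\<close> under the augmentation. The cases of interest are \<open>A = R, B = I\<close> and
  \<open>A = I, B = 0\<close>.\<close>

definition minimal_free_resolution ::
    "('n, 'k::field) mpoly set \<Rightarrow> ('n, 'k) mpoly set \<Rightarrow> (nat \<Rightarrow> nat) \<Rightarrow> (nat \<Rightarrow> nat \<Rightarrow> 'n \<Rightarrow> int)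
     \<Rightarrow> (nat \<Rightarrow> nat \<Rightarrow> nat \<Rightarrow> ('n, 'k) mpoly) \<Rightarrow> (nat \<Rightarrow> ('n, 'k) mpoly) \<Rightarrow> bool" where
  "minimal_free_resolution A B r dg D e \<longleftrightarrow>
     (\<forall>g < r 0. homogeneous (dg 0 g) (e g)) \<and>
     (\<forall>i. \<forall>g < r (Suc i). \<forall>h < r i. homogeneous (dg (Suc i) g - dg i h) (D i g h)) \<and>
     {(\<Sum>g<r 0. v g * e g) + b | v b. v \<in> free_mod (r 0) \<and> b \<in> B} = A \<and>
     {v \<in> free_mod (r 0). (\<Sum>g<r 0. v g * e g) \<in> B} = lin_map (r 1) (r 0) (D 0) ` free_mod (r 1) \<and>
     (\<forall>i. {v \<in> free_mod (r (Suc i)). lin_map (r (Suc i)) (r i) (D i) v = (\<lambda>_. 0)} =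
          lin_map (r (Suc (Suc i))) (r (Suc i)) (D (Suc i)) ` free_mod (r (Suc (Suc i)))) \<and>
     (\<forall>i. \<forall>g < r (Suc i). \<forall>h < r i. \<not> D i g h dvd 1)"

text \<open>The multigraded ranks do not depend on the choice of the minimal resolution.\<close>

definition graded_betti ::
    "('n, 'k::field) mpoly set \<Rightarrow> ('n, 'k) mpoly set \<Rightarrow> nat \<Rightarrow> ('n \<Rightarrow> int) \<Rightarrow> nat" where
  "graded_betti A B =
     (THE b. \<exists>r dg D e. minimal_free_resolution A B r dg D e \<and>
        b = (\<lambda>i \<alpha>. card {g. g < r i \<and> dg i g = \<alpha>}))"

definition betti_ideal :: "('n, 'k::field) mpoly set \<Rightarrow> nat \<Rightarrow> ('n \<Rightarrow> int) \<Rightarrow> nat" where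
  "betti_ideal I = graded_betti I {0}"

definition betti_quotient :: "('n, 'k::field) mpoly set \<Rightarrow> nat \<Rightarrow> ('n \<Rightarrow> int) \<Rightarrow> nat" where
  "betti_quotient I = graded_betti UNIV I"

text \<open>Generators are listed as \<open>ms ! 0, \<dots>, ms ! (length ms - 1)\<close>; faces are sets of positions.\<close>

definition mlcm :: "'n mono list \<Rightarrow> nat set \<Rightarrow> 'n mono" where
  "mlcm ms \<sigma> = (\<lambda>v. Max (insert 0 ((\<lambda>i. (ms ! i) v) ` \<sigma>)))"

text \<open>\<open>pruned_edges ms j\<close> is the set of edges selected in the steps for the positions below \<open>j\<close>.
  Edges selected within one step are pairwise disjoint, so faces can be treated simultaneously.\<close>

fun pruned_edges :: "'n mono list \<Rightarrow> nat \<Rightarrow> nat set set set" where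
  "pruned_edges ms 0 = {}"
| "pruned_edges ms (Suc j) = pruned_edges ms j \<union>
     {{\<sigma>, insert j \<sigma>} | \<sigma>. \<sigma> \<subseteq> {..<length ms} \<and> j \<notin> \<sigma> \<and> mlcm ms \<sigma> = mlcm ms (insert j \<sigma>) \<and>
        \<sigma> \<notin> \<Union> (pruned_edges ms j) \<and> insert j \<sigma> \<notin> \<Union> (pruned_edges ms j)}"

definition critical_faces :: "'n mono list \<Rightarrow> nat set set" where
  "critical_faces ms = {\<sigma>. \<sigma> \<subseteq> {..<length ms}} - \<Union> (pruned_edges ms (length ms))"

definition pruned_betti :: "'n mono list \<Rightarrow> nat \<Rightarrow> ('n \<Rightarrow> int) \<Rightarrow> nat" where
  "pruned_betti ms i \<alpha> = card {\<sigma> \<in> critical_faces ms. card \<sigma> = i \<and> multideg (mlcm ms \<sigma>) = \<alpha>}"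

text \<open>The pruned resolution has \<open>pruned_betti ms i \<alpha>\<close> summands \<open>R(- \<alpha>)\<close> in homological degree
  \<open>i\<close>, hence is minimal iff these numbers are the Betti numbers of \<open>R / I\<close>.\<close>

definition minimal_pruned_order :: "('n, 'k::field) mpoly set \<Rightarrow> 'n mono list \<Rightarrow> bool" where
  "minimal_pruned_order I ms \<longleftrightarrow>
     distinct ms \<and> set ms = min_gens I \<and> (\<forall>i \<alpha>. pruned_betti ms i \<alpha> = betti_quotient I i \<alpha>)"

definition betti_splitting ::
    "('n, 'k::field) mpoly set \<Rightarrow> ('n, 'k) mpoly set \<Rightarrow> ('n, 'k) mpoly set \<Rightarrow> bool" where
  "betti_splitting I J K \<longleftrightarrow>
     monomial_ideal I \<and> monomial_ideal J \<and> monomial_ideal K \<and>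
     I = J + K \<and> min_gens I = min_gens J \<union> min_gens K \<and> min_gens J \<inter> min_gens K = {} \<and>
     (\<forall>i \<alpha>. betti_ideal I i \<alpha> = betti_ideal J i \<alpha> + betti_ideal K i \<alpha> +
        (if i = 0 then 0 else betti_ideal (J \<inter> K) (i - 1) \<alpha>))"

inductive admits_minimal_pruned_resolution :: "('n, 'k::field) mpoly set \<Rightarrow> bool" where
  order: "monomial_ideal I \<Longrightarrow> minimal_pruned_order I ms \<Longrightarrow> admits_minimal_pruned_resolution I"
| splitting: "betti_splitting I J K \<Longrightarrow> admits_minimal_pruned_resolution J \<Longrightarrow>
    admits_minimal_pruned_resolution K \<Longrightarrow> admits_minimal_pruned_resolution (J \<inter> K) \<Longrightarrow>
    admits_minimal_pruned_resolution I"

text \<open>A simple graph on the vertex set \<open>'n\<close> is given by its set of edges, which are two-element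
  sets.\<close>

definition edge_ideal :: "'n set set \<Rightarrow> ('n, 'k::field) mpoly set" where
  "edge_ideal E = ideal_gen {var i * var j | i j. {i, j} \<in> E}"

definition cycle_on :: "'n set \<Rightarrow> 'n set set \<Rightarrow> bool" where
  "cycle_on V C \<longleftrightarrow> (\<exists>vs. distinct vs \<and> set vs = V \<and> 3 \<le> length vs \<and>
     C = {{vs ! i, vs ! (Suc i mod length vs)} | i. i < length vs})"

definition wheel :: "'n set set \<Rightarrow> bool" where
  "wheel E \<longleftrightarrow> (\<exists>h C. cycle_on (UNIV - {h}) C \<and> E = C \<union> {{h, v} | v. v \<noteq> h})"

end

theory Submission
  imports Defs
begin

text \<open>A single order of the generators suffices: first the spokes, then the edges of the rim in a
  suitable order. Pruning is controlled by discrete Morse theory in algebraic form: the pruned pairs can be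
  cancelled from the Taylor complex one after the other, by decreasing step, because every pivot is then
  still an entry of the Taylor complex. The complex that remains on the critical faces is a minimal
  resolution as soon as its entries between faces of the same multidegree vanish, and its ranks are the Betti
  numbers because minimal resolutions are homotopy equivalent. For the wheel, the critical faces of a given
  multidegree lie in one homological degree, except for a face that consists of spokes only. All
  elements of such a face are essential for its least common multiple, so its entries to faces of the same
  multidegree are zero in the Taylor complex and remain so during the cancellation.\<close>

section \<open>Monomials and homogeneous components\<close>

text \<open>Spokes come first because a spoke at a vertex that the rim edges already cover is
  redundant once another spoke supplies the hub. Toggling the spoke at the least covered vertex
  matches every face with both spokes and rim edges, except those whose only spoke sits at that
  vertex. The rim steps then act as the pruning of a cycle, in the same way without spokes and with
  this one spoke. A nonempty critical set of rim edges is smaller than the set W of vertices that it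
  covers, so together with one spoke it has at most as many elements as the face formed by the
  spokes at W. Hence the spokes-only face can only be the larger of two critical faces in
  neighbouring degrees. The obstacle is the cycle: critical sets of rim edges that cover the same
  vertices must have equal size. The pruning is read as a scan of a cyclic binary word in blocks of
  three letters. In the swapped order only one bit, besides the letters, passes from block to block,
  so two words with the same covered vertices can be compared letter by letter. If they differ, they
  do so only where the cycle closes.\<close>

lemma mono_add_diff:
  fixes k s :: "'n mono"
  shows "k \<le> s \<Longrightarrow> k + (s - k) = s"
  by (simp add: fun_eq_iff le_fun_def fun_diff_def)

lemma poly_mapping_sum_single:
  fixes p :: "'a \<Rightarrow>\<^sub>0 'b::comm_monoid_add"
  shows "p = (\<Sum>k\<in>Poly_Mapping.keys p. Poly_Mapping.single k (Poly_Mapping.lookup p k))"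
proof (rule poly_mapping_eqI)
  fix k
  have "Poly_Mapping.lookup (\<Sum>k\<in>Poly_Mapping.keys p. Poly_Mapping.single k (Poly_Mapping.lookup p k)) k
     = (\<Sum>j\<in>Poly_Mapping.keys p. if j = k then Poly_Mapping.lookup p j else 0)"
    unfolding lookup_sum by (intro sum.cong refl) (auto simp: lookup_single when_def)
  also have "\<dots> = Poly_Mapping.lookup p k"
    by (auto simp: sum.delta in_keys_iff)
  finally show "Poly_Mapping.lookup p k = Poly_Mapping.lookup (\<Sum>k\<in>Poly_Mapping.keys p. Poly_Mapping.single k (Poly_Mapping.lookup p k)) k"
    by simp
qed

lemma lookup_times_single:
  fixes p :: "('n, 'k::field) mpoly"
  shows "Poly_Mapping.lookup (p * Poly_Mapping.single t c) s
    = (if t \<le> s then Poly_Mapping.lookup p (s - t) * c else 0)"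
proof -
  have *: "k + t = s \<longleftrightarrow> t \<le> s \<and> k = s - t" for k :: "'n mono"
    unfolding fun_eq_iff le_fun_def fun_diff_def plus_fun_apply
    by (metis add_diff_cancel_right' le_add2 le_add_diff_inverse2)
  have "p * Poly_Mapping.single t c
      = (\<Sum>k\<in>Poly_Mapping.keys p. Poly_Mapping.single (k + t) (Poly_Mapping.lookup p k * c))"
    by (subst poly_mapping_sum_single[of p]) (simp add: sum_distrib_right mult_single)
  then have "Poly_Mapping.lookup (p * Poly_Mapping.single t c) s
      = (\<Sum>k\<in>Poly_Mapping.keys p. if k = s - t then (if t \<le> s then Poly_Mapping.lookup p k * c else 0) else 0)"
    by (simp only: lookup_sum) (intro sum.cong refl, auto simp: lookup_single when_def *)
  also have "\<dots> = (if t \<le> s then Poly_Mapping.lookup p (s - t) * c else 0)"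
    by (auto simp: sum.delta in_keys_iff)
  finally show ?thesis .
qed

text \<open>Reduction modulo the ideal of the variables. It is a ring homomorphism and sends the
  differential of a minimal resolution to zero.\<close>

definition cst :: "('n, 'k::field) mpoly \<Rightarrow> 'k" where
  "cst p = Poly_Mapping.lookup p 0"

lemma cst_0 [simp]: "cst 0 = 0" and cst_1 [simp]: "cst 1 = 1"
  and cst_add: "cst (p + q) = cst p + cst q" and cst_diff: "cst (p - q) = cst p - cst q"
  and cst_sum: "cst (sum f A) = (\<Sum>x\<in>A. cst (f x))"
  by (simp_all add: cst_def lookup_add lookup_minus lookup_sum)

lemma cst_mult: "cst (p * q) = cst p * cst q"
proof -
  have 0: "(0::'n mono) - t = 0" for t :: "'n mono"
    by (simp add: fun_eq_iff fun_diff_def)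
  have 1: "t \<le> 0 \<longleftrightarrow> t = 0" for t :: "'n mono"
    by (auto simp: fun_eq_iff le_fun_def)
  have "p * q = (\<Sum>k\<in>Poly_Mapping.keys q. p * Poly_Mapping.single k (Poly_Mapping.lookup q k))"
    by (subst (1) poly_mapping_sum_single[of q]) (simp add: sum_distrib_left)
  then have "cst (p * q) = (\<Sum>k\<in>Poly_Mapping.keys q. if k = 0 then cst p * Poly_Mapping.lookup q k else 0)"
    by (simp add: cst_def lookup_sum lookup_times_single 0 1 cong: if_cong)
  also have "\<dots> = cst p * cst q"
    by (auto simp: sum.delta in_keys_iff cst_def)
  finally show ?thesis .
qed

lemma cst_dvd_one: "(p :: ('n, 'k::field) mpoly) dvd 1 \<Longrightarrow> cst p \<noteq> 0"
  by (metis cst_1 cst_mult dvdE mult_zero_left zero_neq_one)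

lemma multideg_add: "multideg (m + m') = multideg m + multideg m'"
  by (simp add: multideg_def fun_eq_iff)

lemma multideg_0 [simp]: "multideg 0 = 0"
  by (simp add: multideg_def fun_eq_iff)

lemma multideg_inject [simp]: "multideg m = multideg m' \<longleftrightarrow> m = m'"
  by (auto simp: multideg_def fun_eq_iff)

lemma multideg_diff: "m \<le> m' \<Longrightarrow> multideg (m' - m) = multideg m' - multideg m"
  by (auto simp: multideg_def fun_eq_iff le_fun_def fun_diff_def of_nat_diff)

lemma homogeneous_0 [simp]: "homogeneous \<alpha> 0"
  by (simp add: homogeneous_def)

lemma homogeneous_1 [simp]: "homogeneous 0 1"
  by (simp add: homogeneous_def)

lemma homogeneous_single: "homogeneous (multideg m) (Poly_Mapping.single m c)"
  by (auto simp: homogeneous_def)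

lemma homogeneous_add: "homogeneous \<alpha> p \<Longrightarrow> homogeneous \<alpha> q \<Longrightarrow> homogeneous \<alpha> (p + q)"
  using keys_add[of p q] by (fastforce simp: homogeneous_def)

lemma homogeneous_sum: "(\<And>x. x \<in> A \<Longrightarrow> homogeneous \<alpha> (f x)) \<Longrightarrow> homogeneous \<alpha> (sum f A)"
  by (induction A rule: infinite_finite_induct) (auto intro: homogeneous_add)

lemma homogeneous_mult:
  assumes "homogeneous \<alpha> p" "homogeneous \<beta> q" "\<gamma> = \<alpha> + \<beta>"
  shows "homogeneous \<gamma> (p * q)"
  using keys_mult[of p q] assms by (fastforce simp: homogeneous_def multideg_add)

lemma homogeneous_cst: "homogeneous \<alpha> p \<Longrightarrow> cst p \<noteq> 0 \<Longrightarrow> \<alpha> = 0"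
  by (metis cst_def homogeneous_def in_keys_iff multideg_0)

text \<open>A nonzero constant term forces degree 0, and only the exponent \<open>0\<close> has that
  multidegree, so \<open>p\<close> would be a nonzero scalar. This turns minimality, stated with
  units, into vanishing constant terms.\<close>

lemma homogeneous_not_unit:
  assumes "homogeneous \<alpha> p" "\<not> p dvd 1"
  shows "cst p = 0"
proof (rule ccontr)
  assume c: "cst p \<noteq> 0"
  then have "\<alpha> = 0" using assms(1) homogeneous_cst by blast
  then have "\<forall>m\<in>Poly_Mapping.keys p. multideg m = multideg 0"
    using assms(1) by (simp add: homogeneous_def)
  then have "p = Poly_Mapping.single 0 (cst p)"
    by (intro poly_mapping_eqI) (auto simp: lookup_single when_def cst_def in_keys_iff simp del: multideg_0)
  moreover have "Poly_Mapping.single 0 (cst p) * Poly_Mapping.single 0 (inverse (cst p)) = (1 :: ('a,'b) mpoly)"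
    using c by (simp add: mult_single)
  ultimately show False using assms(2) by (metis dvd_triv_left)
qed

lift_definition hcomp :: "('n \<Rightarrow> int) \<Rightarrow> ('n, 'k::field) mpoly \<Rightarrow> ('n, 'k) mpoly"
  is "\<lambda>\<alpha> p m. if multideg m = \<alpha> then p m else 0"
  by (rule finite_subset) auto

lemma homogeneous_hcomp: "homogeneous \<alpha> (hcomp \<alpha> p)"
  unfolding homogeneous_def in_keys_iff by transfer auto

lemma hcomp_homogeneous: "homogeneous \<beta> p \<Longrightarrow> hcomp \<alpha> p = (if \<alpha> = \<beta> then p else 0)"
  unfolding homogeneous_def in_keys_iff by (rule poly_mapping_eqI, transfer) auto

lemma hcomp_add: "hcomp \<alpha> (p + q) = hcomp \<alpha> p + hcomp \<alpha> q"
  by (rule poly_mapping_eqI, simp add: lookup_add, transfer) auto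

lemma hcomp_0 [simp]: "hcomp \<alpha> 0 = 0"
  by (rule poly_mapping_eqI, transfer) auto

lemma hcomp_sum: "hcomp \<alpha> (sum f A) = (\<Sum>x\<in>A. hcomp \<alpha> (f x))"
  by (induction A rule: infinite_finite_induct) (auto simp: hcomp_add)

text \<open>Homogeneous parts commute with a homogeneous matrix up to a shift of degree. Hence an
  arbitrary solution of such a linear system can be replaced by a homogeneous one.\<close>

lemma hcomp_mult:
  assumes q: "homogeneous \<gamma> q"
  shows "hcomp \<alpha> (p * q) = hcomp (\<alpha> - \<gamma>) p * q"
proof -
  have s: "hcomp \<alpha> (Poly_Mapping.single k c * q) = hcomp (\<alpha> - \<gamma>) (Poly_Mapping.single k c) * q" for k c
    by (subst hcomp_homogeneous[OF homogeneous_mult[OF homogeneous_single q refl]],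
        subst hcomp_homogeneous[OF homogeneous_single]) (auto simp: algebra_simps)
  show ?thesis
    by (subst (1 2) poly_mapping_sum_single[of p]) (simp add: sum_distrib_right hcomp_sum s)
qed

section \<open>Monomial ideals\<close>

lemma mpoly_module: "module ((*) :: ('n, 'k::field) mpoly \<Rightarrow> _)"
  by standard (simp_all add: algebra_simps)

lemma ideal_gen_mult: "p \<in> ideal_gen S \<Longrightarrow> q * p \<in> ideal_gen S"
  by (rule module.span_scale[OF mpoly_module])

lemma ideal_gen_sum: "(\<And>x. x \<in> A \<Longrightarrow> f x \<in> ideal_gen S) \<Longrightarrow> sum f A \<in> ideal_gen S"
  by (rule module.span_sum[OF mpoly_module])

lemma ideal_gen_base: "p \<in> S \<Longrightarrow> p \<in> ideal_gen S"
  by (rule module.span_base[OF mpoly_module])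

lemma mem_monomial_ideal_iff:
  fixes p :: "('n, 'k::field) mpoly"
  shows "p \<in> ideal_gen (monom ` M) \<longleftrightarrow> (\<forall>k\<in>Poly_Mapping.keys p. \<exists>m\<in>M. m \<le> k)"
proof
  assume "p \<in> ideal_gen (monom ` M)"
  then show "\<forall>k\<in>Poly_Mapping.keys p. \<exists>m\<in>M. m \<le> k"
  proof (induction rule: module.span_induct_alt[OF mpoly_module, consumes 1])
    case 1
    then show ?case by simp
  next
    case (2 c x y)
    then obtain m where m: "m \<in> M" "x = monom m" by auto
    show ?case
    proof
      fix k assume "k \<in> Poly_Mapping.keys (c * x + y)"
      then have "k \<in> Poly_Mapping.keys (c * x) \<or> k \<in> Poly_Mapping.keys y"
        using keys_add[of "c * x" y] by auto
      then show "\<exists>m\<in>M. m \<le> k"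
      proof
        assume "k \<in> Poly_Mapping.keys (c * x)"
        then have "m \<le> k"
          unfolding m(2) monom_def in_keys_iff lookup_times_single by presburger
        then show ?thesis using m(1) by blast
      qed (use 2 in blast)
    qed
  qed
next
  assume r: "\<forall>k\<in>Poly_Mapping.keys p. \<exists>m\<in>M. m \<le> k"
  have "Poly_Mapping.single k c \<in> ideal_gen (monom ` M)" if kp: "k \<in> Poly_Mapping.keys p" for k c
  proof -
    obtain m where m: "m \<in> M" "m \<le> k" using bspec[OF r kp] by (rule bexE)
    have "Poly_Mapping.single k c = Poly_Mapping.single (k - m) c * monom m"
      unfolding monom_def mult_single add.commute[of "k - m" m] mono_add_diff[OF m(2)] by simp
    then show ?thesis using m(1) by (simp add: ideal_gen_mult ideal_gen_base)
  qed
  then show "p \<in> ideal_gen (monom ` M)"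
    by (subst poly_mapping_sum_single[of p]) (intro ideal_gen_sum)
qed

lemma monom_mem_iff: "(monom k :: ('n, 'k::field) mpoly) \<in> ideal_gen (monom ` M) \<longleftrightarrow> (\<exists>m\<in>M. m \<le> k)"
  by (simp add: mem_monomial_ideal_iff) (simp add: monom_def)

lemma min_gens_antichain:
  assumes "\<And>m m'. m \<in> M \<Longrightarrow> m' \<in> M \<Longrightarrow> m \<le> m' \<Longrightarrow> m = m'"
  shows "min_gens (ideal_gen (monom ` M) :: ('n, 'k::field) mpoly set) = M"
proof -
  have "m \<in> M \<longleftrightarrow> (\<exists>m'\<in>M. m' \<le> m) \<and> (\<forall>k. (\<exists>m'\<in>M. m' \<le> k) \<longrightarrow> k \<le> m \<longrightarrow> k = m)" for m
  proof
    assume "m \<in> M"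
    then show "(\<exists>m'\<in>M. m' \<le> m) \<and> (\<forall>k. (\<exists>m'\<in>M. m' \<le> k) \<longrightarrow> k \<le> m \<longrightarrow> k = m)"
    proof (intro conjI allI impI)
      show "\<exists>m'\<in>M. m' \<le> m" using \<open>m \<in> M\<close> by auto
    next
      fix k assume "\<exists>m'\<in>M. m' \<le> k" "k \<le> m"
      then obtain m' where m': "m' \<in> M" "m' \<le> k" by auto
      then have "m' = m" using assms[OF m'(1) \<open>m \<in> M\<close>] \<open>k \<le> m\<close> by (meson order.trans)
      then show "k = m" using m'(2) \<open>k \<le> m\<close> by (simp add: order.antisym)
    qed
  next
    assume r: "(\<exists>m'\<in>M. m' \<le> m) \<and> (\<forall>k. (\<exists>m'\<in>M. m' \<le> k) \<longrightarrow> k \<le> m \<longrightarrow> k = m)"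
    then obtain m' where "m' \<in> M" "m' \<le> m" by blast
    with r have "m' = m" by blast
    with \<open>m' \<in> M\<close> show "m \<in> M" by simp
  qed
  then show ?thesis
    unfolding min_gens_def monom_mem_iff by blast
qed

section \<open>Uniqueness of the graded Betti numbers\<close>

text \<open>Pairing a linear relation between the rows of \<open>M\<close> with a column of
  \<open>N\<close> isolates one coefficient. So the rows are independent, and they lie in a space
  spanned by \<open>card T\<close> vectors.\<close>

lemma card_le_of_left_inverse:
  fixes M N :: "nat \<Rightarrow> nat \<Rightarrow> 'k::field"
  assumes "finite S" "finite T"
    and inv: "\<And>g g'. g \<in> S \<Longrightarrow> g' \<in> S \<Longrightarrow> (\<Sum>h\<in>T. M g h * N h g') = (if g = g' then 1 else 0)"
  shows "card S \<le> card T"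
proof -
  define sc :: "'k \<Rightarrow> (nat \<Rightarrow> 'k) \<Rightarrow> nat \<Rightarrow> 'k" where "sc = (\<lambda>c f x. c * f x)"
  interpret vector_space sc
    by standard (simp_all add: sc_def fun_eq_iff algebra_simps)
  define row where "row g = (\<lambda>h. if h \<in> T then M g h else 0)" for g
  define unit where "unit h = (\<lambda>x. if x = h then 1 else (0::'k))" for h :: nat
  have pair: "(\<Sum>h\<in>T. row g h * N h g') = (if g = g' then 1 else 0)" if "g \<in> S" "g' \<in> S" for g g'
    using inv[OF that] by (simp add: row_def)
  have inj: "inj_on row S"
  proof (rule inj_onI)
    fix g g' assume g: "g \<in> S" "g' \<in> S" "row g = row g'"
    have "(if g' = g then 1 else 0 :: 'k) = 1"
      using pair[OF g(1,1)] pair[OF g(2,1)] unfolding g(3) by simp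
    then show "g = g'" by (simp split: if_splits)
  qed
  have sumap: "(\<Sum>v\<in>row ` S. sc (c v) v) h = (\<Sum>g\<in>S. c (row g) * row g h)" for c h
  proof -
    have "(\<Sum>v\<in>row ` S. sc (c v) v) = (\<Sum>g\<in>S. sc (c (row g)) (row g))"
      by (rule sum.reindex_cong[OF inj]) auto
    moreover have "(\<Sum>g\<in>F. sc (c (row g)) (row g)) h = (\<Sum>g\<in>F. c (row g) * row g h)" if "finite F" for F
      using that by (induction F) (auto simp: sc_def)
    ultimately show ?thesis using assms(1) by simp
  qed
  have ind: "independent (row ` S)"
  proof (rule independent_if_scalars_zero)
    show "finite (row ` S)" using assms(1) by simp
  next
    fix c v assume z: "(\<Sum>v\<in>row ` S. sc (c v) v) = 0" and "v \<in> row ` S"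
    then obtain g' where g': "g' \<in> S" "v = row g'" by auto
    have "0 = (\<Sum>h\<in>T. (\<Sum>g\<in>S. c (row g) * row g h) * N h g')"
      using sumap[of c] z by simp
    also have "\<dots> = (\<Sum>g\<in>S. c (row g) * (\<Sum>h\<in>T. row g h * N h g'))"
      unfolding sum_distrib_left sum_distrib_right by (subst sum.swap) (simp add: mult.assoc)
    also have "\<dots> = (\<Sum>g\<in>S. if g = g' then c (row g) else 0)"
      by (intro sum.cong refl) (simp add: pair g')
    also have "\<dots> = c v" using g' assms(1) by simp
    finally show "c v = 0" by simp
  qed
  have "row g \<in> span (unit ` T)" for g
  proof -
    have "row g = (\<Sum>h\<in>T. sc (M g h) (unit h))"
    proof
      fix x
      have "(\<Sum>h\<in>F. sc (M g h) (unit h)) x = (\<Sum>h\<in>F. if h = x then M g h else 0)" if "finite F" for F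
        using that by (induction F) (auto simp: sc_def unit_def)
      from this[OF assms(2)] show "row g x = (\<Sum>h\<in>T. sc (M g h) (unit h)) x"
        using assms(2) by (simp add: row_def)
    qed
    then show ?thesis by (auto intro!: span_sum span_scale intro: span_base)
  qed
  then have "card (row ` S) \<le> card (unit ` T)"
    using independent_span_bound[OF _ ind, of "unit ` T"] assms(2) by auto
  also have "\<dots> \<le> card T" by (rule card_image_le[OF assms(2)])
  finally show ?thesis using card_image[OF inj] by simp
qed

lemma lin_map_unit:
  assumes "g < r"
  shows "lin_map r s D (\<lambda>l. if l = g then 1 else 0) = (\<lambda>h. if h < s then D g h else 0)"
proof -
  have "(\<Sum>l<r. (if l = g then 1 else 0) * D l h) = D g h" for h
    by (subst sum.mono_neutral_cong_right[of _ "{g}" _ "\<lambda>l. D l h"]) (use assms in auto)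
  then show ?thesis unfolding lin_map_def by (simp only:)
qed

lemma sum_mult_assoc:
  fixes a :: "nat \<Rightarrow> 'a::comm_semiring_0"
  shows "(\<Sum>h\<in>H. (\<Sum>l\<in>L. a l * f l h) * d h) = (\<Sum>l\<in>L. a l * (\<Sum>h\<in>H. f l h * d h))"
  unfolding sum_distrib_left sum_distrib_right by (subst sum.swap) (simp add: mult.assoc)

text \<open>\<open>cyc i\<close> treats the augmentation and the differentials uniformly: it is the kernel of the map
  leaving \<open>F\<^sub>i\<close>.\<close>

locale resolution =
  fixes A B :: "('n, 'k::field) mpoly set" and r dg D e
  assumes res: "minimal_free_resolution A B r dg D e"
    and B_ideal: "module.subspace (*) B"
    and B_hcomp: "\<And>\<alpha> b. b \<in> B \<Longrightarrow> hcomp \<alpha> b \<in> B"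
begin

lemma B_0: "0 \<in> B" and B_add: "a \<in> B \<Longrightarrow> b \<in> B \<Longrightarrow> a + b \<in> B"
  and B_mult: "b \<in> B \<Longrightarrow> c * b \<in> B"
  using B_ideal unfolding module.subspace_def[OF mpoly_module] by auto

lemma B_sum: "(\<And>x. x \<in> X \<Longrightarrow> f x \<in> B) \<Longrightarrow> sum f X \<in> B"
  by (induction X rule: infinite_finite_induct) (auto intro: B_0 B_add)

lemma B_diff: "a \<in> B \<Longrightarrow> b \<in> B \<Longrightarrow> a - b \<in> B"
  using B_add[OF _ B_mult[of b "-1"], of a] by simp

definition cyc :: "nat \<Rightarrow> (nat \<Rightarrow> ('n, 'k) mpoly) \<Rightarrow> bool" where
  "cyc i y \<longleftrightarrow> (case i of 0 \<Rightarrow> (\<Sum>h<r 0. y h * e h) \<in> B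
     | Suc j \<Rightarrow> \<forall>k<r j. (\<Sum>h<r (Suc j). y h * D j h k) = 0)"

lemmas res_unfolded = res[unfolded minimal_free_resolution_def]

lemma hom_e: "g < r 0 \<Longrightarrow> homogeneous (dg 0 g) (e g)"
  and hom_D: "g < r (Suc i) \<Longrightarrow> h < r i \<Longrightarrow> homogeneous (dg (Suc i) g - dg i h) (D i g h)"
  and nonunit_D: "g < r (Suc i) \<Longrightarrow> h < r i \<Longrightarrow> \<not> D i g h dvd 1"
  and generate: "{(\<Sum>g<r 0. v g * e g) + b | v b. v \<in> free_mod (r 0) \<and> b \<in> B} = A"
  and exact_0: "{v \<in> free_mod (r 0). (\<Sum>g<r 0. v g * e g) \<in> B} = lin_map (r 1) (r 0) (D 0) ` free_mod (r 1)"
  and exact_Suc: "{v \<in> free_mod (r (Suc i)). lin_map (r (Suc i)) (r i) (D i) v = (\<lambda>_. 0)} =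
          lin_map (r (Suc (Suc i))) (r (Suc i)) (D (Suc i)) ` free_mod (r (Suc (Suc i)))"
  using res_unfolded by (elim conjE; iprover)+

lemma cst_D: "g < r (Suc i) \<Longrightarrow> h < r i \<Longrightarrow> cst (D i g h) = 0"
  using homogeneous_not_unit[OF hom_D nonunit_D] .

lemma cyc_iff: "v \<in> free_mod (r i) \<Longrightarrow> cyc i v \<longleftrightarrow> v \<in> lin_map (r (Suc i)) (r i) (D i) ` free_mod (r (Suc i))"
proof (cases i)
  case 0
  then show "v \<in> free_mod (r i) \<Longrightarrow> ?thesis" using exact_0 by (auto simp: cyc_def)
next
  case (Suc j)
  assume v: "v \<in> free_mod (r i)"
  have "cyc i v \<longleftrightarrow> v \<in> {v \<in> free_mod (r (Suc j)). lin_map (r (Suc j)) (r j) (D j) v = (\<lambda>_. 0)}"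
    using v Suc by (auto simp: cyc_def lin_map_def fun_eq_iff)
  then show ?thesis unfolding exact_Suc Suc .
qed

lemma cyc_cong: "(\<And>h. h < r i \<Longrightarrow> y h = y' h) \<Longrightarrow> cyc i y \<longleftrightarrow> cyc i y'"
  by (cases i) (simp_all add: cyc_def)

lemma cyc_D: "l < r (Suc i) \<Longrightarrow> cyc i (D i l)"
proof -
  assume l: "l < r (Suc i)"
  let ?v = "lin_map (r (Suc i)) (r i) (D i) (\<lambda>k. if k = l then 1 else 0)"
  have "cyc i ?v"
    using l by (subst cyc_iff) (auto simp: free_mod_def lin_map_def)
  then show ?thesis
    unfolding lin_map_unit[OF l] by (subst cyc_cong) auto
qed

lemma DD: "g < r (Suc (Suc i)) \<Longrightarrow> k < r i \<Longrightarrow> (\<Sum>h<r (Suc i). D (Suc i) g h * D i h k) = 0"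
  using cyc_D[of g "Suc i"] by (simp add: cyc_def)

lemma exact:
  assumes "cyc i y"
  shows "\<exists>u. \<forall>h<r i. y h = (\<Sum>l<r (Suc i). u l * D i l h)"
proof -
  let ?v = "\<lambda>h. if h < r i then y h else 0"
  have "cyc i ?v" using assms by (subst cyc_cong[of i _ y]) auto
  then have "?v \<in> lin_map (r (Suc i)) (r i) (D i) ` free_mod (r (Suc i))"
    by (subst cyc_iff[symmetric]) (auto simp: free_mod_def)
  then obtain u where u: "?v = lin_map (r (Suc i)) (r i) (D i) u" by auto
  have "y h = (\<Sum>l<r (Suc i). u l * D i l h)" if "h < r i" for h
    using fun_cong[OF u, of h] that by (simp add: lin_map_def)
  then show ?thesis by blast
qed

text \<open>Any preimage can be cut down to its parts of the right degrees, because taking the part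
  of degree \<open>\<gamma> - dg i h\<close> leaves \<open>y h\<close> unchanged.\<close>

lemma exact_homogeneous:
  assumes "cyc i y" "\<And>h. h < r i \<Longrightarrow> homogeneous (\<gamma> - dg i h) (y h)"
  shows "\<exists>u. (\<forall>l<r (Suc i). homogeneous (\<gamma> - dg (Suc i) l) (u l)) \<and>
             (\<forall>h<r i. y h = (\<Sum>l<r (Suc i). u l * D i l h))"
proof -
  obtain u where u: "\<And>h. h < r i \<Longrightarrow> y h = (\<Sum>l<r (Suc i). u l * D i l h)"
    using exact[OF assms(1)] by blast
  have "y h = (\<Sum>l<r (Suc i). hcomp (\<gamma> - dg (Suc i) l) (u l) * D i l h)" if h: "h < r i" for h
  proof -
    have "y h = hcomp (\<gamma> - dg i h) (y h)"
      by (simp add: hcomp_homogeneous[OF assms(2)[OF h]])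
    also have "\<dots> = (\<Sum>l<r (Suc i). hcomp (\<gamma> - dg i h) (u l * D i l h))"
      by (subst u[OF h]) (rule hcomp_sum)
    also have "\<dots> = (\<Sum>l<r (Suc i). hcomp (\<gamma> - dg (Suc i) l) (u l) * D i l h)"
      by (intro sum.cong refl) (use h in \<open>simp add: hcomp_mult[OF hom_D]\<close>)
    finally show ?thesis .
  qed
  then show ?thesis
    by (intro exI[of _ "\<lambda>l. hcomp (\<gamma> - dg (Suc i) l) (u l)"] conjI allI impI homogeneous_hcomp)
qed

lemma cover_homogeneous:
  assumes "a \<in> A" "homogeneous \<gamma> a"
  shows "\<exists>v. (\<forall>h<r 0. homogeneous (\<gamma> - dg 0 h) (v h)) \<and> a - (\<Sum>h<r 0. v h * e h) \<in> B"
proof -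
  obtain v b where v: "a = (\<Sum>g<r 0. v g * e g) + b" "b \<in> B"
    using assms(1) generate by blast
  have "a = hcomp \<gamma> a" by (simp add: hcomp_homogeneous[OF assms(2)])
  also have "\<dots> = (\<Sum>h<r 0. hcomp (\<gamma> - dg 0 h) (v h) * e h) + hcomp \<gamma> b"
    by (subst v(1)) (simp add: hcomp_add hcomp_sum hcomp_mult[OF hom_e])
  finally have eq: "a = (\<Sum>h<r 0. hcomp (\<gamma> - dg 0 h) (v h) * e h) + hcomp \<gamma> b" .
  have "a - (\<Sum>h<r 0. hcomp (\<gamma> - dg 0 h) (v h) * e h) = hcomp \<gamma> b"
    by (subst eq) simp
  then have "a - (\<Sum>h<r 0. hcomp (\<gamma> - dg 0 h) (v h) * e h) \<in> B"
    using B_hcomp[OF v(2)] by simp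
  then show ?thesis
    by (intro exI[of _ "\<lambda>h. hcomp (\<gamma> - dg 0 h) (v h)"] conjI allI impI homogeneous_hcomp)
qed

lemma e_mem: "g < r 0 \<Longrightarrow> e g \<in> A"
proof -
  assume g: "g < r 0"
  have "(\<Sum>l<r 0. (if l = g then 1 else 0) * e l) = e g"
    by (subst sum.mono_neutral_cong_right[of _ "{g}" _ e]) (use g in auto)
  then have "e g = (\<Sum>l<r 0. (if l = g then 1 else 0) * e l) + 0" by simp
  moreover have "(\<lambda>l. if l = g then 1 else 0) \<in> free_mod (r 0)"
    using g by (auto simp: free_mod_def)
  ultimately have "e g \<in> {(\<Sum>g<r 0. v g * e g) + b | v b. v \<in> free_mod (r 0) \<and> b \<in> B}"
    using B_0 by (intro CollectI exI conjI)
  then show ?thesis unfolding generate .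
qed

text \<open>A chain map that lifts the identity is homotopic to it. Every summand of the homotopy
  formula contains an entry of some \<open>D\<close>, whose constant term is zero by
  minimality.\<close>

lemma cst_of_lift_of_identity:
  assumes base: "\<And>g. g < r 0 \<Longrightarrow> e g - (\<Sum>h<r 0. \<phi> 0 g h * e h) \<in> B"
    and comm: "\<And>i g k. g < r (Suc i) \<Longrightarrow> k < r i \<Longrightarrow>
      (\<Sum>h<r (Suc i). \<phi> (Suc i) g h * D i h k) = (\<Sum>l<r i. D i g l * \<phi> i l k)"
    and gh: "g < r i" "h < r i"
  shows "cst (\<phi> i g h) = (if g = h then 1 else 0)"
proof -
  define \<psi> where "\<psi> i g h = \<phi> i g h - (if h = g then 1 else 0)" for i g h
  have delta: "(\<Sum>h<n. (if h = g then 1 else 0) * f h) = f g" "(\<Sum>h<n. f h * (if k = h then 1 else 0)) = f k"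
    if "g < n" "k < n" for g k n and f :: "nat \<Rightarrow> ('n,'k) mpoly"
    by (subst sum.mono_neutral_cong_right[of _ "{g}" _ f], use that in auto)
       (subst sum.mono_neutral_cong_right[of _ "{k}" _ f], use that in auto)
  have cyc0: "cyc 0 (\<psi> 0 g)" if "g < r 0" for g
    using B_diff[OF B_0 base[OF that]] that
    by (simp add: cyc_def \<psi>_def left_diff_distrib sum_subtractf delta)
  have comm\<psi>: "(\<Sum>h<r (Suc i). \<psi> (Suc i) g h * D i h k) = (\<Sum>l<r i. D i g l * \<psi> i l k)"
    if "g < r (Suc i)" "k < r i" for i g k
    using comm[OF that] that
    by (simp add: \<psi>_def left_diff_distrib right_diff_distrib sum_subtractf delta)
  \<comment> \<open>The homotopy is built along with the claim: the second conjunct says that the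
    next defect is a cycle, so exactness provides the next part of the homotopy.\<close>
  have "(\<forall>g<r i. \<forall>h<r i. cst (\<psi> i g h) = 0) \<and>
    (\<exists>s. \<forall>g<r (Suc i). cyc (Suc i) (\<lambda>h. \<psi> (Suc i) g h - (\<Sum>l<r i. D i g l * s l h)))" for i
  proof (induction i)
    case 0
    have "\<forall>g. \<exists>u. g < r 0 \<longrightarrow> (\<forall>h<r 0. \<psi> 0 g h = (\<Sum>l<r (Suc 0). u l * D 0 l h))"
      using exact[OF cyc0] by blast
    then obtain s where s: "\<And>g h. g < r 0 \<Longrightarrow> h < r 0 \<Longrightarrow> \<psi> 0 g h = (\<Sum>l<r (Suc 0). s g l * D 0 l h)"
      by (drule_tac choice) blast
    have "cst (\<psi> 0 g h) = 0" if "g < r 0" "h < r 0" for g h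
      using that by (simp add: s cst_sum cst_mult cst_D)
    moreover have "cyc (Suc 0) (\<lambda>h. \<psi> (Suc 0) g h - (\<Sum>l<r 0. D 0 g l * s l h))" if g: "g < r (Suc 0)" for g
    proof -
      have "(\<Sum>h<r (Suc 0). (\<psi> (Suc 0) g h - (\<Sum>l<r 0. D 0 g l * s l h)) * D 0 h k) = 0" if k: "k < r 0" for k
        unfolding left_diff_distrib sum_subtractf sum_mult_assoc comm\<psi>[OF g k]
        using k by (simp add: s)
      then show ?thesis by (simp add: cyc_def)
    qed
    ultimately show ?case by blast
  next
    case (Suc i)
    then obtain s where s: "\<And>g. g < r (Suc i) \<Longrightarrow> cyc (Suc i) (\<lambda>h. \<psi> (Suc i) g h - (\<Sum>l<r i. D i g l * s l h))"
      by blast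
    have "\<forall>g. \<exists>u. g < r (Suc i) \<longrightarrow> (\<forall>h<r (Suc i). \<psi> (Suc i) g h - (\<Sum>l<r i. D i g l * s l h) = (\<Sum>l<r (Suc (Suc i)). u l * D (Suc i) l h))"
      using exact[OF s] by blast
    then obtain t where t': "\<And>g h. g < r (Suc i) \<Longrightarrow> h < r (Suc i) \<Longrightarrow>
        \<psi> (Suc i) g h - (\<Sum>l<r i. D i g l * s l h) = (\<Sum>l<r (Suc (Suc i)). t g l * D (Suc i) l h)"
      by (drule_tac choice) blast
    have t: "(\<Sum>l<r (Suc (Suc i)). t g l * D (Suc i) l h) = \<psi> (Suc i) g h - (\<Sum>l<r i. D i g l * s l h)"
      if "g < r (Suc i)" "h < r (Suc i)" for g h using t'[OF that] by simp
    have "cst (\<psi> (Suc i) g h) = 0" if "g < r (Suc i)" "h < r (Suc i)" for g h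
    proof -
      have "\<psi> (Suc i) g h = (\<Sum>l<r (Suc (Suc i)). t g l * D (Suc i) l h) + (\<Sum>l<r i. D i g l * s l h)"
        using t[OF that] by simp
      then show ?thesis using that by (simp add: cst_add cst_sum cst_mult cst_D)
    qed
    moreover have "cyc (Suc (Suc i)) (\<lambda>h. \<psi> (Suc (Suc i)) g h - (\<Sum>l<r (Suc i). D (Suc i) g l * t l h))"
      if g: "g < r (Suc (Suc i))" for g
    proof -
      have "(\<Sum>h<r (Suc (Suc i)). (\<psi> (Suc (Suc i)) g h - (\<Sum>l<r (Suc i). D (Suc i) g l * t l h)) * D (Suc i) h k) = 0"
        if k: "k < r (Suc i)" for k
      proof -
        have "(\<Sum>l<r (Suc i). D (Suc i) g l * (\<Sum>m<r i. D i l m * s m k)) = 0"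
          using DD[OF g] by (subst sum_mult_assoc[symmetric]) simp
        then show ?thesis
          unfolding left_diff_distrib sum_subtractf sum_mult_assoc comm\<psi>[OF g k]
          using k by (simp add: t right_diff_distrib sum_subtractf)
      qed
      then show ?thesis by (simp add: cyc_def)
    qed
    ultimately show ?case by blast
  qed
  then have "cst (\<psi> i g h) = 0" using gh by blast
  then show ?thesis unfolding \<psi>_def cst_diff by (auto split: if_splits)
qed

end

text \<open>The comparison map of two graded resolutions. The homogeneity of its entries is what
  later separates the multidegrees.\<close>

lemma resolution_lift:
  assumes F: "resolution A B r dg D e" and G: "resolution A B r' dg' D' e'"
  shows "\<exists>f. (\<forall>i. \<forall>g<r i. \<forall>h<r' i. homogeneous (dg i g - dg' i h) (f i g h)) \<and>
    (\<forall>g<r 0. e g - (\<Sum>h<r' 0. f 0 g h * e' h) \<in> B) \<and>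
    (\<forall>i. \<forall>g<r (Suc i). \<forall>k<r' i.
       (\<Sum>h<r' (Suc i). f (Suc i) g h * D' i h k) = (\<Sum>l<r i. D i g l * f i l k))"
proof -
  interpret F: resolution A B r dg D e by (rule F)
  interpret G: resolution A B r' dg' D' e' by (rule G)
  \<comment> \<open>\<open>P\<close> carries the cycle condition that makes the next level solvable,
    and \<open>Q\<close> is the commuting square between two levels; this is the form required by
    dependent choice.\<close>
  define P where "P i f \<longleftrightarrow> (\<forall>g<r i. \<forall>h<r' i. homogeneous (dg i g - dg' i h) (f g h)) \<and>
    (\<forall>g<r (Suc i). G.cyc i (\<lambda>k. \<Sum>l<r i. D i g l * f l k)) \<and>
    (i = 0 \<longrightarrow> (\<forall>g<r 0. e g - (\<Sum>h<r' 0. f g h * e' h) \<in> B))" for i f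
  define Q where "Q i f f' \<longleftrightarrow> (\<forall>g<r (Suc i). \<forall>k<r' i.
       (\<Sum>h<r' (Suc i). f' g h * D' i h k) = (\<Sum>l<r i. D i g l * f l k))" for i f f'
  have "\<exists>f. \<forall>i. P i (f i) \<and> Q i (f i) (f (Suc i))"
  proof (rule dependent_nat_choice)
    have "\<forall>g. \<exists>v. g < r 0 \<longrightarrow> (\<forall>h<r' 0. homogeneous (dg 0 g - dg' 0 h) (v h)) \<and> e g - (\<Sum>h<r' 0. v h * e' h) \<in> B"
      using G.cover_homogeneous[OF F.e_mem F.hom_e] by blast
    then obtain f where f1: "\<And>g h. g < r 0 \<Longrightarrow> h < r' 0 \<Longrightarrow> homogeneous (dg 0 g - dg' 0 h) (f g h)"
      and f2: "\<And>g. g < r 0 \<Longrightarrow> e g - (\<Sum>h<r' 0. f g h * e' h) \<in> B" by metis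
    have "G.cyc 0 (\<lambda>k. \<Sum>l<r 0. D 0 g l * f l k)" if g: "g < r (Suc 0)" for g
    proof -
      have "(\<Sum>l<r 0. D 0 g l * e l) \<in> B"
        using F.cyc_D[OF g] by (simp add: F.cyc_def)
      moreover have "(\<Sum>l<r 0. D 0 g l * (e l - (\<Sum>h<r' 0. f l h * e' h))) \<in> B"
        using f2 by (auto intro!: F.B_sum F.B_mult)
      ultimately have "(\<Sum>l<r 0. D 0 g l * e l) - (\<Sum>l<r 0. D 0 g l * (e l - (\<Sum>h<r' 0. f l h * e' h))) \<in> B"
        by (rule F.B_diff)
      then show ?thesis
        by (simp add: G.cyc_def sum_mult_assoc right_diff_distrib sum_subtractf)
    qed
    then show "\<exists>f. P 0 f" using f1 f2 by (auto simp: P_def)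
  next
    fix f i assume P: "P i f"
    have "\<exists>u. g < r (Suc i) \<longrightarrow> (\<forall>h<r' (Suc i). homogeneous (dg (Suc i) g - dg' (Suc i) h) (u h)) \<and>
        (\<forall>k<r' i. (\<Sum>l<r i. D i g l * f l k) = (\<Sum>h<r' (Suc i). u h * D' i h k))" for g
    proof (cases "g < r (Suc i)")
      case True
      have "homogeneous (dg (Suc i) g - dg' i k) (\<Sum>l<r i. D i g l * f l k)" if "k < r' i" for k
        by (rule homogeneous_sum, rule homogeneous_mult[where \<alpha> = "dg (Suc i) g - dg i l" and \<beta> = "dg i l - dg' i k" for l])
           (use True that P F.hom_D in \<open>auto simp: P_def\<close>)
      then show ?thesis
        using G.exact_homogeneous[of i "\<lambda>k. \<Sum>l<r i. D i g l * f l k" "dg (Suc i) g"] P True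
        by (auto simp: P_def)
    qed auto
    then have "\<forall>g. \<exists>u. g < r (Suc i) \<longrightarrow> (\<forall>h<r' (Suc i). homogeneous (dg (Suc i) g - dg' (Suc i) h) (u h)) \<and>
        (\<forall>k<r' i. (\<Sum>l<r i. D i g l * f l k) = (\<Sum>h<r' (Suc i). u h * D' i h k))" by blast
    then obtain f' where f'1: "\<And>g h. g < r (Suc i) \<Longrightarrow> h < r' (Suc i) \<Longrightarrow> homogeneous (dg (Suc i) g - dg' (Suc i) h) (f' g h)"
      and f'2: "\<And>g k. g < r (Suc i) \<Longrightarrow> k < r' i \<Longrightarrow> (\<Sum>l<r i. D i g l * f l k) = (\<Sum>h<r' (Suc i). f' g h * D' i h k)"
      by (drule_tac choice) blast
    have f'3: "G.cyc (Suc i) (\<lambda>k. \<Sum>l<r (Suc i). D (Suc i) g l * f' l k)" if g: "g < r (Suc (Suc i))" for g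
    proof -
      have "(\<Sum>h<r' (Suc i). (\<Sum>l<r (Suc i). D (Suc i) g l * f' l h) * D' i h k) = 0" if k: "k < r' i" for k
      proof -
        have "(\<Sum>h<r' (Suc i). (\<Sum>l<r (Suc i). D (Suc i) g l * f' l h) * D' i h k)
            = (\<Sum>l<r (Suc i). D (Suc i) g l * (\<Sum>m<r i. D i l m * f m k))"
          using k by (simp add: sum_mult_assoc f'2)
        also have "\<dots> = 0"
          using F.DD[OF g] by (subst sum_mult_assoc[symmetric]) simp
        finally show ?thesis .
      qed
      then show ?thesis by (simp add: G.cyc_def)
    qed
    have "P (Suc i) f'"
      unfolding P_def by (intro conjI allI impI f'1 f'3) simp_all
    moreover have "Q i f f'" unfolding Q_def by (intro allI impI f'2[symmetric])
    ultimately show "\<exists>f'. P (Suc i) f' \<and> Q i f f'" by (intro exI[of _ f'] conjI)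
  qed
  then obtain f where "\<forall>i. P i (f i) \<and> Q i (f i) (f (Suc i))" ..
  then show ?thesis unfolding P_def Q_def by (intro exI[of _ f]) simp
qed

text \<open>The composite of the comparison maps in both directions lifts the identity, so it is the
  identity modulo the variables. Constant terms occur only between generators of equal degree, so
  this is one matrix identity for each \<open>\<alpha>\<close>.\<close>

lemma betti_le:
  assumes F: "resolution A B r dg D e" and G: "resolution A B r' dg' D' e'"
  shows "card {g. g < r i \<and> dg i g = \<alpha>} \<le> card {g. g < r' i \<and> dg' i g = \<alpha>}"
proof -
  interpret F: resolution A B r dg D e by (rule F)
  interpret G: resolution A B r' dg' D' e' by (rule G)
  obtain f where f: "\<And>i g h. g < r i \<Longrightarrow> h < r' i \<Longrightarrow> homogeneous (dg i g - dg' i h) (f i g h)"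
    "\<And>g. g < r 0 \<Longrightarrow> e g - (\<Sum>h<r' 0. f 0 g h * e' h) \<in> B"
    "\<And>i g k. g < r (Suc i) \<Longrightarrow> k < r' i \<Longrightarrow>
       (\<Sum>h<r' (Suc i). f (Suc i) g h * D' i h k) = (\<Sum>l<r i. D i g l * f i l k)"
    using resolution_lift[OF F G] by blast
  obtain k where k: "\<And>i g h. g < r' i \<Longrightarrow> h < r i \<Longrightarrow> homogeneous (dg' i g - dg i h) (k i g h)"
    "\<And>g. g < r' 0 \<Longrightarrow> e' g - (\<Sum>h<r 0. k 0 g h * e h) \<in> B"
    "\<And>i g l. g < r' (Suc i) \<Longrightarrow> l < r i \<Longrightarrow>
       (\<Sum>h<r (Suc i). k (Suc i) g h * D i h l) = (\<Sum>m<r' i. D' i g m * k i m l)"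
    using resolution_lift[OF G F] by blast
  define \<phi> where "\<phi> i g h = (\<Sum>l<r' i. f i g l * k i l h)" for i g h
  have "e g - (\<Sum>h<r 0. \<phi> 0 g h * e h) \<in> B" if g: "g < r 0" for g
  proof -
    have "(\<Sum>l<r' 0. f 0 g l * (e' l - (\<Sum>h<r 0. k 0 l h * e h))) \<in> B"
      using k(2) by (auto intro!: F.B_sum F.B_mult)
    from F.B_add[OF f(2)[OF g] this] show ?thesis
      by (simp add: \<phi>_def sum_mult_assoc right_diff_distrib sum_subtractf)
  qed
  moreover have "(\<Sum>h<r (Suc i). \<phi> (Suc i) g h * D i h l) = (\<Sum>m<r i. D i g m * \<phi> i m l)"
    if g: "g < r (Suc i)" and l: "l < r i" for i g l
  proof -
    have "(\<Sum>h<r (Suc i). \<phi> (Suc i) g h * D i h l)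
        = (\<Sum>h<r' (Suc i). f (Suc i) g h * (\<Sum>m<r' i. D' i h m * k i m l))"
      using l by (simp add: \<phi>_def sum_mult_assoc k(3))
    also have "\<dots> = (\<Sum>m<r' i. (\<Sum>p<r i. D i g p * f i p m) * k i m l)"
      using g by (subst sum_mult_assoc[symmetric]) (simp add: f(3))
    also have "\<dots> = (\<Sum>m<r i. D i g m * \<phi> i m l)"
      by (simp add: sum_mult_assoc \<phi>_def)
    finally show ?thesis .
  qed
  ultimately have id: "cst (\<phi> i g h) = (if g = h then 1 else 0)" if "g < r i" "h < r i" for g h
    by (rule F.cst_of_lift_of_identity) (use that in auto)
  have "(\<Sum>h\<in>{h. h < r' i \<and> dg' i h = \<alpha>}. cst (f i g h) * cst (k i h g')) = (if g = g' then 1 else 0)"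
    if g: "g \<in> {g. g < r i \<and> dg i g = \<alpha>}" and g': "g' \<in> {g. g < r i \<and> dg i g = \<alpha>}" for g g'
  proof -
    have "cst (f i g h) = 0" if "h < r' i" "dg' i h \<noteq> \<alpha>" for h
      using homogeneous_cst[OF f(1)[of g i h]] that g by auto
    then have "(\<Sum>h\<in>{h. h < r' i \<and> dg' i h = \<alpha>}. cst (f i g h) * cst (k i h g'))
        = (\<Sum>h<r' i. cst (f i g h) * cst (k i h g'))"
      by (intro sum.mono_neutral_left) auto
    also have "\<dots> = cst (\<phi> i g g')" by (simp add: \<phi>_def cst_sum cst_mult)
    finally show ?thesis using id g g' by simp
  qed
  then show ?thesis
    by (intro card_le_of_left_inverse[where M = "\<lambda>g h. cst (f i g h)" and N = "\<lambda>h g. cst (k i h g)"]) simp_all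
qed

theorem graded_betti_eq:
  assumes F: "resolution A B r dg D e"
  shows "graded_betti A B i \<alpha> = card {g. g < r i \<and> dg i g = \<alpha>}"
proof -
  interpret F: resolution A B r dg D e by (rule F)
  have "graded_betti A B = (\<lambda>i \<alpha>. card {g. g < r i \<and> dg i g = \<alpha>})"
    unfolding graded_betti_def
  proof (rule the_equality)
    show "\<exists>r' dg' D' e'. minimal_free_resolution A B r' dg' D' e' \<and>
        (\<lambda>i \<alpha>. card {g. g < r i \<and> dg i g = \<alpha>}) = (\<lambda>i \<alpha>. card {g. g < r' i \<and> dg' i g = \<alpha>})"
      using F.res by blast
  next
    fix b assume "\<exists>r dg D e. minimal_free_resolution A B r dg D e \<and> b = (\<lambda>i \<alpha>. card {g. g < r i \<and> dg i g = \<alpha>})"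
    then obtain r' dg' D' e' where b: "minimal_free_resolution A B r' dg' D' e'"
        "b = (\<lambda>i \<alpha>. card {g. g < r' i \<and> dg' i g = \<alpha>})" by blast
    have G: "resolution A B r' dg' D' e'"
      using b(1) F.B_ideal F.B_hcomp by (rule resolution.intro)
    show "b = (\<lambda>i \<alpha>. card {g. g < r i \<and> dg i g = \<alpha>})"
      unfolding b(2) by (intro ext order.antisym betti_le[OF F G] betti_le[OF G F])
  qed
  then show ?thesis by simp
qed

section \<open>Multigraded based complexes\<close>

definition bd :: "'c set \<Rightarrow> ('c \<Rightarrow> 'c \<Rightarrow> 'k::field) \<Rightarrow> ('c \<Rightarrow> 'k) \<Rightarrow> 'c \<Rightarrow> 'k" where
  "bd X c z y = (\<Sum>x\<in>X. z x * c x y)"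

definition chain :: "('c \<Rightarrow> 'n mono) \<Rightarrow> 'c set \<Rightarrow> 'n mono \<Rightarrow> ('c \<Rightarrow> 'k::field) \<Rightarrow> bool" where
  "chain dg X \<beta> z \<longleftrightarrow> (\<forall>x. z x \<noteq> 0 \<longrightarrow> x \<in> X \<and> dg x \<le> \<beta>)"

text \<open>A frame is a multigraded complex of free modules in which the entries of the differentials are
  scalar multiples \<open>c x y\<close> of the monomials of exponent \<open>dg x - dg y\<close>. In multidegree \<open>\<beta>\<close> it is the
  complex of vector spaces spanned by the cells of degree at most \<open>\<beta>\<close>.\<close>

locale frame =
  fixes sz :: "'c \<Rightarrow> nat" and dg :: "'c \<Rightarrow> 'n mono" and U :: "'n mono set"
    and X :: "'c set" and c :: "'c \<Rightarrow> 'c \<Rightarrow> 'k::field"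
  assumes fin: "finite X"
    and c_sz: "x \<in> X \<Longrightarrow> y \<in> X \<Longrightarrow> c x y \<noteq> 0 \<Longrightarrow> sz x = Suc (sz y)"
    and c_dg: "x \<in> X \<Longrightarrow> y \<in> X \<Longrightarrow> c x y \<noteq> 0 \<Longrightarrow> dg y \<le> dg x"
    and c_c: "x \<in> X \<Longrightarrow> z \<in> X \<Longrightarrow> (\<Sum>y\<in>X. c x y * c y z) = 0"
    and exact: "\<beta> \<in> U \<Longrightarrow> chain dg X \<beta> v \<Longrightarrow> (\<And>y. y \<in> X \<Longrightarrow> bd X c v y = 0) \<Longrightarrow>
      \<exists>w. chain dg X \<beta> w \<and> (\<forall>y\<in>X. bd X c w y = v y)"

text \<open>Gaussian elimination with pivot \<open>c a b\<close>: the Schur complement that remains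
  after \<open>a\<close> and \<open>b\<close> are split off.\<close>

definition cancel :: "('c \<Rightarrow> 'c \<Rightarrow> 'k::field) \<Rightarrow> 'c \<Rightarrow> 'c \<Rightarrow> 'c \<Rightarrow> 'c \<Rightarrow> 'k" where
  "cancel c a b x y = c x y - c x b * c a y / c a b"

lemma (in frame) bd_bd:
  assumes "z \<in> X"
  shows "bd X c (bd X c w) z = 0"
proof -
  have "bd X c (bd X c w) z = (\<Sum>x\<in>X. w x * (\<Sum>y\<in>X. c x y * c y z))"
    unfolding bd_def sum_distrib_left sum_distrib_right by (subst sum.swap) (simp add: mult.assoc)
  then show ?thesis using assms by (simp add: c_c)
qed

text \<open>Equal degrees make the pivot a unit of the polynomial ring. Exactness is transferred by
  extending a cycle of the smaller complex to \<open>X\<close>, filling it there, and moving the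
  filling off \<open>a\<close> and \<open>b\<close>.\<close>

lemma (in frame) frame_cancel:
  assumes ab: "a \<in> X" "b \<in> X" "c a b \<noteq> 0" and dg: "dg a = dg b"
  shows "frame sz dg U (X - {a, b}) (cancel c a b)"
proof -
  let ?X = "X - {a, b}" and ?c = "cancel c a b"
  have c'b: "?c x b = 0" and c'a: "?c a y = 0" for x y
    using ab(3) by (simp_all add: cancel_def)
  have sz_ab: "sz a = Suc (sz b)" using c_sz ab by blast
  have caa: "c a a = 0" using c_sz[of a a] ab(1) by force
  have restrict: "(\<Sum>x\<in>?X. f x) = (\<Sum>x\<in>X. f x)" if "f a = 0" "f b = 0" for f :: "'c \<Rightarrow> 'k"
    using fin that by (intro sum.mono_neutral_left) auto
  show ?thesis
  proof
    show "finite ?X" using fin by simp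
  next
    fix x y assume xy: "x \<in> ?X" "y \<in> ?X" "?c x y \<noteq> 0"
    then have "c x y \<noteq> 0 \<or> (c x b \<noteq> 0 \<and> c a y \<noteq> 0)" by (auto simp: cancel_def)
    then show "sz x = Suc (sz y)"
      using c_sz[of x y] c_sz[of x b] c_sz[of a y] ab xy sz_ab by auto
    from \<open>c x y \<noteq> 0 \<or> (c x b \<noteq> 0 \<and> c a y \<noteq> 0)\<close> show "dg y \<le> dg x"
    proof
      assume "c x y \<noteq> 0" then show ?thesis using c_dg xy by simp
    next
      assume h: "c x b \<noteq> 0 \<and> c a y \<noteq> 0"
      have "dg y \<le> dg a" using c_dg[of a y] ab xy h by simp
      also have "\<dots> \<le> dg x" unfolding dg using c_dg[of x b] ab xy h by simp
      finally show ?thesis .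
    qed
  next
    fix x z assume xz: "x \<in> ?X" "z \<in> ?X"
    define p q where "p = c x b / c a b" and "q = c a z / c a b"
    have "(\<Sum>y\<in>?X. ?c x y * ?c y z) = (\<Sum>y\<in>X. ?c x y * ?c y z)"
      by (rule restrict) (simp_all add: c'b c'a)
    also have "\<dots> = (\<Sum>y\<in>X. c x y * c y z - q * (c x y * c y b) - p * (c a y * c y z) + p * q * (c a y * c y b))"
      by (intro sum.cong refl) (simp add: cancel_def p_def q_def algebra_simps)
    also have "\<dots> = 0"
      unfolding sum.distrib sum_subtractf sum_distrib_left[symmetric] using xz ab by (simp add: c_c)
    finally show "(\<Sum>y\<in>?X. ?c x y * ?c y z) = 0" .
  next
    fix \<beta> v assume \<beta>: "\<beta> \<in> U" and v: "chain dg ?X \<beta> v" and cyc: "\<And>y. y \<in> ?X \<Longrightarrow> bd ?X ?c v y = 0"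
    have va: "v a = 0" "v b = 0" using v by (auto simp: chain_def)
    have bdX: "bd ?X f v y = bd X f v y" for f y
      unfolding bd_def by (rule restrict) (simp_all add: va)
    \<comment> \<open>The coefficient \<open>- t\<close> at \<open>a\<close> is chosen to cancel the
      boundary of \<open>v\<close> at \<open>b\<close>.\<close>
    define t where "t = bd X c v b / c a b"
    define v' where "v' x = (if x = a then - t else v x)" for x
    have bdv': "bd X c v' y = bd X c v y - t * c a y" for y
    proof -
      have "bd X c v' y = (\<Sum>x\<in>X. v x * c x y + (if x = a then - t * c a y else 0))"
        unfolding bd_def by (intro sum.cong refl) (auto simp: v'_def va)
      then show ?thesis using fin ab(1) by (simp add: sum.distrib bd_def)
    qed
    have chain_v': "chain dg X \<beta> v'"
    proof -
      \<comment> \<open>If \<open>t\<close> is nonzero, then a cell of \<open>v\<close> has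
        \<open>b\<close> in its boundary. This bounds \<open>dg b\<close>, which equals
        \<open>dg a\<close>.\<close>
      have "dg a \<le> \<beta>" if "t \<noteq> 0"
      proof -
        from that have "bd X c v b \<noteq> 0" by (auto simp: t_def)
        then obtain x where x: "x \<in> X" "v x * c x b \<noteq> 0"
          unfolding bd_def by (rule sum.not_neutral_contains_not_neutral)
        then have "dg a \<le> dg x" unfolding dg using c_dg ab by simp
        also have "dg x \<le> \<beta>" using v x by (auto simp: chain_def)
        finally show ?thesis .
      qed
      then show ?thesis using v ab(1) by (auto simp: chain_def v'_def)
    qed
    have cyc': "bd X c v' y = 0" if "y \<in> X" "y \<noteq> a" for y
    proof (cases "y = b")
      case True
      then show ?thesis using ab(3) by (simp add: bdv' t_def)
    next
      case False
      have "t * c a y = (\<Sum>x\<in>X. v x * (c x b * c a y / c a b))"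
        unfolding t_def bd_def sum_divide_distrib sum_distrib_right by (intro sum.cong refl) simp
      then have "bd X ?c v y = bd X c v y - t * c a y"
        by (simp add: bd_def cancel_def right_diff_distrib sum_subtractf)
      then show ?thesis using cyc[of y] that False by (simp add: bdX bdv')
    qed
    \<comment> \<open>Only the value at \<open>a\<close> is left. It is the only possible
      contribution to the second boundary at \<open>b\<close>, which vanishes, and the pivot is
      nonzero.\<close>
    have "bd X c v' a = 0"
    proof -
      have "bd X c (bd X c v') b = (\<Sum>x\<in>X. if x = a then bd X c v' a * c a b else 0)"
        by (subst (1) bd_def) (intro sum.cong refl, auto simp: cyc')
      then have "bd X c v' a * c a b = 0"
        using bd_bd[OF ab(2)] fin ab(1) by simp
      then show ?thesis using ab(3) by simp
    qed
    with cyc' have "\<And>y. y \<in> X \<Longrightarrow> bd X c v' y = 0" by metis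
    then obtain w where w: "chain dg X \<beta> w" "\<And>y. y \<in> X \<Longrightarrow> bd X c w y = v' y"
      using exact[OF \<beta> chain_v'] by blast
    \<comment> \<open>Subtracting \<open>s\<close> times the boundary of \<open>a\<close> clears the
      coefficient at \<open>b\<close> and does not change the boundary of \<open>w\<close>.\<close>
    define s where "s = w b / c a b"
    define w' where "w' x = (if x \<in> X then w x - s * c a x else 0)" for x
    have chain_w': "chain dg X \<beta> w'"
      unfolding chain_def
    proof (intro allI impI conjI)
      fix x assume nz: "w' x \<noteq> 0"
      then show "x \<in> X" by (simp add: w'_def split: if_splits)
      have "w x \<noteq> 0 \<or> (w b \<noteq> 0 \<and> c a x \<noteq> 0)"
        using nz by (auto simp: w'_def s_def split: if_splits)
      then show "dg x \<le> \<beta>"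
      proof
        assume h: "w b \<noteq> 0 \<and> c a x \<noteq> 0"
        then have "dg x \<le> dg a" using c_dg ab(1) \<open>x \<in> X\<close> by simp
        also have "dg a \<le> \<beta>" unfolding dg using w(1) h by (simp add: chain_def)
        finally show ?thesis .
      qed (use w(1) in \<open>simp add: chain_def\<close>)
    qed
    have w'b: "w' b = 0" using ab by (simp add: w'_def s_def)
    have bdw': "bd X c w' y = v' y" if "y \<in> X" for y
    proof -
      have "bd X c w' y = (\<Sum>x\<in>X. w x * c x y - s * (c a x * c x y))"
        unfolding bd_def by (intro sum.cong refl) (simp add: w'_def algebra_simps)
      then show ?thesis
        using w(2)[OF that] c_c[OF ab(1) that]
        by (simp add: sum_subtractf sum_distrib_left[symmetric] bd_def)
    qed
    define w'' where "w'' x = (if x = a then 0 else w' x)" for x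
    show "\<exists>w. chain dg ?X \<beta> w \<and> (\<forall>y\<in>?X. bd ?X ?c w y = v y)"
    proof (intro exI[of _ w''] conjI ballI)
      show "chain dg ?X \<beta> w''"
        using chain_w' w'b by (auto simp: chain_def w''_def)
      fix y assume y: "y \<in> ?X"
      have "bd ?X ?c w'' y = (\<Sum>x\<in>X. w'' x * ?c x y)"
        unfolding bd_def by (rule restrict) (simp_all add: w''_def w'b)
      also have "\<dots> = (\<Sum>x\<in>X. w' x * ?c x y)"
        by (intro sum.cong refl) (simp add: w''_def c'a)
      also have "\<dots> = bd X c w' y - bd X c w' b * c a y / c a b"
        by (simp add: bd_def cancel_def right_diff_distrib sum_subtractf sum_divide_distrib sum_distrib_right mult.assoc)
      also have "\<dots> = v y" using y ab va caa by (auto simp: bdw' v'_def split: if_splits)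
      finally show "bd ?X ?c w'' y = v y" .
    qed
  qed
qed

section \<open>The Taylor complex\<close>

definition sg :: "nat set \<Rightarrow> nat \<Rightarrow> 'k::field" where
  "sg \<sigma> j = (-1) ^ card {i\<in>\<sigma>. i < j}"

definition tc :: "nat set \<Rightarrow> nat set \<Rightarrow> 'k::field" where
  "tc \<sigma> \<tau> = (\<Sum>j\<in>\<sigma>. if \<tau> = \<sigma> - {j} then sg \<sigma> j else 0)"

lemma sg_sq [simp]: "sg \<sigma> j * sg \<sigma> j = (1 :: 'k::field)"
  by (simp add: sg_def power_add[symmetric] flip: mult_2)

lemma sg_swap:
  assumes "finite \<sigma>" "i \<in> \<sigma>" "j \<in> \<sigma>" "i \<noteq> j"
  shows "sg \<sigma> i * sg (\<sigma> - {i}) j = - (sg \<sigma> j * sg (\<sigma> - {j}) i :: 'k::field)"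
proof -
  have main: "sg \<sigma> i * sg (\<sigma> - {i}) j = - (sg \<sigma> j * sg (\<sigma> - {j}) i :: 'k)"
    if "i < j" "i \<in> \<sigma>" "j \<in> \<sigma>" for i j
  proof -
    have "{l \<in> \<sigma>. l < j} = insert i {l \<in> \<sigma> - {i}. l < j}" using that by auto
    then have "card {l \<in> \<sigma>. l < j} = Suc (card {l \<in> \<sigma> - {i}. l < j})"
      using assms(1) by simp
    moreover have "{l \<in> \<sigma> - {j}. l < i} = {l \<in> \<sigma>. l < i}" using that by auto
    ultimately show ?thesis by (simp add: sg_def)
  qed
  show ?thesis
    using main[of i j] main[of j i] assms by (cases "i < j") auto
qed

lemma tc_face [simp]: "finite \<sigma> \<Longrightarrow> j \<in> \<sigma> \<Longrightarrow> tc \<sigma> (\<sigma> - {j}) = sg \<sigma> j"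
proof -
  assume "finite \<sigma>" "j \<in> \<sigma>"
  moreover from this have "tc \<sigma> (\<sigma> - {j}) = (\<Sum>i\<in>\<sigma>. if i = j then sg \<sigma> j else 0)"
    unfolding tc_def by (intro sum.cong refl) auto
  ultimately show ?thesis by simp
qed

lemma tc_nonzeroE:
  assumes "tc \<sigma> \<tau> \<noteq> (0 :: 'k::field)"
  obtains j where "j \<in> \<sigma>" "\<tau> = \<sigma> - {j}"
proof -
  obtain j where "j \<in> \<sigma>" "(if \<tau> = \<sigma> - {j} then sg \<sigma> j else 0) \<noteq> (0 :: 'k)"
    using assms unfolding tc_def by (rule sum.not_neutral_contains_not_neutral)
  then show ?thesis using that by (auto split: if_splits)
qed

lemma bd_tc:
  fixes z :: "nat set \<Rightarrow> 'k::field"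
  assumes "\<tau> \<subseteq> {..<q}"
  shows "bd (Pow {..<q}) tc z \<tau> = (\<Sum>j\<in>{..<q} - \<tau>. z (insert j \<tau>) * sg (insert j \<tau>) j)"
proof -
  have *: "(j \<in> \<sigma> \<and> \<tau> = \<sigma> - {j}) \<longleftrightarrow> (j \<notin> \<tau> \<and> \<sigma> = insert j \<tau>)" for j \<sigma> by auto
  have "bd (Pow {..<q}) tc z \<tau> = (\<Sum>\<sigma>\<in>Pow {..<q}. \<Sum>j<q. if j \<in> \<sigma> \<and> \<tau> = \<sigma> - {j} then z \<sigma> * sg \<sigma> j else 0)"
    unfolding bd_def
  proof (intro sum.cong refl)
    fix \<sigma> assume "\<sigma> \<in> Pow {..<q}"
    then have "tc \<sigma> \<tau> = (\<Sum>j<q. if j \<in> \<sigma> \<and> \<tau> = \<sigma> - {j} then sg \<sigma> j else 0 :: 'k)"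
      unfolding tc_def by (intro sum.mono_neutral_cong_left) auto
    then show "z \<sigma> * tc \<sigma> \<tau> = (\<Sum>j<q. if j \<in> \<sigma> \<and> \<tau> = \<sigma> - {j} then z \<sigma> * sg \<sigma> j else 0)"
      by (simp add: sum_distrib_left) (intro sum.cong refl, auto)
  qed
  also have "\<dots> = (\<Sum>j<q. \<Sum>\<sigma>\<in>Pow {..<q}. if \<sigma> = insert j \<tau> then (if j \<notin> \<tau> then z \<sigma> * sg \<sigma> j else 0) else 0)"
    by (subst sum.swap) (intro sum.cong refl, simp add: *)
  also have "\<dots> = (\<Sum>j<q. if j \<notin> \<tau> then z (insert j \<tau>) * sg (insert j \<tau>) j else 0)"
    using assms by (intro sum.cong refl) (subst sum.delta, auto)
  also have "\<dots> = (\<Sum>j\<in>{..<q} - \<tau>. z (insert j \<tau>) * sg (insert j \<tau>) j)"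
    by (intro sum.mono_neutral_cong_right) auto
  finally show ?thesis .
qed

lemma tc_tc:
  assumes "\<sigma> \<subseteq> {..<q}" "\<tau> \<subseteq> {..<q}"
  shows "bd (Pow {..<q}) tc (tc \<sigma>) \<tau> = (0 :: 'k::field)"
proof (cases "\<exists>i j. i \<in> \<sigma> \<and> j \<in> \<sigma> \<and> i \<noteq> j \<and> \<tau> = \<sigma> - {i} - {j}")
  case True
  then obtain i j where ij: "i \<in> \<sigma>" "j \<in> \<sigma>" "i \<noteq> j" "\<tau> = \<sigma> - {i} - {j}" by blast
  have f: "finite \<sigma>" using assms(1) finite_subset by blast
  have ins: "insert j \<tau> = \<sigma> - {i}" "insert i \<tau> = \<sigma> - {j}" using ij by auto
  have "tc \<sigma> (insert k \<tau>) = (0::'k)" if "k \<in> {..<q} - \<tau> - {i, j}" for k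
  proof (rule ccontr)
    assume "tc \<sigma> (insert k \<tau>) \<noteq> (0::'k)"
    then obtain l where "insert k \<tau> = \<sigma> - {l}" by (rule tc_nonzeroE)
    then have "k \<in> \<sigma>" by auto
    then show False using that ij by auto
  qed
  then have "bd (Pow {..<q}) tc (tc \<sigma>) \<tau> = (\<Sum>k\<in>{i, j}. tc \<sigma> (insert k \<tau>) * sg (insert k \<tau>) k :: 'k)"
    unfolding bd_tc[OF assms(2)] using ij assms(1) by (intro sum.mono_neutral_right) auto
  also have "\<dots> = tc \<sigma> (insert i \<tau>) * sg (insert i \<tau>) i + tc \<sigma> (insert j \<tau>) * sg (insert j \<tau>) j"
    using ij(3) by simp
  also have "\<dots> = 0"
    using sg_swap[OF f ij(1-3), where 'k = 'k] ij(1-3) f by (simp add: ins)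
  finally show ?thesis .
next
  case False
  have "tc \<sigma> (insert j \<tau>) = (0::'k)" if "j \<in> {..<q} - \<tau>" for j
  proof (rule ccontr)
    assume "tc \<sigma> (insert j \<tau>) \<noteq> (0::'k)"
    then obtain i where i: "i \<in> \<sigma>" "insert j \<tau> = \<sigma> - {i}" by (rule tc_nonzeroE)
    moreover have "\<tau> = insert j \<tau> - {j}" using that by auto
    ultimately show False using False by auto
  qed
  then show ?thesis unfolding bd_tc[OF assms(2)] by simp
qed

lemma mlcm_le_iff: "finite \<sigma> \<Longrightarrow> mlcm ms \<sigma> \<le> \<beta> \<longleftrightarrow> (\<forall>i\<in>\<sigma>. ms ! i \<le> \<beta>)"
  by (auto simp: mlcm_def le_fun_def)

lemma mlcm_mono: "finite \<tau> \<Longrightarrow> \<sigma> \<subseteq> \<tau> \<Longrightarrow> mlcm ms \<sigma> \<le> mlcm ms \<tau>"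
  by (subst mlcm_le_iff) (use mlcm_le_iff[of \<tau> ms "mlcm ms \<tau>"] in \<open>auto intro: finite_subset\<close>)

lemma mlcm_empty [simp]: "mlcm ms {} = 0"
  by (simp add: mlcm_def fun_eq_iff)

text \<open>If the generator at position \<open>p\<close> divides the monomial of exponent
  \<open>\<beta>\<close>, then the faces of degree at most \<open>\<beta>\<close> form a cone with
  apex \<open>p\<close>. The empty face belongs to the complex, so exactness holds there too. For
  \<open>\<beta>\<close> outside the ideal that face is the only one left and gives homology; hence
  the restriction on \<open>\<beta>\<close>.\<close>

lemma taylor_frame:
  "frame card (mlcm ms) {\<beta>. \<exists>m\<in>set ms. m \<le> \<beta>} (Pow {..<length ms}) (tc :: nat set \<Rightarrow> nat set \<Rightarrow> 'k::field)"
proof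
  let ?q = "length ms"
  have fin: "finite \<sigma>" if "\<sigma> \<subseteq> {..<?q}" for \<sigma> using that finite_subset by blast
  show "finite (Pow {..<?q})" by simp
  fix x y :: "nat set" assume xy: "x \<in> Pow {..<?q}" "y \<in> Pow {..<?q}"
  show "(\<Sum>z\<in>Pow {..<?q}. tc x z * tc z y) = (0::'k)"
    using tc_tc[of x ?q y] xy by (simp add: bd_def)
  assume "tc x y \<noteq> (0::'k)"
  then obtain j where j: "j \<in> x" "y = x - {j}" by (rule tc_nonzeroE)
  then show "card x = Suc (card y)" using xy fin card_Suc_Diff1[of x j] by simp
  show "mlcm ms y \<le> mlcm ms x" using j xy fin by (auto intro: mlcm_mono)
next
  let ?q = "length ms"
  have fin: "finite \<sigma>" if "\<sigma> \<subseteq> {..<?q}" for \<sigma> using that finite_subset by blast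
  fix \<beta> and z :: "nat set \<Rightarrow> 'k"
  assume "\<beta> \<in> {\<beta>. \<exists>m\<in>set ms. m \<le> \<beta>}" and z: "chain (mlcm ms) (Pow {..<?q}) \<beta> z"
    and cyc: "\<And>y. y \<in> Pow {..<?q} \<Longrightarrow> bd (Pow {..<?q}) tc z y = 0"
  then obtain p where p: "p < ?q" "ms ! p \<le> \<beta>" by (auto simp: in_set_conv_nth)
  \<comment> \<open>The cone over \<open>z\<close> with apex \<open>p\<close>, with the sign for
    which the face \<open>insert p \<tau>\<close> contributes exactly \<open>z \<tau>\<close> to the
    boundary at \<open>\<tau>\<close>.\<close>
  define w where "w \<rho> = (if p \<in> \<rho> then sg \<rho> p * z (\<rho> - {p}) else 0)" for \<rho>
  show "\<exists>w. chain (mlcm ms) (Pow {..<?q}) \<beta> w \<and> (\<forall>y\<in>Pow {..<?q}. bd (Pow {..<?q}) tc w y = z y)"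
  proof (intro exI[of _ w] conjI ballI)
    show "chain (mlcm ms) (Pow {..<?q}) \<beta> w"
      unfolding chain_def
    proof (intro allI impI)
      fix \<rho> assume "w \<rho> \<noteq> 0"
      then have \<rho>: "p \<in> \<rho>" "z (\<rho> - {p}) \<noteq> 0" by (auto simp: w_def split: if_splits)
      then have 1: "\<rho> - {p} \<subseteq> {..<?q}" "mlcm ms (\<rho> - {p}) \<le> \<beta>" using z by (auto simp: chain_def)
      have 2: "\<rho> \<subseteq> {..<?q}" using 1(1) p(1) by auto
      have "mlcm ms \<rho> \<le> \<beta>"
        using 1(2) p(2) mlcm_le_iff[OF fin[OF 1(1)], of ms \<beta>] mlcm_le_iff[OF fin[OF 2], of ms \<beta>] by blast
      then show "\<rho> \<in> Pow {..<?q} \<and> mlcm ms \<rho> \<le> \<beta>" using 2 by simp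
    qed
  next
    fix \<tau> assume "\<tau> \<in> Pow {..<?q}"
    then have \<tau>: "\<tau> \<subseteq> {..<?q}" by simp
    show "bd (Pow {..<?q}) tc w \<tau> = z \<tau>"
    proof (cases "p \<in> \<tau>")
      case False
      have "bd (Pow {..<?q}) tc w \<tau> = (\<Sum>j\<in>{p}. w (insert j \<tau>) * sg (insert j \<tau>) j)"
        unfolding bd_tc[OF \<tau>] using p(1) False
        by (intro sum.mono_neutral_right) (auto simp: w_def)
      also have "\<dots> = sg (insert p \<tau>) p * sg (insert p \<tau>) p * z \<tau>"
        using False by (simp add: w_def)
      finally show ?thesis by simp
    next
      case True
      define \<tau>' where "\<tau>' = \<tau> - {p}"
      have \<tau>': "\<tau>' \<subseteq> {..<?q}" "insert p \<tau>' = \<tau>" using \<tau> True by (auto simp: \<tau>'_def)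
      have split: "{..<?q} - \<tau>' = insert p ({..<?q} - \<tau>)" "p \<notin> {..<?q} - \<tau>"
        using True p(1) by (auto simp: \<tau>'_def)
      \<comment> \<open>For \<open>\<tau>\<close> containing \<open>p\<close>, the value
        \<open>z \<tau>\<close> is recovered from the cycle condition at
        \<open>\<tau> - {p}\<close>.\<close>
      have "bd (Pow {..<?q}) tc z \<tau>' = z \<tau> * sg \<tau> p + (\<Sum>j\<in>{..<?q} - \<tau>. z (insert j \<tau>') * sg (insert j \<tau>') j)"
        unfolding bd_tc[OF \<tau>'(1)] split(1) by (subst sum.insert) (use split(2) \<tau>'(2) in auto)
      then have *: "(\<Sum>j\<in>{..<?q} - \<tau>. z (insert j \<tau>') * sg (insert j \<tau>') j) = - (z \<tau> * sg \<tau> p)"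
        using cyc[of \<tau>'] \<tau>'(1) by (simp add: add_eq_0_iff)
      have "w (insert j \<tau>) * sg (insert j \<tau>) j = - sg \<tau> p * (z (insert j \<tau>') * sg (insert j \<tau>') j)"
        if j: "j \<in> {..<?q} - \<tau>" for j
      proof -
        let ?\<sigma> = "insert j \<tau>"
        have e: "?\<sigma> - {p} = insert j \<tau>'" "?\<sigma> - {j} = \<tau>" using j True by (auto simp: \<tau>'_def)
        have "sg ?\<sigma> p * sg (?\<sigma> - {p}) j = - (sg ?\<sigma> j * sg (?\<sigma> - {j}) p :: 'k)"
          using True j \<tau> fin by (intro sg_swap) auto
        then have s: "sg ?\<sigma> p * sg (insert j \<tau>') j = - (sg ?\<sigma> j * sg \<tau> p :: 'k)" unfolding e .
        have "sg ?\<sigma> p * sg ?\<sigma> j = sg ?\<sigma> p * (sg (insert j \<tau>') j * sg (insert j \<tau>') j) * sg ?\<sigma> j * (sg \<tau> p * (sg \<tau> p :: 'k))"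
          by simp
        also have "\<dots> = (sg ?\<sigma> p * sg (insert j \<tau>') j) * (sg ?\<sigma> j * sg \<tau> p) * (sg (insert j \<tau>') j * sg \<tau> p)"
          by (simp only: mult_ac)
        also have "\<dots> = - (sg ?\<sigma> j * sg ?\<sigma> j) * (sg \<tau> p * sg \<tau> p) * (sg (insert j \<tau>') j * sg \<tau> p)"
          unfolding s by (simp only: mult_ac mult_minus_left mult_minus_right)
        finally have "sg ?\<sigma> p * sg ?\<sigma> j = - (sg (insert j \<tau>') j * sg \<tau> p :: 'k)" by simp
        then have "z (insert j \<tau>') * (sg ?\<sigma> p * sg ?\<sigma> j) = z (insert j \<tau>') * - (sg (insert j \<tau>') j * sg \<tau> p :: 'k)"
          by simp
        then show ?thesis using True by (simp add: w_def e mult_ac)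
      qed
      then have "bd (Pow {..<?q}) tc w \<tau> = - sg \<tau> p * (\<Sum>j\<in>{..<?q} - \<tau>. z (insert j \<tau>') * sg (insert j \<tau>') j)"
        unfolding bd_tc[OF \<tau>] sum_distrib_left by (intro sum.cong refl)
      also have "\<dots> = sg \<tau> p * sg \<tau> p * z \<tau>" unfolding * by (simp add: mult_ac del: sg_sq)
      finally show ?thesis by simp
    qed
  qed
qed

section \<open>Frames as free resolutions\<close>

lemma single_times_single:
  fixes c d :: "'k::field"
  assumes "c \<noteq> 0 \<Longrightarrow> y \<le> x" "d \<noteq> 0 \<Longrightarrow> z \<le> y"
  shows "Poly_Mapping.single (x - y) c * Poly_Mapping.single (y - z) d = (Poly_Mapping.single (x - z) (c * d) :: ('n, 'k) mpoly)"
proof (cases "c = 0 \<or> d = 0")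
  case False
  then have "y \<le> x" "z \<le> y" using assms by auto
  then have "x - y + (y - z) = x - z"
    by (simp add: fun_eq_iff le_fun_def fun_diff_def)
  then show ?thesis by (simp add: mult_single)
qed auto

text \<open>Exactness is checked one multidegree at a time. The restriction to \<open>U\<close> is
  harmless: a vector in the kernel of the augmentation has its exponents in \<open>U\<close>, and in
  higher homological degrees every cell has degree in \<open>U\<close>.\<close>

lemma (in frame) minimal_free_resolution_of_frame:
  fixes M :: "'n mono set"
  assumes U: "U = {\<beta>. \<exists>m\<in>M. m \<le> \<beta>}"
    and x0: "x0 \<in> X" "sz x0 = 0" "dg x0 = 0"
    and dgU: "\<And>x. x \<in> X \<Longrightarrow> x \<noteq> x0 \<Longrightarrow> dg x \<in> U"
    and sz0: "\<And>x. x \<in> X \<Longrightarrow> sz x = 0 \<Longrightarrow> x = x0"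
    and minimal: "\<And>x y. x \<in> X \<Longrightarrow> y \<in> X \<Longrightarrow> dg x = dg y \<Longrightarrow> c x y = 0"
  obtains r dg' D e where
    "minimal_free_resolution UNIV (ideal_gen (monom ` M) :: ('n, 'k) mpoly set) r dg' D e"
    "\<And>i \<alpha>. card {g. g < r i \<and> dg' i g = \<alpha>} = card {x \<in> X. sz x = i \<and> multideg (dg x) = \<alpha>}"
proof -
  define r where "r i = card {x \<in> X. sz x = i}" for i
  have "\<exists>h. bij_betw h {..<r i} {x \<in> X. sz x = i}" for i
    unfolding r_def using ex_bij_betw_nat_finite[of "{x \<in> X. sz x = i}"] fin by (auto simp: atLeast0LessThan)
  then obtain en where en: "\<And>i. bij_betw (en i) {..<r i} {x \<in> X. sz x = i}" by metis
  define ix where "ix x = inv_into {..<r (sz x)} (en (sz x)) x" for x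
  have en_mem: "en i g \<in> X" "sz (en i g) = i" if "g < r i" for i g
    using bij_betwE[OF en[of i]] that by auto
  have ix_en: "ix (en i g) = g" if "g < r i" for i g
    using bij_betw_inv_into_left[OF en[of i], of g] that en_mem[OF that] by (simp add: ix_def)
  have ix_mem: "ix x < r (sz x)" and en_ix: "en (sz x) (ix x) = x" if "x \<in> X" for x
  proof -
    have "x \<in> en (sz x) ` {..<r (sz x)}" using en[of "sz x"] that by (simp add: bij_betw_def)
    then show "ix x < r (sz x)" "en (sz x) (ix x) = x"
      unfolding ix_def using inv_into_into[of x "en (sz x)" "{..<r (sz x)}"] f_inv_into_f[of x "en (sz x)" "{..<r (sz x)}"] by auto
  qed
  define dg' where "dg' i g = multideg (dg (en i g))" for i g
  define D :: "nat \<Rightarrow> nat \<Rightarrow> nat \<Rightarrow> ('n, 'k) mpoly" where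
    "D i g h = Poly_Mapping.single (dg (en (Suc i) g) - dg (en i h)) (c (en (Suc i) g) (en i h))" for i g h
  define e :: "nat \<Rightarrow> ('n, 'k) mpoly" where "e g = 1" for g
  \<comment> \<open>The part of \<open>v\<close> in multidegree \<open>\<beta>\<close>, as a chain
    on the cells. The guard \<open>dg x \<le> \<beta>\<close> matters because subtraction of
    exponents is truncated.\<close>
  define strand where "strand i v \<beta> x = (if x \<in> X \<and> sz x = i \<and> dg x \<le> \<beta>
      then Poly_Mapping.lookup (v (ix x)) (\<beta> - dg x) else 0)"
    for i :: nat and v :: "nat \<Rightarrow> ('n, 'k) mpoly" and \<beta> x
  have sum_X: "(\<Sum>x\<in>X. f x) = (\<Sum>g<r i. f (en i g))" if "\<And>x. x \<in> X \<Longrightarrow> sz x \<noteq> i \<Longrightarrow> f x = 0"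
    for f :: "'c \<Rightarrow> 'k" and i
  proof -
    have "(\<Sum>x\<in>X. f x) = (\<Sum>x\<in>{x \<in> X. sz x = i}. f x)"
      using fin that by (intro sum.mono_neutral_right) auto
    also have "\<dots> = (\<Sum>g<r i. f (en i g))"
      using sum.reindex_bij_betw[OF en[of i], of f] by simp
    finally show ?thesis .
  qed
  have chain_strand: "chain dg X \<beta> (strand i v \<beta>)" for i v \<beta>
    by (auto simp: chain_def strand_def)
  have bd_strand: "bd X c (strand (Suc j) v \<beta>) (en j h)
      = Poly_Mapping.lookup (\<Sum>g<r (Suc j). v g * D j g h) (\<beta> - dg (en j h))"
    if h: "h < r j" and le: "dg (en j h) \<le> \<beta>" for j v \<beta> h
  proof -
    let ?y = "en j h"
    have "bd X c (strand (Suc j) v \<beta>) ?y = (\<Sum>g<r (Suc j). strand (Suc j) v \<beta> (en (Suc j) g) * c (en (Suc j) g) ?y)"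
      unfolding bd_def by (rule sum_X) (simp add: strand_def)
    also have "\<dots> = (\<Sum>g<r (Suc j). Poly_Mapping.lookup (v g * D j g h) (\<beta> - dg ?y))"
    proof (intro sum.cong refl)
      fix g assume "g \<in> {..<r (Suc j)}"
      then have g: "g < r (Suc j)" by simp
      let ?x = "en (Suc j) g"
      show "strand (Suc j) v \<beta> ?x * c ?x ?y = Poly_Mapping.lookup (v g * D j g h) (\<beta> - dg ?y)"
      proof (cases "c ?x ?y = 0")
        case True
        then show ?thesis by (simp add: D_def)
      next
        case False
        then have yx: "dg ?y \<le> dg ?x" using c_dg en_mem g h by blast
        have 1: "dg ?x - dg ?y \<le> \<beta> - dg ?y \<longleftrightarrow> dg ?x \<le> \<beta>"
          using yx le unfolding le_fun_def fun_diff_def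
          by (metis diff_le_mono le_diff_iff)
        have 2: "\<beta> - dg ?y - (dg ?x - dg ?y) = \<beta> - dg ?x"
          using yx le unfolding le_fun_def fun_diff_def by (auto simp: fun_eq_iff)
        show ?thesis
          unfolding D_def lookup_times_single 1 2 using g by (simp add: strand_def ix_en en_mem)
      qed
    qed
    finally show ?thesis by (simp add: lookup_sum)
  qed
  have bd_strand_0: "bd X c (strand i v \<beta>) y = 0"
    if y: "y \<in> X" and n: "\<not> (dg y \<le> \<beta> \<and> i = Suc (sz y))" for i v \<beta> y
    unfolding bd_def
  proof (intro sum.neutral ballI)
    fix x assume x: "x \<in> X"
    show "strand i v \<beta> x * c x y = 0"
    proof (rule ccontr)
      assume "strand i v \<beta> x * c x y \<noteq> 0"
      then have "strand i v \<beta> x \<noteq> 0" "c x y \<noteq> 0" by auto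
      then have "sz x = i" "dg x \<le> \<beta>" "sz x = Suc (sz y)" "dg y \<le> dg x"
        using c_sz[OF x y] c_dg[OF x y] by (auto simp: strand_def split: if_splits)
      with n show False by (auto intro: order.trans)
    qed
  qed
  have lift: "v \<in> lin_map (r (Suc i)) (r i) (D i) ` free_mod (r (Suc i))"
    if v: "v \<in> free_mod (r i)" and inU: "\<And>\<beta> x. strand i v \<beta> x \<noteq> 0 \<Longrightarrow> \<beta> \<in> U"
      and cyc: "\<And>\<beta> y. y \<in> X \<Longrightarrow> bd X c (strand i v \<beta>) y = 0" for i v
  proof -
    \<comment> \<open>Only finitely many multidegrees occur in \<open>v\<close>. Each is filled
      separately by exactness, and the fillings are the homogeneous parts of
      \<open>u\<close>.\<close>
    define S where "S = {\<beta>. \<exists>x. strand i v \<beta> x \<noteq> 0}"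
    have "S \<subseteq> (\<Union>g<r i. (\<lambda>k. k + dg (en i g)) ` Poly_Mapping.keys (v g))"
    proof
      fix \<beta> assume "\<beta> \<in> S"
      then obtain x where "strand i v \<beta> x \<noteq> 0" by (auto simp: S_def)
      then have x: "x \<in> X" "sz x = i" "dg x \<le> \<beta>" "\<beta> - dg x \<in> Poly_Mapping.keys (v (ix x))"
        by (auto simp: strand_def in_keys_iff split: if_splits)
      have "\<beta> = (\<beta> - dg x) + dg (en i (ix x))"
        using mono_add_diff[OF x(3)] en_ix[OF x(1)] x(2) by (simp add: add.commute[of "\<beta> - dg x"])
      then show "\<beta> \<in> (\<Union>g<r i. (\<lambda>k. k + dg (en i g)) ` Poly_Mapping.keys (v g))"
        using ix_mem[OF x(1)] x(2,4) by (intro UN_I[of "ix x"] image_eqI[of _ _ "\<beta> - dg x"]) auto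
    qed
    then have finS: "finite S" by (rule finite_subset) auto
    have "\<exists>w. chain dg X \<beta> w \<and> (\<forall>y\<in>X. bd X c w y = strand i v \<beta> y)" if "\<beta> \<in> S" for \<beta>
      using exact[OF _ chain_strand cyc] inU that by (auto simp: S_def)
    then obtain w where w: "\<And>\<beta>. \<beta> \<in> S \<Longrightarrow> chain dg X \<beta> (w \<beta>)"
      "\<And>\<beta> y. \<beta> \<in> S \<Longrightarrow> y \<in> X \<Longrightarrow> bd X c (w \<beta>) y = strand i v \<beta> y" by metis
    define u where "u g = (if g < r (Suc i) then \<Sum>\<beta>\<in>{\<beta>\<in>S. dg (en (Suc i) g) \<le> \<beta>}.
        Poly_Mapping.single (\<beta> - dg (en (Suc i) g)) (w \<beta> (en (Suc i) g)) else 0)" for g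
    have u: "u \<in> free_mod (r (Suc i))" by (simp add: free_mod_def u_def)
    have lookup_u: "Poly_Mapping.lookup (u g) (\<beta> - dg (en (Suc i) g)) = (if \<beta> \<in> S then w \<beta> (en (Suc i) g) else 0)"
      if g: "g < r (Suc i)" and le: "dg (en (Suc i) g) \<le> \<beta>" for g \<beta>
    proof -
      let ?d = "dg (en (Suc i) g)"
      have eq: "\<beta>' - ?d = \<beta> - ?d \<longleftrightarrow> \<beta>' = \<beta>" if "?d \<le> \<beta>'" for \<beta>'
        using mono_add_diff[OF le] mono_add_diff[OF that] by metis
      have "Poly_Mapping.lookup (u g) (\<beta> - ?d) = (\<Sum>\<beta>'\<in>{\<beta>'\<in>S. ?d \<le> \<beta>'}. if \<beta>' = \<beta> then w \<beta> (en (Suc i) g) else 0)"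
        using g unfolding u_def by (simp add: lookup_sum) (intro sum.cong refl, auto simp: lookup_single when_def eq)
      then show ?thesis using finS le by (simp add: sum.delta)
    qed
    have strand_u: "strand (Suc i) u \<beta> x = (if \<beta> \<in> S \<and> sz x = Suc i then w \<beta> x else 0)" for \<beta> x
    proof (cases "x \<in> X \<and> sz x = Suc i \<and> dg x \<le> \<beta>")
      case True
      then show ?thesis using lookup_u[of "ix x" \<beta>] ix_mem[of x] en_ix[of x] by (auto simp: strand_def)
    next
      case False
      then have "\<beta> \<in> S \<Longrightarrow> sz x = Suc i \<Longrightarrow> w \<beta> x = 0" using w(1)[of \<beta>] by (auto simp: chain_def)
      then show ?thesis using False by (auto simp: strand_def)
    qed
    have bd_u: "bd X c (strand (Suc i) u \<beta>) y = strand i v \<beta> y" if y: "y \<in> X" "sz y = i" for \<beta> y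
    proof (cases "\<beta> \<in> S")
      case True
      have "bd X c (strand (Suc i) u \<beta>) y = bd X c (w \<beta>) y"
        unfolding bd_def strand_u using True c_sz[OF _ y(1)] y(2) by (intro sum.cong refl) auto
      then show ?thesis using w(2)[OF True y(1)] by simp
    next
      case False
      then show ?thesis by (auto simp: bd_def strand_u S_def)
    qed
    have "lin_map (r (Suc i)) (r i) (D i) u = v"
    proof
      fix h
      show "lin_map (r (Suc i)) (r i) (D i) u h = v h"
      proof (cases "h < r i")
        case True
        let ?y = "en i h"
        have "Poly_Mapping.lookup (\<Sum>g<r (Suc i). u g * D i g h) s = Poly_Mapping.lookup (v h) s" for s
        proof -
          have le: "dg ?y \<le> s + dg ?y" and d: "s + dg ?y - dg ?y = s"
            by (simp_all add: le_fun_def fun_diff_def fun_eq_iff)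
          have "Poly_Mapping.lookup (\<Sum>g<r (Suc i). u g * D i g h) s = strand i v (s + dg ?y) ?y"
            using bd_strand[OF True le, of u] bd_u[OF en_mem[OF True], of "s + dg ?y"] unfolding d by (rule subst)
          also have "\<dots> = Poly_Mapping.lookup (v h) s"
            unfolding strand_def ix_en[OF True] d using le en_mem[OF True] by simp
          finally show ?thesis .
        qed
        then have "(\<Sum>g<r (Suc i). u g * D i g h) = v h" by (intro poly_mapping_eqI)
        then show ?thesis using True by (simp add: lin_map_def)
      next
        case False
        then show ?thesis using v by (simp add: lin_map_def free_mod_def)
      qed
    qed
    then show ?thesis using u by blast
  qed
  have X0: "{x \<in> X. sz x = 0} = {x0}" using x0(1,2) sz0 by blast
  have r0: "r 0 = 1" by (simp add: r_def X0)
  have en0: "en 0 0 = x0" using en_mem[of 0 0] r0 by (intro sz0) simp_all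
  have DD: "(\<Sum>l<r (Suc i). D (Suc i) g l * D i l h) = 0" if "g < r (Suc (Suc i))" "h < r i" for i g h
  proof -
    let ?x = "en (Suc (Suc i)) g" and ?z = "en i h"
    have "D (Suc i) g l * D i l h = Poly_Mapping.single (dg ?x - dg ?z) (c ?x (en (Suc i) l) * c (en (Suc i) l) ?z)"
      if "l < r (Suc i)" for l
      unfolding D_def using that en_mem \<open>g < _\<close> \<open>h < _\<close> by (intro single_times_single c_dg) auto
    then have "(\<Sum>l<r (Suc i). D (Suc i) g l * D i l h)
        = Poly_Mapping.single (dg ?x - dg ?z) (\<Sum>l<r (Suc i). c ?x (en (Suc i) l) * c (en (Suc i) l) ?z)"
      by (intro poly_mapping_eqI) (auto simp: lookup_sum lookup_single when_def)
    also have "(\<Sum>l<r (Suc i). c ?x (en (Suc i) l) * c (en (Suc i) l) ?z) = (\<Sum>y\<in>X. c ?x y * c y ?z)"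
      using c_sz[of _ ?z] en_mem[OF \<open>h < r i\<close>] by (intro sum_X[symmetric]) force
    also have "\<dots> = 0" using c_c en_mem that by blast
    finally show ?thesis by simp
  qed
  let ?I = "ideal_gen (monom ` M) :: ('n, 'k) mpoly set"
  have mem_I: "p \<in> ?I \<longleftrightarrow> Poly_Mapping.keys p \<subseteq> U" for p
    unfolding mem_monomial_ideal_iff U by auto
  have e_sum: "(\<Sum>g<r 0. v g * e g) = v 0" for v by (simp add: r0 e_def)
  have "minimal_free_resolution UNIV ?I r dg' D e"
    unfolding minimal_free_resolution_def
  proof (intro conjI allI impI)
    fix g assume "g < r 0"
    then show "homogeneous (dg' 0 g) (e g)" by (simp add: r0 dg'_def en0 x0 e_def)
  next
    fix i g h assume gh: "g < r (Suc i)" "h < r i"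
    show "homogeneous (dg' (Suc i) g - dg' i h) (D i g h)"
    proof (cases "c (en (Suc i) g) (en i h) = 0")
      case False
      then have "dg (en i h) \<le> dg (en (Suc i) g)" using c_dg en_mem gh by blast
      then show ?thesis unfolding D_def dg'_def by (metis homogeneous_single multideg_diff)
    qed (simp add: D_def)
    show "\<not> D i g h dvd 1"
    proof
      assume "D i g h dvd 1"
      then have nz: "Poly_Mapping.lookup (D i g h) 0 \<noteq> 0" using cst_dvd_one by (auto simp: cst_def)
      then have *: "dg (en (Suc i) g) - dg (en i h) = 0" "c (en (Suc i) g) (en i h) \<noteq> 0"
        by (auto simp: D_def lookup_single when_def split: if_splits)
      have "dg (en i h) \<le> dg (en (Suc i) g)" using c_dg en_mem gh *(2) by blast
      then have "dg (en (Suc i) g) = dg (en i h)"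
        using mono_add_diff[of "dg (en i h)" "dg (en (Suc i) g)"] *(1) by simp
      then show False using minimal en_mem gh *(2) by blast
    qed
  next
    have "p \<in> {(\<Sum>g<r 0. v g * e g) + b | v b. v \<in> free_mod (r 0) \<and> b \<in> ?I}" for p
    proof (intro CollectI exI conjI)
      show "p = (\<Sum>g<r 0. (\<lambda>g. if g = 0 then p else 0) g * e g) + 0" by (simp add: e_sum)
      show "(\<lambda>g. if g = 0 then p else 0) \<in> free_mod (r 0)" by (simp add: free_mod_def r0)
      show "0 \<in> ?I" by (simp add: mem_I)
    qed
    then show "{(\<Sum>g<r 0. v g * e g) + b | v b. v \<in> free_mod (r 0) \<and> b \<in> ?I} = UNIV" by blast
  next
    show "{v \<in> free_mod (r 0). (\<Sum>g<r 0. v g * e g) \<in> ?I} = lin_map (r 1) (r 0) (D 0) ` free_mod (r 1)"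
    proof (intro equalityI subsetI)
      fix v assume "v \<in> {v \<in> free_mod (r 0). (\<Sum>g<r 0. v g * e g) \<in> ?I}"
      then have v: "v \<in> free_mod (r 0)" "Poly_Mapping.keys (v 0) \<subseteq> U" by (simp_all add: e_sum mem_I)
      have "v \<in> lin_map (r (Suc 0)) (r 0) (D 0) ` free_mod (r (Suc 0))"
      proof (rule lift[OF v(1)])
        fix \<beta> x assume s: "strand 0 v \<beta> x \<noteq> 0"
        then have "x = x0" by (intro sz0) (auto simp: strand_def split: if_splits)
        with s have "Poly_Mapping.lookup (v (ix x0)) (\<beta> - 0) \<noteq> 0" by (auto simp: strand_def x0 split: if_splits)
        moreover have "ix x0 = 0" using ix_en[of 0 0] r0 en0 by simp
        ultimately show "\<beta> \<in> U" using v(2) by (auto simp: in_keys_iff)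
      qed (rule bd_strand_0, auto)
      then show "v \<in> lin_map (r 1) (r 0) (D 0) ` free_mod (r 1)" by simp
    next
      fix v assume "v \<in> lin_map (r 1) (r 0) (D 0) ` free_mod (r 1)"
      then obtain u where u: "v = lin_map (r 1) (r 0) (D 0) u" by blast
      have "D 0 g 0 \<in> ?I" if g: "g < r 1" for g
      proof -
        have "en (Suc 0) g \<in> X" "en (Suc 0) g \<noteq> x0" using en_mem[of g "Suc 0"] g x0 by auto
        then have "dg (en (Suc 0) g) \<in> U" by (rule dgU)
        then show ?thesis by (auto simp: mem_I D_def en0 x0 in_keys_iff lookup_single when_def)
      qed
      then have "v 0 \<in> ?I" unfolding u lin_map_def using r0
        by (auto intro!: ideal_gen_sum ideal_gen_mult)
      moreover have "v \<in> free_mod (r 0)" by (simp add: u free_mod_def lin_map_def)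
      ultimately show "v \<in> {v \<in> free_mod (r 0). (\<Sum>g<r 0. v g * e g) \<in> ?I}" by (simp add: e_sum)
    qed
  next
    fix i
    show "{v \<in> free_mod (r (Suc i)). lin_map (r (Suc i)) (r i) (D i) v = (\<lambda>_. 0)} =
          lin_map (r (Suc (Suc i))) (r (Suc i)) (D (Suc i)) ` free_mod (r (Suc (Suc i)))"
    proof (intro equalityI subsetI)
      fix v assume "v \<in> {v \<in> free_mod (r (Suc i)). lin_map (r (Suc i)) (r i) (D i) v = (\<lambda>_. 0)}"
      then have v: "v \<in> free_mod (r (Suc i))" and z: "lin_map (r (Suc i)) (r i) (D i) v = (\<lambda>_. 0)" by auto
      show "v \<in> lin_map (r (Suc (Suc i))) (r (Suc i)) (D (Suc i)) ` free_mod (r (Suc (Suc i)))"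
      proof (rule lift[OF v])
        fix \<beta> x assume "strand (Suc i) v \<beta> x \<noteq> 0"
        then have x: "x \<in> X" "sz x = Suc i" "dg x \<le> \<beta>" by (auto simp: strand_def split: if_splits)
        then have "x \<noteq> x0" using x0 by auto
        then have "dg x \<in> U" using dgU x by simp
        then show "\<beta> \<in> U" unfolding U using x(3) by (auto intro: order.trans)
      next
        fix \<beta> y assume y: "y \<in> X"
        show "bd X c (strand (Suc i) v \<beta>) y = 0"
        proof (cases "dg y \<le> \<beta> \<and> Suc i = Suc (sz y)")
          case True
          then have iy: "ix y < r i" "en i (ix y) = y" using ix_mem[OF y] en_ix[OF y] by auto
          have "(\<Sum>g<r (Suc i). v g * D i g (ix y)) = 0"
            using fun_cong[OF z, of "ix y"] iy(1) by (simp add: lin_map_def)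
          then show ?thesis using bd_strand[of "ix y" i \<beta> v] iy True by simp
        qed (rule bd_strand_0[OF y])
      qed
    next
      fix v assume "v \<in> lin_map (r (Suc (Suc i))) (r (Suc i)) (D (Suc i)) ` free_mod (r (Suc (Suc i)))"
      then obtain u where u: "v = lin_map (r (Suc (Suc i))) (r (Suc i)) (D (Suc i)) u" by blast
      have "(\<Sum>h<r (Suc i). v h * D i h k) = 0" if "k < r i" for k
        unfolding u lin_map_def using that DD by (simp add: sum_mult_assoc)
      then have "lin_map (r (Suc i)) (r i) (D i) v = (\<lambda>_. 0)" by (auto simp: lin_map_def)
      moreover have "v \<in> free_mod (r (Suc i))" by (simp add: u free_mod_def lin_map_def)
      ultimately show "v \<in> {v \<in> free_mod (r (Suc i)). lin_map (r (Suc i)) (r i) (D i) v = (\<lambda>_. 0)}" by simp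
    qed
  qed
  moreover have "card {g. g < r i \<and> dg' i g = \<alpha>} = card {x \<in> X. sz x = i \<and> multideg (dg x) = \<alpha>}" for i \<alpha>
  proof (rule bij_betw_same_card[of "en i"])
    show "bij_betw (en i) {g. g < r i \<and> dg' i g = \<alpha>} {x \<in> X. sz x = i \<and> multideg (dg x) = \<alpha>}"
      unfolding bij_betw_def
    proof (intro conjI equalityI subsetI)
      show "inj_on (en i) {g. g < r i \<and> dg' i g = \<alpha>}"
        by (rule inj_on_subset[OF bij_betw_imp_inj_on[OF en[of i]]]) auto
    next
      fix x assume "x \<in> {x \<in> X. sz x = i \<and> multideg (dg x) = \<alpha>}"
      then show "x \<in> en i ` {g. g < r i \<and> dg' i g = \<alpha>}"
        using ix_mem[of x] en_ix[of x] by (intro image_eqI[of _ _ "ix x"]) (auto simp: dg'_def)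
    qed (auto simp: en_mem dg'_def)
  qed
  ultimately show ?thesis by (rule that)
qed

section \<open>Cancellation along the pruned edges\<close>

definition selected :: "'n mono list \<Rightarrow> nat \<Rightarrow> nat set \<Rightarrow> bool" where
  "selected ms j \<sigma> \<longleftrightarrow> \<sigma> \<in> \<Union> (pruned_edges ms j)"

definition lower :: "'n mono list \<Rightarrow> nat \<Rightarrow> nat set set" where
  "lower ms j = {\<sigma>. \<sigma> \<subseteq> {..<length ms} \<and> j \<notin> \<sigma> \<and> mlcm ms \<sigma> = mlcm ms (insert j \<sigma>) \<and>
     \<not> selected ms j \<sigma> \<and> \<not> selected ms j (insert j \<sigma>)}"

lemma selected_0 [simp]: "\<not> selected ms 0 \<sigma>"
  by (simp add: selected_def)

lemma selected_Suc:
  "selected ms (Suc j) \<sigma> \<longleftrightarrow> selected ms j \<sigma> \<or> (\<exists>\<rho>\<in>lower ms j. \<sigma> = \<rho> \<or> \<sigma> = insert j \<rho>)"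
proof -
  have "pruned_edges ms (Suc j) = pruned_edges ms j \<union> (\<lambda>\<rho>. {\<rho>, insert j \<rho>}) ` lower ms j"
    unfolding pruned_edges.simps lower_def selected_def by (simp only: setcompr_eq_image)
  then show ?thesis unfolding selected_def by simp
qed

lemma selected_mono: "i \<le> j \<Longrightarrow> selected ms i \<sigma> \<Longrightarrow> selected ms j \<sigma>"
  by (rule lift_Suc_mono_le[where f = "\<lambda>j. selected ms j \<sigma>", THEN le_boolD, THEN mp])
     (simp_all add: selected_Suc)

lemma critical_iff: "\<sigma> \<in> critical_faces ms \<longleftrightarrow> \<sigma> \<subseteq> {..<length ms} \<and> \<not> selected ms (length ms) \<sigma>"
  by (auto simp: critical_faces_def selected_def)

lemma lowerI_upper:
  assumes "j \<in> \<sigma>" "\<sigma> \<subseteq> {..<length ms}" "mlcm ms (\<sigma> - {j}) = mlcm ms \<sigma>"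
    "\<not> selected ms j \<sigma>" "\<not> selected ms j (\<sigma> - {j})"
  shows "\<sigma> - {j} \<in> lower ms j"
  using assms unfolding lower_def by (simp add: insert_absorb) blast

lemma selected_iff_ex: "j \<le> q \<Longrightarrow> selected ms q \<sigma> \<longleftrightarrow>
    selected ms j \<sigma> \<or> (\<exists>i. j \<le> i \<and> i < q \<and> (\<exists>\<rho>\<in>lower ms i. \<sigma> = \<rho> \<or> \<sigma> = insert i \<rho>))"
proof (induction q)
  case (Suc q)
  show ?case
  proof (cases "j = Suc q")
    case False
    then have "j \<le> q" using Suc.prems by simp
    from Suc.IH[OF this] show ?thesis
      unfolding selected_Suc less_Suc_eq using \<open>j \<le> q\<close> by (metis (no_types, lifting))
  qed auto
qed auto

text \<open>\<open>R\<close> holds the pairs that are not yet cancelled, so this is the current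
  basis: all faces at the start, the critical faces at the end.\<close>

definition cells :: "'n mono list \<Rightarrow> (nat \<times> nat set) set \<Rightarrow> nat set set" where
  "cells ms R = critical_faces ms \<union> {\<sigma>. \<exists>s \<rho>. (s, \<rho>) \<in> R \<and> (\<sigma> = \<rho> \<or> \<sigma> = insert s \<rho>)}"

definition pairs :: "'n mono list \<Rightarrow> (nat \<times> nat set) set" where
  "pairs ms = {(s, \<rho>). s < length ms \<and> \<rho> \<in> lower ms s}"

lemma cells_pairs: "cells ms (pairs ms) = Pow {..<length ms}"
proof (intro equalityI subsetI)
  fix \<sigma> assume "\<sigma> \<in> cells ms (pairs ms)"
  then show "\<sigma> \<in> Pow {..<length ms}"
    by (auto simp: cells_def pairs_def critical_iff lower_def)
next
  fix \<sigma> assume "\<sigma> \<in> Pow {..<length ms}"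
  then show "\<sigma> \<in> cells ms (pairs ms)"
    using selected_iff_ex[of 0 "length ms" ms \<sigma>] by (auto simp: cells_def pairs_def critical_iff)
qed

lemma face_of_pair:
  assumes "(s, \<rho>) \<in> pairs ms" "\<sigma> = \<rho> \<or> \<sigma> = insert s \<rho>"
  shows "\<not> selected ms s \<sigma>" "selected ms (Suc s) \<sigma>" "\<rho> = \<sigma> - {s}" "\<sigma> \<notin> critical_faces ms"
proof -
  show "\<not> selected ms s \<sigma>" "\<rho> = \<sigma> - {s}" using assms by (auto simp: pairs_def lower_def)
  show sel: "selected ms (Suc s) \<sigma>" using assms by (auto simp: pairs_def selected_Suc)
  show "\<sigma> \<notin> critical_faces ms"
    using selected_mono[OF _ sel, of "length ms"] assms by (auto simp: pairs_def critical_iff)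
qed

text \<open>A face of a pair of step \<open>s\<close> becomes selected precisely in step
  \<open>s\<close>. This determines \<open>s\<close>, and then the lower face is
  \<open>\<sigma> - {s}\<close>.\<close>

lemma pair_unique:
  assumes "(s, \<rho>) \<in> pairs ms" "\<sigma> = \<rho> \<or> \<sigma> = insert s \<rho>"
    and "(s', \<rho>') \<in> pairs ms" "\<sigma> = \<rho>' \<or> \<sigma> = insert s' \<rho>'"
  shows "s = s' \<and> \<rho> = \<rho>'"
proof -
  note 1 = face_of_pair[OF assms(1,2)] and 2 = face_of_pair[OF assms(3,4)]
  have "\<not> s < s'" using selected_mono[OF _ 1(2), of s'] 2(1) by auto
  moreover have "\<not> s' < s" using selected_mono[OF _ 2(2), of s] 1(1) by auto
  ultimately show ?thesis using 1(3) 2(3) by auto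
qed

text \<open>Pairs are cancelled by decreasing step. The first assumption on \<open>c\<close> says that the entries
  between faces that are still unselected before step \<open>j\<close>, and that differ in \<open>j\<close>, are those of the Taylor
  complex as long as only pairs of steps from \<open>j\<close> on have been cancelled.\<close>

lemma cancel_pairs:
  fixes c :: "nat set \<Rightarrow> nat set \<Rightarrow> 'k::field"
  assumes "finite R" "R \<subseteq> pairs ms"
    and "frame card (mlcm ms) U (cells ms R) c"
    and "\<And>s \<rho> j x y. (s, \<rho>) \<in> R \<Longrightarrow> j \<le> s \<Longrightarrow> x \<in> cells ms R \<Longrightarrow> y \<in> cells ms R \<Longrightarrow>
      \<not> selected ms j x \<Longrightarrow> \<not> selected ms j y \<Longrightarrow> mlcm ms x = mlcm ms y \<Longrightarrow> j \<in> x \<Longrightarrow> j \<notin> y \<Longrightarrow> c x y = tc x y"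
    and "\<And>x y. x \<in> cells ms R \<Longrightarrow> \<forall>j\<in>x. mlcm ms (x - {j}) \<noteq> mlcm ms x \<Longrightarrow> y \<in> cells ms R \<Longrightarrow>
      mlcm ms x = mlcm ms y \<Longrightarrow> c x y = 0"
  shows "\<exists>c' :: nat set \<Rightarrow> nat set \<Rightarrow> 'k. frame card (mlcm ms) U (critical_faces ms) c' \<and>
    (\<forall>x\<in>critical_faces ms. (\<forall>j\<in>x. mlcm ms (x - {j}) \<noteq> mlcm ms x) \<longrightarrow>
      (\<forall>y\<in>critical_faces ms. mlcm ms x = mlcm ms y \<longrightarrow> c' x y = 0))"
  using assms
proof (induction "card R" arbitrary: R c)
  case 0
  then have R: "cells ms R = critical_faces ms" by (simp add: cells_def)
  show ?case
    using 0(4) 0(6) unfolding R by (intro exI[of _ c] conjI ballI impI)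
next
  case (Suc n)
  note R = Suc.prems(1,2)
  interpret frame card "mlcm ms" U "cells ms R" c by (rule Suc.prems(3))
  note inv = Suc.prems(4) and zero = Suc.prems(5)
  have "R \<noteq> {}" using Suc.hyps(2) by auto
  then have "Max (fst ` R) \<in> fst ` R" using R(1) by (intro Max_in) auto
  then obtain s b where sb: "(s, b) \<in> R" "s = Max (fst ` R)" by auto
  have max: "s' \<le> s" if "(s', \<rho>) \<in> R" for s' \<rho>
    using that R(1) sb(2) by (force intro!: Max_ge)
  define a where "a = insert s b"
  have pb: "(s, b) \<in> pairs ms" using sb(1) R(2) by auto
  then have b: "b \<subseteq> {..<length ms}" "s \<notin> b" "mlcm ms b = mlcm ms a" "\<not> selected ms s b" "\<not> selected ms s a" "s < length ms"
    by (auto simp: pairs_def lower_def a_def)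
  have fb: "finite b" using b(1) finite_subset by blast
  have sub: "x \<subseteq> {..<length ms}" if "x \<in> cells ms R" for x
    using that R(2) by (auto simp: cells_def pairs_def critical_iff lower_def)
  have cell: "a \<in> cells ms R" "b \<in> cells ms R" using sb(1) by (auto simp: cells_def a_def)
  \<comment> \<open>The invariant with \<open>j = s\<close> applies to the pivot itself, because
    both of its faces are unselected before step \<open>s\<close>.\<close>
  have "c a b = tc a b" using inv[OF sb(1) order.refl cell] b by (simp add: a_def)
  also have "\<dots> = sg a s"
  proof -
    have "b = a - {s}" using b(2) by (auto simp: a_def)
    moreover have "tc a (a - {s}) = sg a s" using fb by (intro tc_face) (simp_all add: a_def)
    ultimately show ?thesis by simp
  qed
  finally have pivot: "c a b \<noteq> 0" by (simp add: sg_def)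
  define R' where "R' = R - {(s, b)}"
  have cells': "cells ms R' = cells ms R - {a, b}"
  proof (intro equalityI subsetI)
    fix x assume x: "x \<in> cells ms R'"
    have "x \<noteq> a \<and> x \<noteq> b"
    proof (rule ccontr)
      assume "\<not> (x \<noteq> a \<and> x \<noteq> b)"
      then have xab: "x = b \<or> x = insert s b" by (auto simp: a_def)
      have "x \<notin> critical_faces ms" by (rule face_of_pair(4)[OF pb xab])
      then obtain s' \<rho> where "(s', \<rho>) \<in> R'" "x = \<rho> \<or> x = insert s' \<rho>" using x by (auto simp: cells_def)
      then show False using pair_unique[OF pb xab, of s' \<rho>] R(2) by (auto simp: R'_def)
    qed
    then show "x \<in> cells ms R - {a, b}" using x by (auto simp: cells_def R'_def)
  next
    fix x assume "x \<in> cells ms R - {a, b}"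
    then show "x \<in> cells ms R'" by (auto simp: cells_def R'_def a_def)
  qed
  have fr: "frame card (mlcm ms) U (cells ms R') (cancel c a b)"
    unfolding cells' by (rule frame_cancel[OF cell pivot]) (simp add: b(3))
  \<comment> \<open>A nonzero correction squeezes the degrees: \<open>y\<close> lies below
    \<open>a\<close>, which has the degree of \<open>b\<close>, and \<open>b\<close> lies below
    \<open>x\<close>.\<close>
  have deg: "mlcm ms b = mlcm ms x" if "x \<in> cells ms R" "y \<in> cells ms R" "mlcm ms x = mlcm ms y" "c x b \<noteq> 0" "c a y \<noteq> 0" for x y
    using c_dg[OF that(1) cell(2) that(4)] c_dg[OF cell(1) that(2) that(5)] that(3) b(3)
    by (intro order.antisym) simp_all
  \<comment> \<open>A nonzero correction would show that \<open>a\<close> or \<open>b\<close> was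
    matched in step \<open>j\<close>. If \<open>j \<notin> b\<close>, the first factor is a Taylor
    entry and \<open>b = x - {j}\<close>; as \<open>b\<close> is unselected before step
    \<open>s\<close>, this gives \<open>s = j\<close> and \<open>x = a\<close>, which has been
    removed. If \<open>j \<in> b\<close>, the second factor is a Taylor entry and
    \<open>y = a - {j}\<close>, so \<open>a\<close> is selected in step \<open>j\<close>, which is
    before \<open>s\<close>.\<close>
  have key: "c x b * c a y = 0"
    if j: "j \<le> s" and x: "x \<in> cells ms R'" and y: "y \<in> cells ms R'" and nx: "\<not> selected ms j x" and ny: "\<not> selected ms j y"
      and xy: "mlcm ms x = mlcm ms y" "j \<in> x" "j \<notin> y" for j x y
  proof (rule ccontr)
    assume "c x b * c a y \<noteq> 0"
    then have nz: "c x b \<noteq> 0" "c a y \<noteq> 0" by auto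
    have xR: "x \<in> cells ms R" "x \<noteq> a" "x \<noteq> b" and yR: "y \<in> cells ms R" "y \<noteq> a" "y \<noteq> b"
      using x y by (auto simp: cells')
    have d: "mlcm ms b = mlcm ms x" by (rule deg[OF xR(1) yR(1) xy(1) nz])
    have nb: "\<not> selected ms j b" "\<not> selected ms j a" using selected_mono[OF j] b by auto
    show False
    proof (cases "j \<in> b")
      case False
      then have "c x b = tc x b" using inv[OF sb(1) j xR(1) cell(2) nx nb(1) d[symmetric] xy(2)] by simp
      then obtain l where "b = x - {l}" using nz(1) by (auto elim: tc_nonzeroE)
      then have bx: "b = x - {j}" using False xy(2) by auto
      then have "b \<in> lower ms j"
        using lowerI_upper[of j x ms] xy(2) sub[OF xR(1)] d nx nb by simp
      then have "selected ms (Suc j) b" by (auto simp: selected_Suc)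
      then have "\<not> Suc j \<le> s" using selected_mono[of "Suc j" s ms b] b(4) by blast
      then have "s = j" using j by simp
      then show False using bx xR(2) xy(2) by (auto simp: a_def)
    next
      case True
      then have js: "j \<noteq> s" "j \<in> a" using b(2) by (auto simp: a_def)
      then have "c a y = tc a y" using inv[OF sb(1) j cell(1) yR(1) nb(2) ny] d xy b(3) by simp
      then obtain l where "y = a - {l}" using nz(2) by (auto elim: tc_nonzeroE)
      then have ya: "y = a - {j}" using js xy(3) by auto
      then have "y \<in> lower ms j"
        using lowerI_upper[of j a ms] js sub[OF cell(1)] d xy(1) b(3) ny nb by simp
      moreover have "a = insert j y" using ya js by auto
      ultimately have "selected ms (Suc j) a" unfolding selected_Suc by (intro disjI2 bexI[of _ y]) simp_all
      then show False using selected_mono[of "Suc j" s ms a] b(5) js j by simp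
    qed
  qed
  have inv': "cancel c a b x y = tc x y"
    if h: "(s', \<rho>) \<in> R'" "j \<le> s'" "x \<in> cells ms R'" "y \<in> cells ms R'"
      "\<not> selected ms j x" "\<not> selected ms j y" "mlcm ms x = mlcm ms y" "j \<in> x" "j \<notin> y" for s' \<rho> j x y
  proof -
    have R: "(s', \<rho>) \<in> R" "x \<in> cells ms R" "y \<in> cells ms R" using h(1,3,4) unfolding cells' by (simp_all add: R'_def)
    have "j \<le> s" using max[OF R(1)] h(2) by (rule order.trans[rotated])
    from key[OF this h(3-9)] inv[OF R(1) h(2) R(2,3) h(5-9)] show ?thesis
      by (simp add: cancel_def)
  qed
  \<comment> \<open>A face all of whose elements are essential has no entry to \<open>b\<close> in
    its own degree, so its row receives no correction within that degree.\<close>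
  have zero': "cancel c a b x y = 0"
    if "x \<in> cells ms R'" "\<forall>j\<in>x. mlcm ms (x - {j}) \<noteq> mlcm ms x" "y \<in> cells ms R'" "mlcm ms x = mlcm ms y" for x y
  proof -
    have R: "x \<in> cells ms R" "y \<in> cells ms R" using that by (auto simp: cells')
    have "c x b * c a y = 0"
    proof (rule ccontr)
      assume "c x b * c a y \<noteq> 0"
      then have "mlcm ms b = mlcm ms x" "c x b \<noteq> 0" using deg[OF R that(4)] by auto
      then show False using zero[OF R(1) that(2) cell(2)] by simp
    qed
    then show ?thesis using zero[OF R(1) that(2) R(2) that(4)] by (simp add: cancel_def)
  qed
  have "n = card R'" using Suc.hyps(2) sb(1) R(1) by (simp add: R'_def)
  then show ?case
    by (rule Suc.hyps(1)[OF _ _ _ fr inv' zero']) (use R in \<open>simp_all add: R'_def subset_insertI2 insert_Diff_if Diff_subset subset_trans[OF Diff_subset]\<close>)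
qed

theorem minimal_pruned_orderI:
  fixes I :: "('n, 'k::field) mpoly set"
  assumes I: "I = ideal_gen (monom ` set ms)" and ms: "distinct ms" "min_gens I = set ms" "0 \<notin> set ms"
    and nonadjacent: "\<And>\<sigma> \<tau> j. \<sigma> \<in> critical_faces ms \<Longrightarrow> \<tau> \<in> critical_faces ms \<Longrightarrow>
      mlcm ms \<sigma> = mlcm ms \<tau> \<Longrightarrow> card \<sigma> = Suc (card \<tau>) \<Longrightarrow> j \<in> \<sigma> \<Longrightarrow> mlcm ms (\<sigma> - {j}) \<noteq> mlcm ms \<sigma>"
  shows "minimal_pruned_order I ms"
proof -
  let ?U = "{\<beta>. \<exists>m\<in>set ms. m \<le> \<beta>}"
  have "pairs ms \<subseteq> {..<length ms} \<times> Pow {..<length ms}" by (auto simp: pairs_def lower_def)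
  then have finp: "finite (pairs ms)" by (rule finite_subset) simp
  have tf: "frame card (mlcm ms) ?U (cells ms (pairs ms)) (tc :: nat set \<Rightarrow> nat set \<Rightarrow> 'k)"
    unfolding cells_pairs by (rule taylor_frame)
  have "\<exists>c' :: nat set \<Rightarrow> nat set \<Rightarrow> 'k. frame card (mlcm ms) ?U (critical_faces ms) c' \<and>
    (\<forall>x\<in>critical_faces ms. (\<forall>j\<in>x. mlcm ms (x - {j}) \<noteq> mlcm ms x) \<longrightarrow>
      (\<forall>y\<in>critical_faces ms. mlcm ms x = mlcm ms y \<longrightarrow> c' x y = 0))"
  proof (rule cancel_pairs[OF finp order.refl tf])
    fix x y :: "nat set" assume x: "\<forall>j\<in>x. mlcm ms (x - {j}) \<noteq> mlcm ms x" and xy: "mlcm ms x = mlcm ms y"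
    show "tc x y = (0::'k)"
    proof (rule ccontr)
      assume "tc x y \<noteq> (0::'k)"
      then obtain j where "j \<in> x" "y = x - {j}" by (rule tc_nonzeroE)
      then show False using x xy by auto
    qed
  qed simp
  then obtain c :: "nat set \<Rightarrow> nat set \<Rightarrow> 'k" where fr: "frame card (mlcm ms) ?U (critical_faces ms) c"
    and zero: "\<forall>x\<in>critical_faces ms. (\<forall>j\<in>x. mlcm ms (x - {j}) \<noteq> mlcm ms x) \<longrightarrow>
      (\<forall>y\<in>critical_faces ms. mlcm ms x = mlcm ms y \<longrightarrow> c x y = 0)"
    by (elim exE conjE) (rule that)
  interpret frame card "mlcm ms" ?U "critical_faces ms" c by (rule fr)
  have fin: "finite x" if "x \<in> critical_faces ms" for x
    using that finite_subset by (auto simp: critical_iff)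
  have U: "mlcm ms x \<in> ?U" if "x \<subseteq> {..<length ms}" "x \<noteq> {}" for x
  proof -
    from that obtain i where "i \<in> x" "i < length ms" by blast
    moreover have "finite x" using that finite_subset by blast
    ultimately have "ms ! i \<le> mlcm ms x" "ms ! i \<in> set ms"
      using mlcm_le_iff[of x ms "mlcm ms x"] by auto
    then show ?thesis by auto
  qed
  have not0: "mlcm ms x \<noteq> 0" if "x \<subseteq> {..<length ms}" "x \<noteq> {}" for x
  proof
    assume "mlcm ms x = 0"
    with U[OF that] obtain m where "m \<in> set ms" "m \<le> 0" by auto
    then have "m = 0" by (auto simp: le_fun_def fun_eq_iff)
    then show False using \<open>m \<in> set ms\<close> ms(3) by simp
  qed
  \<comment> \<open>The empty face survives because no generator is 1. It becomes the generator of
    homological degree 0.\<close>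
  have crit0: "{} \<in> critical_faces ms"
  proof -
    have "\<not> selected ms q {}" if "q \<le> length ms" for q
      using that
    proof (induction q)
      case (Suc q)
      then show ?case using not0[of "{q}"] by (auto simp: selected_Suc lower_def)
    qed simp
    then show ?thesis by (simp add: critical_iff)
  qed
  have minimal: "c x y = 0" if xy: "x \<in> critical_faces ms" "y \<in> critical_faces ms" "mlcm ms x = mlcm ms y" for x y
  proof (rule ccontr)
    assume nz: "c x y \<noteq> 0"
    then have "card x = Suc (card y)" using c_sz xy by blast
    then have "\<forall>j\<in>x. mlcm ms (x - {j}) \<noteq> mlcm ms x" using nonadjacent[OF xy] by blast
    then have "c x y = 0" using zero[rule_format, OF xy(1) _ xy(2,3)] by simp
    then show False using nz by simp
  qed
  obtain r dg' D e where res: "minimal_free_resolution UNIV (ideal_gen (monom ` set ms) :: ('n, 'k) mpoly set) r dg' D e"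
    and count: "\<And>i \<alpha>. card {g. g < r i \<and> dg' i g = \<alpha>} = card {x \<in> critical_faces ms. card x = i \<and> multideg (mlcm ms x) = \<alpha>}"
    by (rule minimal_free_resolution_of_frame[OF refl crit0 _ _ _ _ minimal])
       (use U fin in \<open>auto simp: critical_iff\<close>)
  have "resolution UNIV I r dg' D e"
  proof (rule resolution.intro)
    show "minimal_free_resolution UNIV I r dg' D e" using res by (simp add: I)
    show "module.subspace (*) I" unfolding I by (rule module.subspace_span[OF mpoly_module])
    fix \<alpha> and b :: "('n, 'k) mpoly" assume "b \<in> I"
    moreover have "Poly_Mapping.keys (hcomp \<alpha> b) \<subseteq> Poly_Mapping.keys b"
      unfolding in_keys_iff subset_iff by transfer auto
    ultimately show "hcomp \<alpha> b \<in> I" unfolding I mem_monomial_ideal_iff by auto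
  qed
  from graded_betti_eq[OF this] have "pruned_betti ms i \<alpha> = betti_quotient I i \<alpha>" for i \<alpha>
    by (simp add: pruned_betti_def betti_quotient_def count)
  then show ?thesis using ms by (simp add: minimal_pruned_order_def)
qed

section \<open>Pruning a cycle\<close>

text \<open>A set \<open>B\<close> of edges of the cycle on \<open>m\<close> vertices is a set of numbers below \<open>m\<close>; the edge \<open>j\<close>
  joins the vertices \<open>j\<close> and \<open>j + 1\<close>. Removing \<open>j\<close> does not change the covered vertices iff both
  neighbouring edges are present.\<close>

definition nbrs :: "nat \<Rightarrow> nat set \<Rightarrow> nat \<Rightarrow> bool" where
  "nbrs m B j \<longleftrightarrow> (if j = 0 then m - 1 \<in> B else j - 1 \<in> B) \<and> (if Suc j = m then 0 \<in> B else Suc j \<in> B)"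

definition covered :: "nat \<Rightarrow> nat set \<Rightarrow> nat set" where
  "covered m B = (\<Union>j\<in>B. {j, Suc j mod m})"

text \<open>The natural order does not work: it is changed by swapping \<open>3k + 1\<close> and \<open>3k + 2\<close>.\<close>

definition perm :: "nat \<Rightarrow> nat \<Rightarrow> nat" where
  "perm m i = (if i mod 3 = 1 \<and> i + 2 < m then i + 1 else if i mod 3 = 2 \<and> i + 1 < m then i - 1 else i)"

lemma perm_less: "i < m \<Longrightarrow> perm m i < m"
  by (auto simp: perm_def)

lemma mod3_cases: obtains k where "i = 3 * k" | k where "i = 3 * k + 1" | k where "i = 3 * k + (2 :: nat)"
proof -
  have "i = 3 * (i div 3) \<or> i = 3 * (i div 3) + 1 \<or> i = 3 * (i div 3) + 2" by presburger
  then show ?thesis using that by blast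
qed

text \<open>A block is swapped only if a further edge follows it. Hence edge \<open>m - 1\<close>
  always comes last, and each earlier toggle changes a single letter of the word introduced
  below.\<close>

lemma perm_simps:
  "perm m (3 * k) = 3 * k"
  "perm m (3 * k + 1) = (if 3 * k + 3 < m then 3 * k + 2 else 3 * k + 1)"
  "perm m (3 * k + 2) = (if 3 * k + 3 < m then 3 * k + 1 else 3 * k + 2)"
proof -
  have "(3 * k + 1) mod 3 = 1" "(3 * k + 2) mod 3 = 2" by presburger+
  then show "perm m (3 * k) = 3 * k" "perm m (3 * k + 1) = (if 3 * k + 3 < m then 3 * k + 2 else 3 * k + 1)"
    "perm m (3 * k + 2) = (if 3 * k + 3 < m then 3 * k + 1 else 3 * k + 2)"
    by (simp_all add: perm_def)
qed

lemma perm_perm [simp]: "perm m (perm m i) = i"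
proof (cases rule: mod3_cases[of i])
  case (1 k)
  then show ?thesis by (simp only: perm_simps)
next
  case (2 k)
  show ?thesis unfolding 2 by (cases "3 * k + 3 < m") (simp_all only: perm_simps if_True if_False)
next
  case (3 k)
  show ?thesis unfolding 3 by (cases "3 * k + 3 < m") (simp_all only: perm_simps if_True if_False)
qed

text \<open>The pruning on rim edges alone: \<open>B\<close> is matched before step
  \<open>i\<close>. Of the two sets tested in a step, one is \<open>B\<close> and the other its
  partner.\<close>

fun csel :: "nat \<Rightarrow> nat \<Rightarrow> nat set \<Rightarrow> bool" where
  "csel m 0 B = False"
| "csel m (Suc i) B = (csel m i B \<or> (nbrs m B (perm m i) \<and>
     \<not> csel m i (insert (perm m i) B) \<and> \<not> csel m i (B - {perm m i})))"

lemma csel_mono: "i \<le> i' \<Longrightarrow> csel m i B \<Longrightarrow> csel m i' B"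
proof (induction i')
  case (Suc i')
  then show ?case by (cases "i = Suc i'") auto
qed simp

text \<open>The word of \<open>B\<close> is indexed such that letter \<open>p\<close> is the edge \<open>p - 1\<close>, and letter \<open>0\<close> repeats
  letter \<open>m\<close>.\<close>

definition word :: "nat \<Rightarrow> nat set \<Rightarrow> nat \<Rightarrow> bool" where
  "word m B p = (if p = 0 then m - 1 \<in> B else p - 1 \<in> B)"

text \<open>The bit of memory of the scan. For a word that is not selected earlier and has letter
  \<open>3k\<close>, \<open>QA w k\<close> says that toggling letter \<open>3k + 1\<close> does not
  lead to a set selected earlier. Likewise \<open>QB w k\<close> says that toggling letter
  \<open>3k + 2\<close> does not lead to a set selected in the step of letter
  \<open>3k + 1\<close>.\<close>

primrec QA :: "(nat \<Rightarrow> bool) \<Rightarrow> nat \<Rightarrow> bool" where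
  "QA w 0 = True"
| "QA w (Suc k) = (\<not> w (3 * k + 2) \<and> \<not> (w (3 * k + 1) \<and> \<not> (w (3 * k) \<and> QA w k)))"

definition QB :: "(nat \<Rightarrow> bool) \<Rightarrow> nat \<Rightarrow> bool" where
  "QB w k = (\<not> (w (3 * k) \<and> QA w k))"

lemma QA_Suc: "QA w (Suc k) \<longleftrightarrow> \<not> w (3 * k + 2) \<and> \<not> (w (3 * k + 1) \<and> QB w k)"
  by (simp add: QB_def)

text \<open>The faces selected when the letters \<open>3k + 1\<close>, \<open>3k + 2\<close>, \<open>3k + 3\<close> are processed.\<close>

definition MA :: "(nat \<Rightarrow> bool) \<Rightarrow> nat \<Rightarrow> bool" where
  "MA w k = (w (3 * k) \<and> w (3 * k + 2) \<and> QA w k)"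

text \<open>With letter \<open>3k + 4\<close> present, inserting letter \<open>3k + 2\<close> would
  give a set selected by \<open>MC\<close>. In a block ending with letter \<open>m\<close> there is
  no such step before it.\<close>

definition MB :: "nat \<Rightarrow> (nat \<Rightarrow> bool) \<Rightarrow> nat \<Rightarrow> bool" where
  "MB m w k = (w (3 * k + 1) \<and> w (3 * k + 3) \<and> (3 * k + 3 \<noteq> m \<longrightarrow> \<not> w (3 * k + 4)) \<and> QB w k)"

text \<open>There is no condition on the partner: letter \<open>3k + 3\<close> is treated directly
  after letter \<open>3k + 1\<close>, and no earlier test reads it.\<close>

definition MC :: "(nat \<Rightarrow> bool) \<Rightarrow> nat \<Rightarrow> bool" where
  "MC w k = (w (3 * k + 2) \<and> w (3 * k + 4))"

text \<open>In a swapped block the letters come in the order \<open>3k + 1\<close>,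
  \<open>3k + 3\<close>, \<open>3k + 2\<close>. If the block is not swapped, its second step treats
  letter \<open>3k + 2\<close> and is therefore \<open>MB\<close>.\<close>

definition Mstep :: "nat \<Rightarrow> nat \<Rightarrow> (nat \<Rightarrow> bool) \<Rightarrow> bool" where
  "Mstep m i w = (if i mod 3 = 0 then MA w (i div 3)
     else if i mod 3 = 1 \<and> i + 2 < m then MC w (i div 3) else MB m w (i div 3))"

lemma QA_cong: "(\<And>i. i < 3 * k \<Longrightarrow> w i = w' i) \<Longrightarrow> QA w k = QA w' k"
  by (induction k) auto

lemma QA_upd [simp]: "3 * k \<le> p \<Longrightarrow> QA (w(p := v)) k = QA w k"
  by (rule QA_cong) auto

lemma Mstep_simps:
  "Mstep m (3 * k) w = MA w k"
  "Mstep m (3 * k + 1) w = (if 3 * k + 3 < m then MC w k else MB m w k)"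
  "Mstep m (3 * k + 2) w = MB m w k"
proof -
  have "(3 * k + 1) mod 3 = 1" "(3 * k + 1) div 3 = k" "(3 * k + 2) mod 3 = 2" "(3 * k + 2) div 3 = k" by presburger+
  then show "Mstep m (3 * k) w = MA w k"
    "Mstep m (3 * k + 1) w = (if 3 * k + 3 < m then MC w k else MB m w k)"
    "Mstep m (3 * k + 2) w = MB m w k"
    by (simp_all add: Mstep_def)
qed

text \<open>The tests of the blocks before block \<open>k\<close> read no letter beyond
  \<open>3k + 1\<close>.\<close>

lemma Mstep_upd:
  assumes "i < 3 * k" "3 * k + 1 < m" "3 * k + 1 < p"
  shows "Mstep m i (w(p := v)) = Mstep m i w"
proof (cases rule: mod3_cases[of i])
  case (1 l)
  then have "3 * l + 2 < p" using assms 1 by linarith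
  then show ?thesis using 1 by (simp add: Mstep_simps MA_def)
next
  case (2 l)
  then have "3 * l + 3 < m" "3 * l + 4 < p" using assms 2 by presburger+
  then show ?thesis unfolding 2 Mstep_simps by (simp add: MC_def)
next
  case (3 l)
  then have "3 * l + 4 < p" using assms 3 by presburger
  then show ?thesis unfolding 3 Mstep_simps by (simp add: MB_def QB_def)
qed

text \<open>A toggle affects only tests of the current block or of the preceding one. For a word
  selected by none of the earlier tests, the requirement that both toggled words escape them as well
  reduces to \<open>QA\<close>, to \<open>QB\<close>, or to nothing, plus the condition on letter
  \<open>3k + 4\<close> in \<open>MB\<close>.\<close>

lemma Mstep_iff:
  assumes i: "i + 1 < m" and p: "p = Suc (perm m i)"
    and no: "\<And>i'. i' < i \<Longrightarrow> \<not> Mstep m i' w"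
  shows "(w (p - 1) \<and> w (p + 1) \<and> (\<forall>i'<i. \<not> Mstep m i' (w(p := True)) \<and> \<not> Mstep m i' (w(p := False)))) \<longleftrightarrow> Mstep m i w"
proof (cases rule: mod3_cases[of i])
  case (1 k)
  then have p': "p = 3 * k + 1" using p by (simp add: perm_simps)
  show ?thesis
  proof (cases k)
    case 0
    then show ?thesis using 1 p' by (simp add: Mstep_def MA_def)
  next
    case (Suc l)
    have old: "Mstep m i' (w(p := v)) = Mstep m i' w" if "i' < 3 * l" for i' v
      by (rule Mstep_upd[of i' l]) (use that p' Suc i 1 in auto)
    have m: "3 * l + 3 < m" "3 * l + 3 \<noteq> m" using i 1 Suc by auto
    have lt: "i' < i \<longleftrightarrow> i' < 3 * l \<or> i' = 3 * l \<or> i' = 3 * l + 1 \<or> i' = 3 * l + 2" for i'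
      using 1 Suc by auto
    have nA: "Mstep m (3 * l) (w(p := v)) = Mstep m (3 * l) w" for v
      using p' Suc by (simp add: Mstep_simps MA_def)
    \<comment> \<open>In the preceding block, inserting letter \<open>3l + 4\<close> can trigger
      \<open>MC\<close> and removing it can trigger \<open>MB\<close>. Excluding both is what
      \<open>QA w (Suc l)\<close> records.\<close>
    have nC: "Mstep m (3 * l + 1) (w(p := v)) \<longleftrightarrow> w (3 * l + 2) \<and> v" for v
      unfolding Mstep_simps using m p' Suc by (simp add: MC_def)
    have nB: "Mstep m (3 * l + 2) (w(p := v)) \<longleftrightarrow> w (3 * l + 1) \<and> w (3 * l + 3) \<and> \<not> v \<and> QB w l" for v
      unfolding Mstep_simps using m p' Suc by (simp add: MB_def QB_def)
    have no': "\<not> Mstep m i' w" if "i' < 3 * l" for i' using no[of i'] that lt by simp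
    have noA: "\<not> Mstep m (3 * l) w" using no lt by simp
    have "(\<forall>i'<i. P i') \<longleftrightarrow> (\<forall>i'<3 * l. P i') \<and> P (3 * l) \<and> P (3 * l + 1) \<and> P (3 * l + 2)" for P
      unfolding lt by (metis (full_types))
    note e = this[of "\<lambda>i'. \<not> Mstep m i' (w(p := True)) \<and> \<not> Mstep m i' (w(p := False))"]
    have e: "(\<forall>i'<i. \<not> Mstep m i' (w(p := True)) \<and> \<not> Mstep m i' (w(p := False))) \<longleftrightarrow>
        \<not> w (3 * l + 2) \<and> \<not> (w (3 * l + 1) \<and> w (3 * l + 3) \<and> QB w l)"
      unfolding e nA nC nB using no' noA by (simp add: old)
    have idx: "p - 1 = 3 * l + 3" "p + 1 = 3 * l + 5" using p' Suc by simp_all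
    have "MA w k \<longleftrightarrow> w (3 * l + 3) \<and> w (3 * l + 5) \<and> \<not> w (3 * l + 2) \<and> \<not> (w (3 * l + 1) \<and> QB w l)"
      using Suc by (simp add: MA_def QB_def ac_simps)
    then show ?thesis unfolding e unfolding 1 Mstep_simps idx by blast
  qed
next
  case (2 k)
  have old: "Mstep m i' (w(p := v)) = Mstep m i' w" if "i' < 3 * k" "3 * k + 1 < p" for i' v
    by (rule Mstep_upd[of i' k]) (use that i 2 in auto)
  have lt: "i' < i \<longleftrightarrow> i' < 3 * k \<or> i' = 3 * k" for i' using 2 by auto
  show ?thesis
  proof (cases "3 * k + 3 < m")
    case True
    then have p': "p = 3 * k + 3" using p 2 by (simp add: perm_simps del: One_nat_def)
    have nA: "Mstep m (3 * k) (w(p := v)) = Mstep m (3 * k) w" for v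
      using p' by (simp add: Mstep_simps MA_def)
    have e: "\<forall>i'<i. \<not> Mstep m i' (w(p := True)) \<and> \<not> Mstep m i' (w(p := False))"
    proof (intro allI impI)
      fix i' assume i': "i' < i"
      then have "Mstep m i' (w(p := v)) = Mstep m i' w" for v
        using lt old[of i'] nA p' by auto
      then show "\<not> Mstep m i' (w(p := True)) \<and> \<not> Mstep m i' (w(p := False))" using no[OF i'] by simp
    qed
    have idx: "p - 1 = 3 * k + 2" "p + 1 = 3 * k + 4" using p' by auto
    show ?thesis unfolding 2 Mstep_simps idx using e True 2 by (simp add: MC_def)
  next
    case False
    then have m: "m = 3 * k + 3" using i 2 by simp
    then have p': "p = 3 * k + 2" using p 2 by (simp add: perm_simps del: One_nat_def)
    have nA: "Mstep m (3 * k) (w(p := v)) \<longleftrightarrow> w (3 * k) \<and> v \<and> QA w k" for v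
      using p' by (simp add: Mstep_simps MA_def)
    have no': "\<not> Mstep m i' w" if "i' < 3 * k" for i' using no[of i'] that lt by simp
    have "(\<forall>i'<i. P i') \<longleftrightarrow> (\<forall>i'<3 * k. P i') \<and> P (3 * k)" for P
      unfolding lt by (metis (full_types))
    note e = this[of "\<lambda>i'. \<not> Mstep m i' (w(p := True)) \<and> \<not> Mstep m i' (w(p := False))"]
    have e: "(\<forall>i'<i. \<not> Mstep m i' (w(p := True)) \<and> \<not> Mstep m i' (w(p := False))) \<longleftrightarrow> QB w k"
      unfolding e nA using no' old p' by (simp add: QB_def del: fun_upd_apply)
    have idx: "p - 1 = 3 * k + 1" "p + 1 = 3 * k + 3" using p' by auto
    show ?thesis unfolding e unfolding 2 Mstep_simps idx using m by (simp add: MB_def)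
  qed
next
  case (3 k)
  then have m: "3 * k + 3 < m" "3 * k + 3 \<noteq> m" using i by auto
  then have p': "p = 3 * k + 2" using p 3 by (simp add: perm_simps del: One_nat_def add_2_eq_Suc')
  have old: "Mstep m i' (w(p := v)) = Mstep m i' w" if "i' < 3 * k" for i' v
    by (rule Mstep_upd[of i' k]) (use that i 3 p' in auto)
  have lt: "i' < i \<longleftrightarrow> i' < 3 * k \<or> i' = 3 * k \<or> i' = 3 * k + 1" for i' using 3 by auto
  have nA: "Mstep m (3 * k) (w(p := v)) \<longleftrightarrow> w (3 * k) \<and> v \<and> QA w k" for v
    using p' by (simp add: Mstep_simps MA_def)
  have nC: "Mstep m (3 * k + 1) (w(p := v)) \<longleftrightarrow> v \<and> w (3 * k + 4)" for v
    unfolding Mstep_simps using m p' by (simp add: MC_def)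
  have no': "\<not> Mstep m i' w" if "i' < 3 * k" for i' using no[of i'] that lt by simp
  have "(\<forall>i'<i. P i') \<longleftrightarrow> (\<forall>i'<3 * k. P i') \<and> P (3 * k) \<and> P (3 * k + 1)" for P
    unfolding lt by (metis (full_types))
  note e = this[of "\<lambda>i'. \<not> Mstep m i' (w(p := True)) \<and> \<not> Mstep m i' (w(p := False))"]
  have e: "(\<forall>i'<i. \<not> Mstep m i' (w(p := True)) \<and> \<not> Mstep m i' (w(p := False))) \<longleftrightarrow> QB w k \<and> \<not> w (3 * k + 4)"
    unfolding e nA nC using no' by (simp add: old QB_def)
  have idx: "p - 1 = 3 * k + 1" "p + 1 = 3 * k + 3" using p' by auto
  show ?thesis unfolding e unfolding 3 Mstep_simps idx using m by (auto simp: MB_def)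
qed

lemma word_insert: "Suc j < m \<Longrightarrow> word m (insert j B) = (word m B)(Suc j := True)"
  by (auto simp: word_def fun_eq_iff)

lemma word_remove: "Suc j < m \<Longrightarrow> word m (B - {j}) = (word m B)(Suc j := False)"
  by (auto simp: word_def fun_eq_iff)

text \<open>Only the steps before the last one are described: edge \<open>m - 1\<close> is both
  letter \<open>m\<close> and letter \<open>0\<close>, so toggling it would change two
  letters.\<close>

lemma csel_iff: "i < m \<Longrightarrow> csel m i B \<longleftrightarrow> (\<exists>i'<i. Mstep m i' (word m B))"
proof (induction i arbitrary: B)
  case (Suc i)
  define j where "j = perm m i"
  have jm: "Suc j < m" 
  proof (cases rule: mod3_cases[of i])
    case (3 k)
    then show ?thesis using Suc.prems by (simp add: j_def perm_simps del: add_2_eq_Suc')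
  qed (use Suc.prems in \<open>auto simp: j_def perm_simps simp del: One_nat_def\<close>)
  have IH: "csel m i B' \<longleftrightarrow> (\<exists>i'<i. Mstep m i' (word m B'))" for B' using Suc by simp
  have nb: "nbrs m B j \<longleftrightarrow> word m B (Suc j - 1) \<and> word m B (Suc j + 1)"
    using jm by (auto simp: nbrs_def word_def)
  show ?case
  proof (cases "\<exists>i'<i. Mstep m i' (word m B)")
    case True
    then show ?thesis using IH by (auto simp: less_Suc_eq)
  next
    case False
    have "nbrs m B j \<and> \<not> csel m i (insert j B) \<and> \<not> csel m i (B - {j}) \<longleftrightarrow> Mstep m i (word m B)"
      unfolding IH nb using jm Mstep_iff[of i m "Suc j" "word m B"] False Suc.prems
      by (auto simp: word_insert word_remove j_def)
    then show ?thesis using False IH by (auto simp: j_def less_Suc_eq)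
  qed
qed simp

text \<open>The bounds on \<open>k\<close> express that the step lies before step
  \<open>m - 1\<close>. For \<open>3 * k + 3 = m\<close> the test \<open>MB\<close> belongs to step
  \<open>3k + 1\<close>, which is \<open>m - 2\<close>, since that block is not swapped.\<close>

definition stable :: "nat \<Rightarrow> (nat \<Rightarrow> bool) \<Rightarrow> bool" where
  "stable m w \<longleftrightarrow> w m = w 0 \<and> (\<forall>k. 3 * k + 1 < m \<longrightarrow> \<not> MA w k) \<and>
     (\<forall>k. 3 * k + 2 < m \<longrightarrow> \<not> MB m w k) \<and> (\<forall>k. 3 * k + 3 < m \<longrightarrow> \<not> MC w k)"

lemma stable_word:
  assumes "\<not> csel m (m - 1) B" "1 \<le> m"
  shows "stable m (word m B)"
proof -
  have no: "\<not> Mstep m i (word m B)" if "i + 1 < m" for i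
    using csel_iff[of "m - 1" m B] assms that by auto
  have "\<not> MA (word m B) k" if "3 * k + 1 < m" for k
    using no[of "3 * k"] that by (simp add: Mstep_simps)
  moreover have "\<not> MC (word m B) k" if "3 * k + 3 < m" for k
    using no[of "3 * k + 1"] that unfolding Mstep_simps by simp
  moreover have "\<not> MB m (word m B) k" if "3 * k + 2 < m" for k
  proof (cases "3 * k + 3 < m")
    case True
    then show ?thesis using no[of "3 * k + 2"] unfolding Mstep_simps by simp
  next
    case False
    then show ?thesis using no[of "3 * k + 1"] that unfolding Mstep_simps by simp
  qed
  moreover have "word m B m = word m B 0" using assms(2) by (auto simp: word_def)
  ultimately show ?thesis by (simp add: stable_def)
qed

section \<open>Comparison of two stable words with the same covered vertices\<close>

locale stable_pair =
  fixes m :: nat and w w' :: "nat \<Rightarrow> bool"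
  assumes m: "3 \<le> m" and st: "stable m w" "stable m w'"
    and gaps: "\<And>i. i < m \<Longrightarrow> w i \<or> w (Suc i) \<longleftrightarrow> w' i \<or> w' (Suc i)"
begin

lemma stA: "3 * k + 1 < m \<Longrightarrow> w (3 * k) \<Longrightarrow> QA w k \<Longrightarrow> \<not> w (3 * k + 2)"
  and stB: "3 * k + 2 < m \<Longrightarrow> w (3 * k + 1) \<Longrightarrow> w (3 * k + 3) \<Longrightarrow> QB w k \<Longrightarrow> 3 * k + 3 \<noteq> m \<and> w (3 * k + 4)"
  and stC: "3 * k + 3 < m \<Longrightarrow> w (3 * k + 2) \<Longrightarrow> \<not> w (3 * k + 4)"
  and wm: "w m = w 0"
  using st(1) unfolding stable_def MA_def MB_def MC_def by auto

lemma symmetric: "stable_pair m w' w"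
  using m st gaps by (simp add: stable_pair_def)

text \<open>Without letter \<open>3k + 3\<close>, the word \<open>w\<close> needs both letters
  \<open>3k + 2\<close> and \<open>3k + 4\<close> to cover the two ends of that edge, and
  \<open>MC\<close> forbids this.\<close>

lemma agree_0:
  assumes k: "3 * k + 3 < m" and eq: "w (3 * k + 2) = w' (3 * k + 2)" and w': "w' (3 * k + 3)"
  shows "w (3 * k + 3)"
proof (rule ccontr)
  interpret s: stable_pair m w' w by (rule symmetric)
  assume w: "\<not> w (3 * k + 3)"
  have "w (3 * k + 2)" using gaps[of "3 * k + 2"] k w w' by (simp add: numeral_3_eq_3)
  then have "\<not> w (3 * k + 4)" using stC k by simp
  then show False using gaps[of "3 * k + 3"] k w w' by (simp add: eval_nat_numeral)
qed

text \<open>Without letter \<open>3k + 1\<close>, the word \<open>w\<close> needs letters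
  \<open>3k\<close> and \<open>3k + 2\<close>, which \<open>MA\<close> forbids once
  \<open>QA w k\<close> is known. For the latter, \<open>MC\<close> for \<open>w'\<close> excludes
  letter \<open>3k - 1\<close>, and \<open>MB\<close> for \<open>w\<close> excludes the other
  obstruction.\<close>

lemma agree_1:
  assumes k: "3 * k + 1 < m" and eq: "w (3 * k) = w' (3 * k)" "QA w k = QA w' k"
    and eq2: "\<And>l. k = Suc l \<Longrightarrow> w (3 * l + 2) = w' (3 * l + 2)" and w': "w' (3 * k + 1)"
  shows "w (3 * k + 1)"
proof (rule ccontr)
  interpret s: stable_pair m w' w by (rule symmetric)
  assume w: "\<not> w (3 * k + 1)"
  have w0: "w (3 * k)" using gaps[of "3 * k"] k w w' eq(1) by simp
  have "QA w k"
  proof (cases k)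
    case (Suc l)
    have "\<not> w' (3 * l + 2)" using s.stC[of l] k w' Suc by (auto simp: eval_nat_numeral)
    then have "\<not> w (3 * l + 2)" using eq2[OF Suc] by simp
    moreover have "\<not> (w (3 * l + 1) \<and> QB w l)" using stB[of l] k w w0 Suc by (auto simp: eval_nat_numeral)
    ultimately show ?thesis unfolding Suc QA_Suc by blast
  qed simp
  then have "\<not> w (3 * k + 2)" using stA k w0 by blast
  then show False using gaps[of "3 * k + 1"] k w w' by simp
qed

text \<open>Without letter \<open>3k + 2\<close>, the word \<open>w\<close> needs letters
  \<open>3k + 1\<close> and \<open>3k + 3\<close>. In \<open>w'\<close>, letter
  \<open>3k + 2\<close> excludes letter \<open>3k + 4\<close> by \<open>MC\<close> and then letter
  \<open>3k + 3\<close> by \<open>MB\<close>, so \<open>w'\<close> misses vertex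
  \<open>3k + 3\<close>, which \<open>w\<close> covers. If \<open>3k + 3 = m\<close>, then
  \<open>MB\<close> for \<open>w\<close> is violated at once.\<close>

lemma agree_2:
  assumes k: "3 * k + 2 < m" and eq: "w (3 * k + 1) = w' (3 * k + 1)" "QB w k = QB w' k" and w': "w' (3 * k + 2)"
  shows "w (3 * k + 2)"
proof (rule ccontr)
  interpret s: stable_pair m w' w by (rule symmetric)
  assume w: "\<not> w (3 * k + 2)"
  have w1: "w (3 * k + 1)" using gaps[of "3 * k + 1"] k w w' by simp
  have Q: "QB w' k" unfolding QB_def using s.stA[of k] k w' by auto
  have w3: "w (3 * k + 3)" using gaps[of "3 * k + 2"] k w w' by (simp add: numeral_3_eq_3)
  show False
  proof (cases "3 * k + 3 = m")
    case True
    then show False using stB[OF k w1 w3] Q eq by simp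
  next
    case False
    then have k3: "3 * k + 3 < m" using k by simp
    have "\<not> w' (3 * k + 4)" using s.stC[OF k3 w'] .
    moreover from this have "\<not> w' (3 * k + 3)" using s.stB[OF k] w1 eq Q by blast
    ultimately show False using gaps[of "3 * k + 3"] k3 w3 by (simp add: eval_nat_numeral)
  qed
qed

text \<open>Letter \<open>0\<close> is left out: the words may differ there and still agree
  afterwards, once the bit \<open>QB\<close> is the same for both.\<close>

definition sync :: "nat \<Rightarrow> bool" where
  "sync k \<longleftrightarrow> (\<forall>i. 1 \<le> i \<and> i \<le> 3 * k + 1 \<and> i < m \<longrightarrow> w i = w' i) \<and>
     (3 * k + 2 < m \<longrightarrow> QB w k = QB w' k)"

lemma sync_Suc:
  assumes "sync k" "3 * k + 2 < m"
  shows "sync (Suc k)"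
proof -
  interpret s: stable_pair m w' w by (rule symmetric)
  have old: "w i = w' i" if "1 \<le> i" "i \<le> 3 * k + 1" for i
    using assms that by (simp add: sync_def)
  have Q: "QB w k = QB w' k" using assms by (simp add: sync_def)
  have 2: "w (3 * k + 2) = w' (3 * k + 2)"
    using agree_2[of k] s.agree_2[of k] old Q assms(2) by auto
  have 3: "w (3 * k + 3) = w' (3 * k + 3)" if "3 * k + 3 < m"
    using agree_0[OF that 2] s.agree_0[OF that 2[symmetric]] by auto
  have QA: "QA w (Suc k) = QA w' (Suc k)" unfolding QA_Suc using 2 Q old by simp
  have idx: "3 * Suc k = 3 * k + 3" "3 * k + 3 + 1 = 3 * k + 4" by simp_all
  have 4: "w (3 * k + 4) = w' (3 * k + 4)" if k4: "3 * k + 4 < m"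
  proof
    have eq3: "w (3 * k + 3) = w' (3 * k + 3)" using 3 k4 by simp
    show "w (3 * k + 4)" if "w' (3 * k + 4)"
      by (rule agree_1[of "Suc k", unfolded idx, OF k4 eq3 QA _ that]) (use 2 in simp)
    show "w' (3 * k + 4)" if "w (3 * k + 4)"
      by (rule s.agree_1[of "Suc k", unfolded idx, OF k4 eq3[symmetric] QA[symmetric] _ that]) (use 2 in simp)
  qed
  have "w i = w' i" if "1 \<le> i" "i \<le> 3 * Suc k + 1" "i < m" for i
  proof -
    have "i \<le> 3 * k + 1 \<or> i = 3 * k + 2 \<or> i = 3 * k + 3 \<or> i = 3 * k + 4" using that by auto
    then show ?thesis using old 2 3 4 that by auto
  qed
  moreover have "QB w (Suc k) = QB w' (Suc k)" if "3 * k + 3 < m"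
    using 3[OF that] QA unfolding QB_def by (simp add: eval_nat_numeral)
  ultimately show ?thesis unfolding sync_def by auto
qed

lemma sync_agree:
  assumes "sync k" "1 \<le> i" "i < m"
  shows "w i = w' i"
proof -
  \<comment> \<open>Advancing block by block either goes on or stops at a block that already reaches
    the end; \<open>m\<close> blocks are certainly enough.\<close>
  have "sync (k + n) \<or> (\<exists>l. m \<le> 3 * l + 2 \<and> sync l)" for n
  proof (induction n)
    case (Suc n)
    then show ?case
    proof
      assume "sync (k + n)"
      then show ?thesis using sync_Suc[of "k + n"] by (cases "3 * (k + n) + 2 < m") (auto simp: not_less)
    qed simp
  qed (use assms in simp)
  from this[of m] obtain l where "m \<le> 3 * l + 2" "sync l"
  proof
    assume "sync (k + m)"
    moreover have "m \<le> 3 * (k + m) + 2" by simp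
    ultimately show thesis using that by blast
  qed (use that in blast)
  then show ?thesis using assms(2,3) unfolding sync_def by auto
qed

lemma agree_if_eq_0: "w 0 = w' 0 \<Longrightarrow> i < m \<Longrightarrow> w i = w' i"
proof -
  interpret s: stable_pair m w' w by (rule symmetric)
  assume 0: "w 0 = w' 0" and i: "i < m"
  have "w 1 = w' 1" using agree_1[of 0] s.agree_1[of 0] 0 m by auto
  then have "sync 0" using 0 by (auto simp: sync_def QB_def le_Suc_eq)
  then show "w i = w' i" using sync_agree[of 0 i] 0 i by (cases "i = 0") auto
qed

text \<open>If the words start differently, then they are both of the form \<open>101101\<dots>\<close> from letter \<open>1\<close> on until
  their first gap, after which they agree again.\<close>

definition desync :: "nat \<Rightarrow> bool" where
  "desync k \<longleftrightarrow> 3 * k + 2 < m \<and> (\<forall>i. 1 \<le> i \<and> i \<le> 3 * k + 1 \<longrightarrow> w i = w' i) \<and>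
     w (3 * k) \<and> w (3 * k + 1) \<and> \<not> w (3 * k + 2) \<and> QA w k \<and> QB w' k"

lemma desync_0:
  assumes "w 0" "\<not> w' 0"
  shows "desync 0"
proof -
  have "\<not> w 2" using stA[of 0] assms m by (simp add: eval_nat_numeral)
  moreover have "w' 1" using gaps[of 0] assms m by simp
  moreover from calculation have "w 1" using gaps[of 1] m by (simp add: eval_nat_numeral)
  ultimately show ?thesis using assms m by (auto simp: desync_def QB_def le_Suc_eq eval_nat_numeral)
qed

text \<open>The bit \<open>QB\<close> is false for \<open>w\<close> and true for \<open>w'\<close>,
  while the letters agree. If both lack letter \<open>3k + 3\<close>, the bit becomes true for both.
  Otherwise \<open>MB\<close> forces letter \<open>3k + 4\<close> in \<open>w'\<close>,
  \<open>MA\<close> excludes letter \<open>3k + 5\<close> from \<open>w\<close>, and the pattern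
  repeats one block later.\<close>

lemma desync_step:
  assumes d: "desync k" and 0: "w 0" "\<not> w' 0" and ne: "m \<noteq> 3 * k + 3"
  shows "sync (Suc k) \<or> desync (Suc k)"
proof -
  interpret s: stable_pair m w' w by (rule symmetric)
  have last: "w m" "\<not> w' m" "w' (m - 1)" using wm s.wm 0 gaps[of "m - 1"] m by auto
  have k: "3 * k + 3 < m" "3 * k + 2 < m" and old: "\<And>i. 1 \<le> i \<Longrightarrow> i \<le> 3 * k + 1 \<Longrightarrow> w i = w' i"
    and w: "w (3 * k)" "w (3 * k + 1)" "\<not> w (3 * k + 2)" "QA w k" "QB w' k"
    using d ne by (auto simp: desync_def)
  have w'1: "w' (3 * k + 1)" using old[of "3 * k + 1"] w by simp
  have w'2: "\<not> w' (3 * k + 2)"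
  proof
    assume a: "w' (3 * k + 2)"
    then have "\<not> w' (3 * k + 4)" using s.stC k by simp
    then have "\<not> w' (3 * k + 3)" using s.stB[OF k(2) w'1] w by blast
    with \<open>\<not> w' (3 * k + 4)\<close> have "\<not> w (3 * k + 3)" using gaps[of "3 * k + 3"] k by (simp add: eval_nat_numeral)
    then show False using gaps[of "3 * k + 2"] k a w by (simp add: eval_nat_numeral)
  qed
  have eq3: "w (3 * k + 3) = w' (3 * k + 3)"
    using gaps[of "3 * k + 2"] k w w'2 by (simp add: eval_nat_numeral)
  have old': "w i = w' i" if "1 \<le> i" "i \<le> 3 * Suc k + 1" "w (3 * k + 4) = w' (3 * k + 4)" for i
  proof -
    have "i \<le> 3 * k + 1 \<or> i = 3 * k + 2 \<or> i = 3 * k + 3 \<or> i = 3 * k + 4" using that by auto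
    then show ?thesis using old eq3 w w'2 that by auto
  qed
  have nQB: "\<not> QB w k" using w by (simp add: QB_def)
  show ?thesis
  proof (cases "w (3 * k + 3)")
    case False
    have "3 * k + 3 \<noteq> m - 1" using last False eq3 by metis
    then have k4: "3 * k + 4 < m" using k by simp
    have "w (3 * k + 4) = w' (3 * k + 4)"
      using gaps[of "3 * k + 3"] k False eq3 by (simp add: eval_nat_numeral)
    moreover have "QB w (Suc k)" "QB w' (Suc k)" using False eq3 by (simp_all add: QB_def eval_nat_numeral)
    ultimately show ?thesis using old' by (simp add: sync_def)
  next
    case True
    then have w'4: "w' (3 * k + 4)" using s.stB[OF k(2) w'1 _ w(5)] eq3 by simp
    then have "3 * k + 4 \<noteq> m" using last by metis
    then have k4: "3 * k + 4 < m" using k by simp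
    have QA: "QA w (Suc k)" "\<not> QA w' (Suc k)" unfolding QA_Suc using w nQB w'1 by simp_all
    have "\<not> w (3 * k + 5)" using stA[of "Suc k"] k4 True QA by (simp add: eval_nat_numeral)
    moreover from this have "3 * k + 5 \<noteq> m" using last by metis
    moreover have "w (3 * k + 4)" using gaps[of "3 * k + 4"] k4 w'4 \<open>\<not> w (3 * k + 5)\<close> by (simp add: eval_nat_numeral)
    moreover have "QB w' (Suc k)" using QA by (simp add: QB_def)
    ultimately have "desync (Suc k)"
      unfolding desync_def using k4 True w'4 QA old' by (auto simp: eval_nat_numeral)
    then show ?thesis ..
  qed
qed

text \<open>Either a gap synchronises the words, which then differ only in edge
  \<open>m - 1\<close>, or the pattern persists up to the end. The latter needs
  \<open>m = 3 * l + 3\<close>, and then \<open>w\<close> and \<open>w'\<close> contain different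
  ones of the last two edges.\<close>

lemma agree_or_swap:
  assumes 0: "w 0" "\<not> w' 0"
  shows "w 1 \<and> w m \<and> \<not> w' m \<and> w' (m - 1) \<and>
    ((\<forall>i. 1 \<le> i \<and> i < m \<longrightarrow> w i = w' i) \<or>
     (\<not> w (m - 1) \<and> (\<forall>i. 1 \<le> i \<and> i < m - 1 \<longrightarrow> w i = w' i)))"
proof -
  interpret s: stable_pair m w' w by (rule symmetric)
  have last: "w m" "\<not> w' m" "w' (m - 1)" using wm s.wm 0 gaps[of "m - 1"] m by auto
  have "(\<exists>l. sync l) \<or> (\<exists>l. desync l \<and> m = 3 * l + 3)" if "desync k" for k
    using that
  proof (induction "m - k" arbitrary: k rule: less_induct)
    case less
    show ?case
    proof (cases "m = 3 * k + 3")
      case False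
      from desync_step[OF less.prems 0 this] show ?thesis
      proof
        assume d: "desync (Suc k)"
        then have "3 * Suc k + 2 < m" unfolding desync_def by blast
        then have "m - Suc k < m - k" by simp
        then show ?thesis using less.hyps d by blast
      qed blast
    qed (use less.prems in blast)
  qed
  from this[OF desync_0[OF 0]] show ?thesis
  proof
    assume "\<exists>l. sync l"
    then have "\<forall>i. 1 \<le> i \<and> i < m \<longrightarrow> w i = w' i" using sync_agree by blast
    moreover have "w 1" using desync_0[OF 0] by (simp add: desync_def)
    ultimately show ?thesis using last by blast
  next
    assume "\<exists>l. desync l \<and> m = 3 * l + 3"
    then obtain l where "desync l" and ml: "m = 3 * l + 3" by blast
    then have "\<forall>i. 1 \<le> i \<and> i \<le> 3 * l + 1 \<longrightarrow> w i = w' i" "\<not> w (3 * l + 2)"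
      unfolding desync_def by blast+
    moreover have "m - 1 = 3 * l + 2" using ml by simp
    moreover have "w 1" using desync_0[OF 0] by (simp add: desync_def)
    ultimately show ?thesis using last by auto
  qed
qed

end

section \<open>Sizes of critical sets of rim edges\<close>

definition crit :: "nat \<Rightarrow> nat set \<Rightarrow> bool" where
  "crit m B \<longleftrightarrow> B \<subseteq> {..<m} \<and> \<not> csel m m B"

lemma covered_iff_word:
  assumes "B \<subseteq> {..<m}" "i < m"
  shows "i \<in> covered m B \<longleftrightarrow> word m B i \<or> word m B (Suc i)"
proof -
  have pred: "i = Suc j mod m \<longleftrightarrow> (if i = 0 then j = m - 1 else j = i - 1)" if "j < m" for j
    using that assms(2) by (cases "Suc j = m") auto
  have "(\<exists>j\<in>B. i = Suc j mod m) \<longleftrightarrow> word m B i"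
  proof -
    have "(\<exists>j\<in>B. i = Suc j mod m) \<longleftrightarrow> (\<exists>j\<in>B. if i = 0 then j = m - 1 else j = i - 1)"
    proof (intro bex_cong refl)
      fix j assume "j \<in> B"
      then show "i = Suc j mod m \<longleftrightarrow> (if i = 0 then j = m - 1 else j = i - 1)" using assms(1) by (intro pred) auto
    qed
    then show ?thesis by (simp add: word_def)
  qed
  moreover have "i \<in> covered m B \<longleftrightarrow> i \<in> B \<or> (\<exists>j\<in>B. i = Suc j mod m)"
    unfolding covered_def by blast
  moreover have "word m B (Suc i) \<longleftrightarrow> i \<in> B" by (simp add: word_def)
  ultimately show ?thesis by blast
qed

text \<open>Here the last step of the pruning enters. If the words agree apart from edge
  \<open>m - 1\<close>, both neighbours of that edge are present and step \<open>m - 1\<close> would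
  match \<open>B\<close> with \<open>B'\<close>. In the other case one edge is exchanged for
  another.\<close>

lemma crit_card_aux:
  assumes m: "3 \<le> m" and crit: "crit m B" "crit m B'" and cov: "covered m B = covered m B'"
    and last: "m - 1 \<in> B" "m - 1 \<notin> B'"
  shows "card B = card B'"
proof -
  have sub: "B \<subseteq> {..<m}" "B' \<subseteq> {..<m}" using crit by (auto simp: crit_def)
  have sel: "\<not> csel m (m - 1) B" "\<not> csel m (m - 1) B'"
    using crit csel_mono[of "m - 1" m] by (auto simp: crit_def)
  interpret stable_pair m "word m B" "word m B'"
  proof
    show "stable m (word m B)" "stable m (word m B')" using stable_word sel m by auto
    show "word m B i \<or> word m B (Suc i) \<longleftrightarrow> word m B' i \<or> word m B' (Suc i)" if "i < m" for i
      using covered_iff_word[OF sub(1) that] covered_iff_word[OF sub(2) that] cov by simp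
  qed (rule m)
  have mem: "j \<in> A \<longleftrightarrow> word m A (Suc j)" for j A by (simp add: word_def)
  have "word m B 0" "\<not> word m B' 0" using last by (simp_all add: word_def)
  from agree_or_swap[OF this]
  have r: "word m B 1" "word m B' (m - 1)"
    and cases: "(\<forall>i. 1 \<le> i \<and> i < m \<longrightarrow> word m B i = word m B' i) \<or>
     (\<not> word m B (m - 1) \<and> (\<forall>i. 1 \<le> i \<and> i < m - 1 \<longrightarrow> word m B i = word m B' i))" by auto
  have idx: "Suc (m - 2) = m - 1" "Suc (m - 1) = m" using m by auto
  from cases show ?thesis
  proof
    assume agree: "\<forall>i. 1 \<le> i \<and> i < m \<longrightarrow> word m B i = word m B' i"
    have "B' = B - {m - 1}"
    proof (rule set_eqI)
      fix j
      show "j \<in> B' \<longleftrightarrow> j \<in> B - {m - 1}"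
      proof (cases "Suc j < m")
        case True
        then show ?thesis using agree[rule_format, of "Suc j"] by (auto simp: word_def)
      next
        case False
        then show ?thesis using last(2) sub by (cases "j = m - 1") auto
      qed
    qed
    moreover have "nbrs m B (m - 1)"
      using r agree[rule_format, of "m - 1"] m by (auto simp: nbrs_def word_def)
    moreover have "perm m (m - 1) = m - 1" by (auto simp: perm_def)
    ultimately have "csel m (Suc (m - 1)) B"
      using sel last(1) by (simp add: insert_absorb)
    then show ?thesis using crit(1) m by (simp add: crit_def)
  next
    assume sw: "\<not> word m B (m - 1) \<and> (\<forall>i. 1 \<le> i \<and> i < m - 1 \<longrightarrow> word m B i = word m B' i)"
    have m2: "m - 2 \<notin> B" "m - 2 \<in> B'" using sw r(2) mem[of "m - 2"] unfolding idx by auto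
    have agree: "j \<in> B \<longleftrightarrow> j \<in> B'" if "j < m - 2" for j
      using sw mem[of j] that by auto
    have "B = insert (m - 1) (B \<inter> {..<m - 2})" "B' = insert (m - 2) (B' \<inter> {..<m - 2})"
    proof -
      have j: "j < m - 2 \<or> j = m - 2 \<or> j = m - 1" if "j < m" for j using that by auto
      show "B = insert (m - 1) (B \<inter> {..<m - 2})" using j sub(1) m2 last by blast
      show "B' = insert (m - 2) (B' \<inter> {..<m - 2})" using j sub(2) m2 last by blast
    qed
    moreover have "B \<inter> {..<m - 2} = B' \<inter> {..<m - 2}" using agree by auto
    ultimately have "card B = Suc (card (B \<inter> {..<m - 2}))" "card B' = Suc (card (B \<inter> {..<m - 2}))"
      by (metis card_insert_disjoint finite_Int finite_lessThan Int_iff lessThan_iff less_irrefl diff_less_mono2 diff_le_mono2 one_le_numeral not_le)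
         (metis \<open>B \<inter> {..<m - 2} = B' \<inter> {..<m - 2}\<close> \<open>B' = insert (m - 2) (B' \<inter> {..<m - 2})\<close> card_insert_disjoint finite_Int finite_lessThan Int_iff lessThan_iff less_irrefl)
    then show ?thesis by simp
  qed
qed

lemma crit_card_eq:
  assumes m: "3 \<le> m" and crit: "crit m B" "crit m B'" and cov: "covered m B = covered m B'"
  shows "card B = card B'"
proof (cases "(m - 1 \<in> B) = (m - 1 \<in> B')")
  case False
  then show ?thesis
    using crit_card_aux[OF m crit cov] crit_card_aux[OF m crit(2,1) cov[symmetric]] by auto
next
  case True
  have sub: "B \<subseteq> {..<m}" "B' \<subseteq> {..<m}" using crit by (auto simp: crit_def)
  have sel: "\<not> csel m (m - 1) B" "\<not> csel m (m - 1) B'"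
    using crit csel_mono[of "m - 1" m] by (auto simp: crit_def)
  interpret stable_pair m "word m B" "word m B'"
  proof
    show "stable m (word m B)" "stable m (word m B')" using stable_word sel m by auto
    show "word m B i \<or> word m B (Suc i) \<longleftrightarrow> word m B' i \<or> word m B' (Suc i)" if "i < m" for i
      using covered_iff_word[OF sub(1) that] covered_iff_word[OF sub(2) that] cov by simp
  qed (rule m)
  have "B = B'"
  proof (rule set_eqI)
    fix j
    show "j \<in> B \<longleftrightarrow> j \<in> B'"
    proof (cases "Suc j < m")
      case True
      then show ?thesis
        using agree_if_eq_0[of "Suc j"] \<open>(m - 1 \<in> B) = (m - 1 \<in> B')\<close> by (simp add: word_def)
    next
      case False
      then show ?thesis using True sub by (cases "j = m - 1") auto
    qed
  qed
  then show ?thesis by simp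
qed

text \<open>Otherwise \<open>B\<close> equals the set it covers and is closed under passing to the
  next edge. Then it is the whole cycle, which step 0 selects.\<close>

lemma crit_card_less:
  assumes m: "3 \<le> m" and crit: "crit m B" and ne: "B \<noteq> {}"
  shows "card B < card (covered m B)"
proof (rule ccontr)
  assume le: "\<not> card B < card (covered m B)"
  have sub: "B \<subseteq> {..<m}" using crit by (auto simp: crit_def)
  have "finite B" using sub finite_subset by blast
  then have "finite (covered m B)" by (simp add: covered_def)
  moreover have "B \<subseteq> covered m B" by (auto simp: covered_def)
  ultimately have "B = covered m B" using le by (intro card_seteq) auto
  then have closed: "Suc j mod m \<in> B" if "j \<in> B" for j using that by (auto simp: covered_def)
  obtain j where j: "j \<in> B" using ne by blast
  have orbit: "(j + n) mod m \<in> B" for n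
  proof (induction n)
    case 0
    then show ?case using j sub by auto
  next
    case (Suc n)
    then show ?case using closed[OF Suc] by (simp add: mod_Suc_eq)
  qed
  have full: "x \<in> B" if "x < m" for x
    using orbit[of "x + m - j"] that j sub by (auto simp: subset_iff)
  have "csel m (Suc 0) B"
    using full m by (simp add: nbrs_def perm_def)
  then have "csel m m B" using csel_mono[of "Suc 0" m m B] m by simp
  then show False using crit by (simp add: crit_def)
qed

section \<open>The wheel\<close>

text \<open>A form symmetric in the two ends of the selected edge, so that no case distinction on
  \<open>j \<in> \<sigma>\<close> is needed later.\<close>

lemma selected_Suc_iff:
  assumes "\<sigma> \<subseteq> {..<length ms}" "j < length ms"
  shows "selected ms (Suc j) \<sigma> \<longleftrightarrow> selected ms j \<sigma> \<or>
    (mlcm ms (\<sigma> - {j}) = mlcm ms (insert j \<sigma>) \<and> \<not> selected ms j (\<sigma> - {j}) \<and> \<not> selected ms j (insert j \<sigma>))"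
proof -
  have ins: "insert j (\<sigma> - {j}) = insert j \<sigma>" by blast
  have "(\<exists>\<rho>\<in>lower ms j. \<sigma> = \<rho> \<or> \<sigma> = insert j \<rho>) \<longleftrightarrow> \<sigma> - {j} \<in> lower ms j"
  proof
    assume "\<exists>\<rho>\<in>lower ms j. \<sigma> = \<rho> \<or> \<sigma> = insert j \<rho>"
    then obtain \<rho> where \<rho>: "\<rho> \<in> lower ms j" "\<sigma> = \<rho> \<or> \<sigma> = insert j \<rho>" by blast
    then have "j \<notin> \<rho>" by (simp add: lower_def)
    then have "\<sigma> - {j} = \<rho>" using \<rho>(2) by blast
    then show "\<sigma> - {j} \<in> lower ms j" using \<rho>(1) by simp
  next
    assume l: "\<sigma> - {j} \<in> lower ms j"
    show "\<exists>\<rho>\<in>lower ms j. \<sigma> = \<rho> \<or> \<sigma> = insert j \<rho>"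
      by (rule bexI[OF _ l]) blast
  qed
  also have "\<dots> \<longleftrightarrow> mlcm ms (\<sigma> - {j}) = mlcm ms (insert j \<sigma>) \<and> \<not> selected ms j (\<sigma> - {j}) \<and> \<not> selected ms j (insert j \<sigma>)"
    using assms unfolding lower_def mem_Collect_eq ins by blast
  finally show ?thesis unfolding selected_Suc by simp
qed

definition sqf :: "'n set \<Rightarrow> 'n mono" where
  "sqf S v = (if v \<in> S then 1 else 0)"

lemma sqf_le_iff [simp]: "sqf S \<le> sqf T \<longleftrightarrow> S \<subseteq> T"
  by (auto simp: sqf_def le_fun_def)

lemma sqf_eq_iff [simp]: "sqf S = sqf T \<longleftrightarrow> S = T"
  by (auto simp: sqf_def fun_eq_iff)

lemma mlcm_sqf:
  assumes "finite \<sigma>" "\<And>i. i \<in> \<sigma> \<Longrightarrow> ms ! i = sqf (S i)"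
  shows "mlcm ms \<sigma> = sqf (\<Union>i\<in>\<sigma>. S i)"
proof
  fix v
  have "(\<lambda>i. (ms ! i) v) ` \<sigma> = (\<lambda>i. sqf (S i) v) ` \<sigma>" using assms(2) by (intro image_cong refl) simp
  then have eq: "mlcm ms \<sigma> v = Max (insert 0 ((\<lambda>i. sqf (S i) v) ` \<sigma>))" by (simp add: mlcm_def)
  show "mlcm ms \<sigma> v = sqf (\<Union>i\<in>\<sigma>. S i) v"
  proof (cases "v \<in> (\<Union>i\<in>\<sigma>. S i)")
    case True
    then have "1 \<in> (\<lambda>i. sqf (S i) v) ` \<sigma>" by (force simp: sqf_def)
    then show ?thesis unfolding eq using True assms(1)
      by (intro Max_eqI) (auto simp: sqf_def)
  next
    case False
    then show ?thesis unfolding eq using assms(1)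
      by (intro Max_eqI) (auto simp: sqf_def)
  qed
qed

lemma covered_subset: "0 < m \<Longrightarrow> B \<subseteq> {..<m} \<Longrightarrow> covered m B \<subseteq> {..<m}"
  by (auto simp: covered_def)

lemma covered_empty_iff [simp]: "covered m B = {} \<longleftrightarrow> B = {}"
  by (auto simp: covered_def)

lemma covered_insert: "covered m (insert p B) = {p, Suc p mod m} \<union> covered m (B - {p})"
  by (auto simp: covered_def)

lemma nbrs_iff_covered:
  assumes m: "3 \<le> m" and B: "B \<subseteq> {..<m}" and p: "p < m"
  shows "nbrs m B p \<longleftrightarrow> {p, Suc p mod m} \<subseteq> covered m (B - {p})"
proof -
  define n where "n = Suc p mod m"
  have n: "n < m" "n = (if Suc p = m then 0 else Suc p)" "n \<noteq> p" using m p by (cases "Suc p = m"; auto simp: n_def)+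
  have sub: "B - {p} \<subseteq> {..<m}" using B by blast
  have "p \<in> covered m (B - {p}) \<longleftrightarrow> (if p = 0 then m - 1 \<in> B else p - 1 \<in> B)"
    unfolding covered_iff_word[OF sub p] using m p by (auto simp: word_def)
  moreover have "n \<in> covered m (B - {p}) \<longleftrightarrow> n \<in> B"
    unfolding covered_iff_word[OF sub n(1)] using m p n by (auto simp: word_def split: if_splits)
  ultimately show ?thesis
    using n(2) unfolding nbrs_def n_def[symmetric] by (auto split: if_splits)
qed

locale wheel_order =
  fixes h :: 'n and vs :: "'n list" and m :: nat
  assumes dist: "distinct vs" and h: "h \<notin> set vs" and len: "length vs = m" and m: "3 \<le> m"
begin

definition supp :: "nat \<Rightarrow> 'n set" where
  "supp i = (if i < m then {h, vs ! i} else {vs ! perm m (i - m), vs ! (Suc (perm m (i - m)) mod m)})"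

definition ms :: "'n mono list" where
  "ms = map (\<lambda>i. sqf (supp i)) [0..<m + m]"

definition spokes :: "nat set \<Rightarrow> nat set" where
  "spokes \<sigma> = \<sigma> \<inter> {..<m}"

text \<open>\<open>perm m\<close> is an involution, so edge \<open>j\<close> of the cycle stands at
  position \<open>m + perm m j\<close>.\<close>

definition rim :: "nat set \<Rightarrow> nat set" where
  "rim \<sigma> = {j. j < m \<and> m + perm m j \<in> \<sigma>}"

lemma length_ms [simp]: "length ms = m + m"
  by (simp add: ms_def)

lemma nth_ms: "i < m + m \<Longrightarrow> ms ! i = sqf (supp i)"
  by (simp add: ms_def del: upt_Suc)

lemma rim_subset: "rim \<sigma> \<subseteq> {..<m}"
  by (auto simp: rim_def)

lemma covered_rim: "covered m (rim \<sigma>) \<subseteq> {..<m}"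
  using covered_subset rim_subset m by simp

lemma finite_covered_rim: "finite (covered m (rim \<sigma>))"
  using covered_rim finite_subset by blast

lemma Union_supp:
  assumes "\<sigma> \<subseteq> {..<m + m}"
  shows "(\<Union>i\<in>\<sigma>. supp i) = (if spokes \<sigma> = {} then {} else {h}) \<union> (!) vs ` (spokes \<sigma> \<union> covered m (rim \<sigma>))"
proof -
  have "\<sigma> = spokes \<sigma> \<union> (\<lambda>j. m + perm m j) ` rim \<sigma>"
  proof (intro equalityI subsetI)
    fix i assume i: "i \<in> \<sigma>"
    show "i \<in> spokes \<sigma> \<union> (\<lambda>j. m + perm m j) ` rim \<sigma>"
    proof (cases "i < m")
      case False
      then have "i = m + perm m (perm m (i - m))" "perm m (i - m) \<in> rim \<sigma>"
        using i assms perm_less[of "i - m" m] by (auto simp: rim_def)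
      then show ?thesis by blast
    qed (use i in \<open>simp add: spokes_def\<close>)
  qed (auto simp: spokes_def rim_def)
  then have "(\<Union>i\<in>\<sigma>. supp i) = (\<Union>i\<in>spokes \<sigma>. supp i) \<union> (\<Union>j\<in>rim \<sigma>. supp (m + perm m j))"
    by (metis UN_Un UN_extend_simps(10))
  also have "(\<Union>i\<in>spokes \<sigma>. supp i) = (if spokes \<sigma> = {} then {} else {h}) \<union> (!) vs ` spokes \<sigma>"
    by (auto simp: supp_def spokes_def)
  also have "(\<Union>j\<in>rim \<sigma>. supp (m + perm m j)) = (!) vs ` covered m (rim \<sigma>)"
    by (auto simp: supp_def covered_def)
  finally show ?thesis by auto
qed

lemma mlcm_ms: "\<sigma> \<subseteq> {..<m + m} \<Longrightarrow> mlcm ms \<sigma> = sqf (\<Union>i\<in>\<sigma>. supp i)"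
  by (rule mlcm_sqf) (auto simp: nth_ms intro: finite_subset)

text \<open>The hub is recorded by the presence of a spoke; a rim vertex is supplied by its own
  spoke or by a rim edge.\<close>

lemma mlcm_eq_iff:
  assumes "\<sigma> \<subseteq> {..<m + m}" "\<tau> \<subseteq> {..<m + m}"
  shows "mlcm ms \<sigma> = mlcm ms \<tau> \<longleftrightarrow> (spokes \<sigma> = {} \<longleftrightarrow> spokes \<tau> = {}) \<and>
    spokes \<sigma> \<union> covered m (rim \<sigma>) = spokes \<tau> \<union> covered m (rim \<tau>)"
proof -
  define f where "f \<rho> = spokes \<rho> \<union> covered m (rim \<rho>)" for \<rho>
  have f: "f \<rho> \<subseteq> {..<m}" for \<rho> using covered_rim by (auto simp: f_def spokes_def)
  have inj: "inj_on ((!) vs) {..<m}" using dist len by (simp add: inj_on_nth)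
  have img: "(!) vs ` f \<rho> \<subseteq> - {h}" for \<rho>
    using f[of \<rho>] h len nth_mem[of _ vs] by auto
  have "mlcm ms \<sigma> = mlcm ms \<tau> \<longleftrightarrow> (if spokes \<sigma> = {} then {} else {h}) \<union> (!) vs ` f \<sigma> = (if spokes \<tau> = {} then {} else {h}) \<union> (!) vs ` f \<tau>"
    by (simp only: mlcm_ms[OF assms(1)] mlcm_ms[OF assms(2)] sqf_eq_iff Union_supp[OF assms(1)] Union_supp[OF assms(2)] f_def)
  also have "\<dots> \<longleftrightarrow> (spokes \<sigma> = {} \<longleftrightarrow> spokes \<tau> = {}) \<and> (!) vs ` f \<sigma> = (!) vs ` f \<tau>"
    using img[of \<sigma>] img[of \<tau>] by (cases "spokes \<sigma> = {}"; cases "spokes \<tau> = {}") auto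
  also have "(!) vs ` f \<sigma> = (!) vs ` f \<tau> \<longleftrightarrow> f \<sigma> = f \<tau>"
    by (rule inj_on_image_eq_iff[OF inj f f])
  finally show ?thesis by (simp add: f_def)
qed

section \<open>The pruning steps of the wheel\<close>

lemma spokes_upd:
  "j < m \<Longrightarrow> spokes (insert j \<sigma>) = insert j (spokes \<sigma>)" "spokes (\<sigma> - {j}) = spokes \<sigma> - {j}"
  "spokes (insert (m + i) \<sigma>) = spokes \<sigma>" "spokes (\<sigma> - {m + i}) = spokes \<sigma>"
  by (auto simp: spokes_def)

lemma rim_upd:
  "j < m \<Longrightarrow> rim (insert j \<sigma>) = rim \<sigma>" "j < m \<Longrightarrow> rim (\<sigma> - {j}) = rim \<sigma>"
  by (auto simp: rim_def)

lemma perm_eq_iff: "perm m j = i \<longleftrightarrow> j = perm m i"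
  by auto

lemma rim_upd':
  "i < m \<Longrightarrow> rim (insert (m + i) \<sigma>) = insert (perm m i) (rim \<sigma>)"
  "i < m \<Longrightarrow> rim (\<sigma> - {m + i}) = rim \<sigma> - {perm m i}"
  using perm_less[of i m] by (auto simp: rim_def perm_eq_iff)

text \<open>Toggling spoke \<open>j\<close> keeps the least common multiple iff another spoke is
  present and the rim edges cover \<open>j\<close>. At the least covered vertex nothing with these
  rim edges is selected yet, so all such faces are matched there. The face with this single spoke
  remains: removing the spoke loses the hub, and adding a spoke at a later covered vertex gives a
  face already matched.\<close>

lemma selected_spokes:
  assumes "j \<le> m" "\<sigma> \<subseteq> {..<m + m}"
  shows "selected ms j \<sigma> \<longleftrightarrow> spokes \<sigma> \<noteq> {} \<and> rim \<sigma> \<noteq> {} \<and> Min (covered m (rim \<sigma>)) < j \<and>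
    spokes \<sigma> \<noteq> {Min (covered m (rim \<sigma>))}"
  using assms
proof (induction j arbitrary: \<sigma>)
  case (Suc j)
  let ?A = "spokes \<sigma>" and ?B = "rim \<sigma>"
  define V where "V = covered m ?B"
  define \<mu> where "\<mu> = Min V"
  have j: "j < m" and sub: "\<sigma> \<subseteq> {..<m + m}" "\<sigma> - {j} \<subseteq> {..<m + m}" "insert j \<sigma> \<subseteq> {..<m + m}" using Suc.prems by auto
  have upd: "spokes (\<sigma> - {j}) = ?A - {j}" "spokes (insert j \<sigma>) = insert j ?A" "rim (\<sigma> - {j}) = ?B" "rim (insert j \<sigma>) = ?B"
    using j by (simp_all add: spokes_upd rim_upd)
  note IH = Suc.IH[OF less_imp_le[OF j] sub(1)] Suc.IH[OF less_imp_le[OF j] sub(2)] Suc.IH[OF less_imp_le[OF j] sub(3)]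
  have lcm: "mlcm ms (\<sigma> - {j}) = mlcm ms (insert j \<sigma>) \<longleftrightarrow> ?A - {j} \<noteq> {} \<and> j \<in> V"
    unfolding mlcm_eq_iff[OF sub(2,3)] upd V_def by auto
  have V: "finite V" "V = {} \<longleftrightarrow> ?B = {}" unfolding V_def by (rule finite_covered_rim, rule covered_empty_iff)
  have min: "\<mu> \<le> j" "?B \<noteq> {}" if "j \<in> V" using that V by (auto simp: \<mu>_def)
  have mem: "\<mu> \<in> V" if "?B \<noteq> {}" using that V unfolding \<mu>_def by (intro Min_in) auto
  have "selected ms (Suc j) \<sigma> \<longleftrightarrow> (?A \<noteq> {} \<and> ?B \<noteq> {} \<and> \<mu> < j \<and> ?A \<noteq> {\<mu>}) \<or>
      ((?A - {j} \<noteq> {} \<and> j \<in> V) \<and>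
       \<not> (?A - {j} \<noteq> {} \<and> ?B \<noteq> {} \<and> \<mu> < j \<and> ?A - {j} \<noteq> {\<mu>}) \<and>
       \<not> (insert j ?A \<noteq> {} \<and> ?B \<noteq> {} \<and> \<mu> < j \<and> insert j ?A \<noteq> {\<mu>}))"
    using selected_Suc_iff[of \<sigma> ms j] sub(1) j unfolding IH lcm upd V_def[symmetric] \<mu>_def[symmetric] by simp
  also have "\<dots> \<longleftrightarrow> ?A \<noteq> {} \<and> ?B \<noteq> {} \<and> \<mu> < Suc j \<and> ?A \<noteq> {\<mu>}"
  proof (cases "\<mu> < j")
    case True
    have "\<not> (?A - {j} \<noteq> {} \<and> j \<in> V \<and> insert j ?A = {\<mu>})" using True by auto
    then show ?thesis using True min by auto
  next
    case False
    have "(?A - {j} \<noteq> {} \<and> j \<in> V) \<longleftrightarrow> ?A \<noteq> {} \<and> ?B \<noteq> {} \<and> \<mu> = j \<and> ?A \<noteq> {\<mu>}"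
      using False min mem by auto
    then show ?thesis using False by auto
  qed
  finally show ?case unfolding V_def \<mu>_def .
qed simp

text \<open>A face with rim edges that survives the spoke steps has no spoke or one at a vertex
  covered by its rim edges. Hence a rim edge is redundant in it exactly when it is redundant in the
  cycle.\<close>

lemma selected_rim:
  assumes "i \<le> m" "\<sigma> \<subseteq> {..<m + m}"
  shows "selected ms (m + i) \<sigma> \<longleftrightarrow> selected ms m \<sigma> \<or> csel m i (rim \<sigma>)"
  using assms
proof (induction i arbitrary: \<sigma>)
  case (Suc i)
  let ?A = "spokes \<sigma>" and ?B = "rim \<sigma>" and ?\<sigma>1 = "insert (m + i) \<sigma>" and ?\<sigma>0 = "\<sigma> - {m + i}"
  define p where "p = perm m i"
  have i: "i < m" "i \<le> m" and sub: "\<sigma> \<subseteq> {..<m + m}" "?\<sigma>0 \<subseteq> {..<m + m}" "?\<sigma>1 \<subseteq> {..<m + m}" using Suc.prems by auto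
  have p: "p < m" using perm_less i by (simp add: p_def)
  have upd: "spokes ?\<sigma>1 = ?A" "spokes ?\<sigma>0 = ?A" "rim ?\<sigma>1 = insert p ?B" "rim ?\<sigma>0 = ?B - {p}"
    using i by (simp_all add: spokes_upd(3,4) rim_upd' p_def)
  note IH = Suc.IH[OF i(2) sub(1)] Suc.IH[OF i(2) sub(2)] Suc.IH[OF i(2) sub(3)]
  have sel: "selected ms m \<tau> \<longleftrightarrow> spokes \<tau> \<noteq> {} \<and> rim \<tau> \<noteq> {} \<and> spokes \<tau> \<noteq> {Min (covered m (rim \<tau>))}"
    if "\<tau> \<subseteq> {..<m + m}" for \<tau>
  proof -
    have "Min (covered m (rim \<tau>)) < m" if "rim \<tau> \<noteq> {}"
      using Min_in[OF finite_covered_rim, of \<tau>] that covered_rim[of \<tau>] by auto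
    then show ?thesis using selected_spokes[OF order.refl that] by blast
  qed
  have np: "Suc p mod m \<noteq> p" using m p by (cases "Suc p = m") auto
  have nb: "nbrs m ?B p \<longleftrightarrow> {p, Suc p mod m} \<subseteq> covered m (?B - {p})"
    by (rule nbrs_iff_covered[OF m rim_subset p])
  have lcm: "mlcm ms ?\<sigma>0 = mlcm ms ?\<sigma>1 \<longleftrightarrow> {p, Suc p mod m} \<subseteq> ?A \<union> covered m (?B - {p})"
    unfolding mlcm_eq_iff[OF sub(2,3)] upd covered_insert by auto
  have "selected ms (Suc (m + i)) \<sigma> \<longleftrightarrow> selected ms (m + i) \<sigma> \<or>
      (mlcm ms ?\<sigma>0 = mlcm ms ?\<sigma>1 \<and> \<not> selected ms (m + i) ?\<sigma>0 \<and> \<not> selected ms (m + i) ?\<sigma>1)"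
    using selected_Suc_iff[of \<sigma> ms "m + i"] sub(1) i(1) by simp
  also have "\<dots> \<longleftrightarrow> selected ms m \<sigma> \<or> csel m i ?B \<or>
      ((mlcm ms ?\<sigma>0 = mlcm ms ?\<sigma>1 \<and> \<not> selected ms m ?\<sigma>0 \<and> \<not> selected ms m ?\<sigma>1) \<and>
        \<not> csel m i (?B - {p}) \<and> \<not> csel m i (insert p ?B))"
    unfolding IH upd by blast
  also have "\<dots> \<longleftrightarrow> selected ms m \<sigma> \<or> csel m i ?B \<or>
      (nbrs m ?B p \<and> \<not> csel m i (?B - {p}) \<and> \<not> csel m i (insert p ?B))"
  proof (cases "selected ms m \<sigma>")
    case False
    have "(mlcm ms ?\<sigma>0 = mlcm ms ?\<sigma>1 \<and> \<not> selected ms m ?\<sigma>0 \<and> \<not> selected ms m ?\<sigma>1) \<longleftrightarrow> nbrs m ?B p"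
    proof
      assume nbrs: "nbrs m ?B p"
      then have c: "{p, Suc p mod m} \<subseteq> covered m (?B - {p})" using nb by blast
      then have c1: "covered m (insert p ?B) = covered m (?B - {p})" unfolding covered_insert by blast
      have "covered m (?B - {p}) \<subseteq> covered m ?B" "covered m ?B \<subseteq> covered m (insert p ?B)"
        by (auto simp: covered_def)
      then have c2: "covered m ?B = covered m (?B - {p})" unfolding c1 by (rule equalityI[rotated])
      have "?B - {p} \<noteq> {}" using c by (auto simp: covered_def)
      then have "?B \<noteq> {}" by blast
      then have "?A = {} \<or> ?A = {Min (covered m ?B)}" using False sel[OF sub(1)] by blast
      then have "\<not> selected ms m ?\<sigma>0 \<and> \<not> selected ms m ?\<sigma>1"
        unfolding sel[OF sub(2)] sel[OF sub(3)] upd c1 c2 by blast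
      then show "mlcm ms ?\<sigma>0 = mlcm ms ?\<sigma>1 \<and> \<not> selected ms m ?\<sigma>0 \<and> \<not> selected ms m ?\<sigma>1"
        using lcm c by blast
    next
      assume l: "mlcm ms ?\<sigma>0 = mlcm ms ?\<sigma>1 \<and> \<not> selected ms m ?\<sigma>0 \<and> \<not> selected ms m ?\<sigma>1"
      then have c: "{p, Suc p mod m} \<subseteq> ?A \<union> covered m (?B - {p})" using lcm by blast
      have A: "?A = {} \<or> ?A = {Min (covered m (insert p ?B))}" "?A = {} \<or> ?B - {p} = {} \<or> ?A = {Min (covered m (?B - {p}))}"
        using l sel[OF sub(2)] sel[OF sub(3)] unfolding upd by blast+
      have "?A \<subseteq> covered m (?B - {p})"
      proof (cases "?B - {p} = {}")
        \<comment> \<open>Without a further rim edge both ends of \<open>p\<close> would carry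
          spokes. But the face with \<open>p\<close> inserted has survived the spoke steps, so it
          has at most one spoke.\<close>
        case True
        then have "{p, Suc p mod m} \<subseteq> ?A" using c unfolding True by (simp add: covered_def)
        then show ?thesis using A(1) np by auto
      next
        case False
        then have "Min (covered m (rim ?\<sigma>0)) \<in> covered m (rim ?\<sigma>0)"
          unfolding upd(4)[symmetric] using finite_covered_rim by (intro Min_in) auto
        then show ?thesis using A(2) False unfolding upd by (metis empty_subsetI insert_subset)
      qed
      then show "nbrs m ?B p" using c nb by blast
    qed
    then show ?thesis by simp
  qed simp
  finally show ?case by (auto simp: p_def)
qed simp

section \<open>Critical faces of the wheel\<close>

lemma critical_cases:
  assumes "\<sigma> \<in> critical_faces ms"
  shows "\<sigma> \<subseteq> {..<m + m}" "crit m (rim \<sigma>)"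
    "spokes \<sigma> = {} \<or> rim \<sigma> = {} \<or> spokes \<sigma> = {Min (covered m (rim \<sigma>))}"
proof -
  show s: "\<sigma> \<subseteq> {..<m + m}" using assms by (simp add: critical_iff)
  have ns: "\<not> selected ms m \<sigma>" "\<not> csel m m (rim \<sigma>)"
    using assms selected_rim[OF order.refl s] by (simp_all add: critical_iff)
  then show "crit m (rim \<sigma>)" by (simp add: crit_def rim_subset)
  have "Min (covered m (rim \<sigma>)) < m" if "rim \<sigma> \<noteq> {}"
    using Min_in[OF finite_covered_rim, of \<sigma>] that covered_rim[of \<sigma>] by auto
  then show "spokes \<sigma> = {} \<or> rim \<sigma> = {} \<or> spokes \<sigma> = {Min (covered m (rim \<sigma>))}"
    using ns(1) selected_spokes[OF order.refl s] by blast
qed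

lemma card_face:
  assumes "\<sigma> \<subseteq> {..<m + m}"
  shows "card \<sigma> = card (spokes \<sigma>) + card (rim \<sigma>)"
proof -
  have "bij_betw (\<lambda>j. m + perm m j) (rim \<sigma>) (\<sigma> - {..<m})"
    unfolding bij_betw_def
  proof (intro conjI equalityI subsetI)
    show "inj_on (\<lambda>j. m + perm m j) (rim \<sigma>)" by (rule inj_onI) (metis add_left_cancel perm_perm)
  next
    fix i assume i: "i \<in> \<sigma> - {..<m}"
    then have "i = m + perm m (perm m (i - m))" "perm m (i - m) \<in> rim \<sigma>"
      using assms perm_less[of "i - m" m] by (auto simp: rim_def)
    then show "i \<in> (\<lambda>j. m + perm m j) ` rim \<sigma>" by blast
  qed (auto simp: rim_def)
  then have "card (rim \<sigma>) = card (\<sigma> - {..<m})" by (rule bij_betw_same_card)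
  moreover have "card \<sigma> = card (\<sigma> \<inter> {..<m}) + card (\<sigma> - {..<m})"
    using assms finite_subset by (subst card_Un_disjoint[symmetric]) (auto simp: Int_Diff_Un)
  ultimately show ?thesis by (simp add: spokes_def)
qed

lemma nonadjacent:
  assumes "\<sigma> \<in> critical_faces ms" "\<tau> \<in> critical_faces ms" "mlcm ms \<sigma> = mlcm ms \<tau>"
    and card: "card \<sigma> = Suc (card \<tau>)" and j: "j \<in> \<sigma>"
  shows "mlcm ms (\<sigma> - {j}) \<noteq> mlcm ms \<sigma>"
proof -
  note s = critical_cases[OF assms(1)] and t = critical_cases[OF assms(2)]
  have eq: "spokes \<sigma> = {} \<longleftrightarrow> spokes \<tau> = {}" "spokes \<sigma> \<union> covered m (rim \<sigma>) = spokes \<tau> \<union> covered m (rim \<tau>)"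
    using mlcm_eq_iff[OF s(1) t(1)] assms(3) by auto
  have card': "card (spokes \<sigma>) + card (rim \<sigma>) = Suc (card (spokes \<tau>) + card (rim \<tau>))"
    using card card_face[OF s(1)] card_face[OF t(1)] by simp
  have min: "Min (covered m (rim \<rho>)) \<in> covered m (rim \<rho>)" if "rim \<rho> \<noteq> {}" for \<rho>
    using Min_in[OF finite_covered_rim] that by simp
  consider "spokes \<sigma> = {}" | "rim \<sigma> = {}" | "spokes \<sigma> \<noteq> {}" "rim \<sigma> \<noteq> {}" by blast
  then show ?thesis
  proof cases
    case 1
    then have "spokes \<tau> = {}" "covered m (rim \<sigma>) = covered m (rim \<tau>)" using eq by auto
    then have "card (rim \<sigma>) = card (rim \<tau>)" using crit_card_eq[OF m s(2) t(2)] by blast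
    then show ?thesis using card' 1 \<open>spokes \<tau> = {}\<close> by simp
  next
    case 2
    have "j < m"
    proof (rule ccontr)
      assume "\<not> j < m"
      then have "perm m (j - m) \<in> rim \<sigma>" using j s(1) perm_less[of "j - m" m] by (auto simp: rim_def)
      then show False using 2 by simp
    qed
    then have "j \<in> spokes \<sigma>" "spokes (\<sigma> - {j}) = spokes \<sigma> - {j}" "rim (\<sigma> - {j}) = {}"
      using j 2 by (simp_all add: spokes_def[of \<sigma>] spokes_upd rim_upd)
    moreover from this have "spokes (\<sigma> - {j}) \<union> covered m (rim (\<sigma> - {j})) \<noteq> spokes \<sigma> \<union> covered m (rim \<sigma>)"
      using 2 by (auto simp: covered_def)
    moreover have "\<sigma> - {j} \<subseteq> {..<m + m}" using s(1) by blast
    ultimately show ?thesis using mlcm_eq_iff[of "\<sigma> - {j}" \<sigma>] s(1) by blast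
  next
    case 3
    then have A: "spokes \<sigma> = {Min (covered m (rim \<sigma>))}" using s(3) by blast
    then have c: "spokes \<tau> \<union> covered m (rim \<tau>) = covered m (rim \<sigma>)"
      using eq(2) insert_absorb[OF min[OF 3(2)]] by simp
    show ?thesis
    proof (cases "rim \<tau> = {}")
      \<comment> \<open>Now \<open>\<tau>\<close> consists of spokes only, and the sizes would force
        the rim part of \<open>\<sigma>\<close> to be as large as the set it covers.\<close>
      case True
      then have "spokes \<tau> = covered m (rim \<sigma>)" using c by (simp add: covered_def)
      then have "card (rim \<sigma>) = card (covered m (rim \<sigma>))" using card' A True by simp
      then show ?thesis using crit_card_less[OF m s(2) 3(2)] by simp
    next
      case False
      then have A': "spokes \<tau> = {Min (covered m (rim \<tau>))}" using t(3) 3(1) eq(1) by blast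
      then have "covered m (rim \<sigma>) = covered m (rim \<tau>)"
        using c insert_absorb[OF min[OF False]] by simp
      then have "card (rim \<sigma>) = card (rim \<tau>)" using crit_card_eq[OF m s(2) t(2)] by blast
      then show ?thesis using card' A A' by simp
    qed
  qed
qed

section \<open>The generators as the edges of the wheel\<close>

lemma card_supp: "i < m + m \<Longrightarrow> card (supp i) = 2"
proof (cases "i < m")
  case True
  then have "vs ! i \<noteq> h" using h len nth_mem[of i vs] by auto
  then show ?thesis using True by (simp add: supp_def)
next
  case False
  assume i: "i < m + m"
  define p where "p = perm m (i - m)"
  have p: "p < m" unfolding p_def using i False by (intro perm_less) auto
  have "Suc p mod m \<noteq> p" "Suc p mod m < m" using m p by (cases "Suc p = m", auto)+
  then have "vs ! p \<noteq> vs ! (Suc p mod m)" using nth_eq_iff_index_eq[OF dist] len p by simp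
  then show ?thesis using False by (simp add: supp_def p_def[symmetric])
qed

lemma inj_supp: "inj_on supp {..<m + m}"
proof (rule inj_onI)
  fix i j assume ij: "i \<in> {..<m + m}" "j \<in> {..<m + m}" "supp i = supp j"
  have mod: "Suc p mod m = (if Suc p = m then 0 else Suc p)" "Suc p mod m < m" if "p < m" for p using that by auto
  have hm: "h \<in> supp k \<longleftrightarrow> k < m" if "k < m + m" for k
  proof (cases "k < m")
    case False
    then have "perm m (k - m) < m" using that by (intro perm_less) auto
    then have "vs ! perm m (k - m) \<noteq> h" "vs ! (Suc (perm m (k - m)) mod m) \<noteq> h"
      using h len nth_mem[of _ vs] mod(2) by metis+
    then show ?thesis using False by (simp add: supp_def)
  qed (simp add: supp_def)
  have nth_eq: "vs ! a = vs ! b \<longleftrightarrow> a = b" if "a < m" "b < m" for a b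
    using nth_eq_iff_index_eq[OF dist] len that by simp
  show "i = j"
  proof (cases "i < m")
    case True
    then have "j < m" using hm[of i] hm[of j] ij by simp
    then have "vs ! i = vs ! j" using ij(3) True h len nth_mem[of _ vs] by (auto simp: supp_def doubleton_eq_iff)
    then show ?thesis using nth_eq True \<open>j < m\<close> by simp
  next
    case False
    then have "\<not> j < m" using hm[of i] hm[of j] ij by simp
    define p q where "p = perm m (i - m)" and "q = perm m (j - m)"
    have pq: "p < m" "q < m" unfolding p_def q_def using ij False \<open>\<not> j < m\<close> by (auto intro!: perm_less)
    have "{vs ! p, vs ! (Suc p mod m)} = {vs ! q, vs ! (Suc q mod m)}"
      using ij(3) False \<open>\<not> j < m\<close> by (simp add: supp_def p_def q_def)
    then have "p = q \<or> (p = Suc q mod m \<and> Suc p mod m = q)"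
      unfolding doubleton_eq_iff using nth_eq pq mod(2) by auto
    \<comment> \<open>The other alternative says that \<open>p\<close> and \<open>q\<close> are
      successors of each other, that is, a cycle of length 2.\<close>
    then have "p = q" using mod(1)[OF pq(1)] mod(1)[OF pq(2)] m by (auto split: if_splits)
    then have "i - m = j - m" unfolding p_def q_def using perm_perm by metis
    then show ?thesis using False \<open>\<not> j < m\<close> by simp
  qed
qed

lemma set_ms: "set ms = sqf ` supp ` {..<m + m}"
  by (auto simp: ms_def)

lemma distinct_ms: "distinct ms"
  using inj_supp by (auto simp: ms_def distinct_map inj_on_def)

lemma supp_image:
  "supp ` {..<m + m} = {{vs ! i, vs ! (Suc i mod m)} | i. i < m} \<union> {{h, v} | v. v \<in> set vs}"
proof (intro equalityI subsetI)
  fix S assume "S \<in> supp ` {..<m + m}"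
  then obtain i where i: "i < m + m" "S = supp i" by auto
  show "S \<in> {{vs ! i, vs ! (Suc i mod m)} | i. i < m} \<union> {{h, v} | v. v \<in> set vs}"
  proof (cases "i < m")
    case True
    then show ?thesis using i len by (auto simp: supp_def)
  next
    case False
    then have "perm m (i - m) < m" using i by (intro perm_less) auto
    then show ?thesis using i False by (auto simp: supp_def)
  qed
next
  fix S assume "S \<in> {{vs ! i, vs ! (Suc i mod m)} | i. i < m} \<union> {{h, v} | v. v \<in> set vs}"
  then show "S \<in> supp ` {..<m + m}"
  proof
    assume "S \<in> {{vs ! i, vs ! (Suc i mod m)} | i. i < m}"
    then obtain i where "i < m" "S = {vs ! i, vs ! (Suc i mod m)}" by blast
    then show ?thesis
      by (intro image_eqI[of _ _ "m + perm m i"]) (simp_all add: supp_def perm_less)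
  next
    assume "S \<in> {{h, v} | v. v \<in> set vs}"
    then obtain i where "i < m" "S = {h, vs ! i}" using len by (auto simp: in_set_conv_nth)
    then show ?thesis by (intro image_eqI[of _ _ i]) (simp_all add: supp_def)
  qed
qed

lemma minimal_pruned_order_wheel:
  "minimal_pruned_order (ideal_gen (monom ` set ms) :: ('n, 'k::field) mpoly set) ms"
proof (rule minimal_pruned_orderI[OF refl distinct_ms _ _ nonadjacent])
  show "min_gens (ideal_gen (monom ` set ms) :: ('n, 'k) mpoly set) = set ms"
  proof (rule min_gens_antichain)
    fix a b assume ab: "a \<in> set ms" "b \<in> set ms" "a \<le> b"
    then obtain i j where ij: "i < m + m" "j < m + m" "a = sqf (supp i)" "b = sqf (supp j)"
      by (auto simp: set_ms)
    then have "supp i \<subseteq> supp j" using ab(3) by simp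
    moreover have "finite (supp j)" using card_supp[OF ij(2)] by (intro card_ge_0_finite) simp
    ultimately have "supp i = supp j" using card_supp[OF ij(1)] card_supp[OF ij(2)] by (intro card_subset_eq) auto
    then show "a = b" using ij by simp
  qed
  show "0 \<notin> set ms"
  proof
    assume "0 \<in> set ms"
    then obtain i where i: "i < m + m" "0 = sqf (supp i)" by (auto simp: set_ms)
    have "(0 :: 'n mono) = sqf {}" by (simp add: sqf_def fun_eq_iff)
    with i(2) have "sqf (supp i) = sqf {}" by (rule trans[OF sym])
    then have "supp i = {}" by (simp only: sqf_eq_iff)
    then show False using card_supp[OF i(1)] by simp
  qed
qed

end

lemma var_times_var: "i \<noteq> j \<Longrightarrow> (var i * var j :: ('n, 'k::field) mpoly) = monom (sqf {i, j})"
  unfolding var_def monom_def mult_single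
  by (rule arg_cong2[where f = Poly_Mapping.single]) (auto simp: sqf_def fun_eq_iff)

lemma edge_ideal_eq:
  assumes "\<And>S. S \<in> E \<Longrightarrow> card S = 2"
  shows "(edge_ideal E :: ('n, 'k::field) mpoly set) = ideal_gen (monom ` sqf ` E)"
proof -
  have "{var i * var j | i j. {i, j} \<in> E} = (monom ` sqf ` E :: ('n, 'k) mpoly set)"
  proof (intro equalityI subsetI)
    fix x :: "('n, 'k) mpoly" assume "x \<in> {var i * var j | i j. {i, j} \<in> E}"
    then obtain i j where ij: "x = var i * var j" "{i, j} \<in> E" by blast
    then have "i \<noteq> j" using assms[OF ij(2)] by auto
    then have "x = monom (sqf {i, j})" unfolding ij(1) by (rule var_times_var)
    then show "x \<in> monom ` sqf ` E" using ij(2) by (simp only: imageI)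
  next
    fix x :: "('n, 'k) mpoly" assume "x \<in> monom ` sqf ` E"
    then obtain S where S: "S \<in> E" "x = monom (sqf S)" by blast
    obtain i j where ij: "S = {i, j}" "i \<noteq> j" using assms[OF S(1)] unfolding card_2_iff by blast
    have "x = var i * var j" unfolding S(2) ij(1) by (rule var_times_var[OF ij(2), symmetric])
    then show "x \<in> {var i * var j | i j. {i, j} \<in> E}" using S(1) unfolding ij(1) by (intro CollectI exI conjI)
  qed
  then show ?thesis by (simp add: edge_ideal_def)
qed

theorem corollary6p22:
  fixes E :: "'n::finite set set" and I :: "('n, 'k::field) mpoly set"
  assumes "wheel E" and "I = edge_ideal E"
  shows "admits_minimal_pruned_resolution I"
proof -
  obtain h C where C: "cycle_on (UNIV - {h}) C" "E = C \<union> {{h, v} | v. v \<noteq> h}"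
    using assms(1) unfolding wheel_def by (elim exE conjE) (rule that)
  obtain vs where vs: "distinct vs" "set vs = UNIV - {h}" "3 \<le> length vs"
    "C = {{vs ! i, vs ! (Suc i mod length vs)} | i. i < length vs}"
    using C(1) unfolding cycle_on_def by (elim exE conjE) (rule that)
  interpret wheel_order h vs "length vs"
    by standard (use vs in auto)
  have E: "E = supp ` {..<length vs + length vs}"
    unfolding supp_image C(2) vs(2,4) by simp
  have I: "I = ideal_gen (monom ` set ms)"
    unfolding assms(2) set_ms E by (rule edge_ideal_eq) (use card_supp in auto)
  show ?thesis
  proof (rule admits_minimal_pruned_resolution.order)
    show "monomial_ideal I" unfolding monomial_ideal_def I by (rule exI) (rule refl)
    show "minimal_pruned_order I ms" unfolding I by (rule minimal_pruned_order_wheel)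
  qed
qed

end
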